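(* Let $k$ be a field, let $\sigma$ be a 3-dimensional simplicial cone in $\mathbb{R}^3$, and let $X=\operatorname{Spec}(k[\sigma^{\vee}\cap\mathbb{Z}^3])$ be the associated affine, simplicial toric 3-fold over $k$. Then the Chow group $A^1(X)$ has order $|\delta|$, where $\delta$ is the determinant of the $3\times 3$ matrix whose columns are the minimal generators of the cone $\sigma$.
   Context: A simplicial cone is a strongly convex, rational (with respect to $\mathbb{Z}^3\subset\mathbb{R}^3$), polyhedral cone whose minimal generators are linearly independent over $\mathbb{R}$; the minimal generators are the primitive vectors of $\mathbb{Z}^3$ spanning the rays of $\sigma$. The dual cone is $\sigma^{\vee}=\{m\in\mathbb{R}^3 : \langle m,u\rangle\geq 0 \text{ for all } u\in\sigma\}$, and $k[\sigma^{\vee}\cap\mathbb{Z}^3]$ is the semigroup algebra. $A^1(X)$ denotes the Chow group of codimension 1 cycles on $X$ modulo rational equivalence (the divisor class group of $X$). *)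

theory Defs
  imports
    "HOL-Analysis.Analysis"
    "HOL-Algebra.QuotRing"
    "HOL-Algebra.Free_Abelian_Groups"
begin

section \<open>Rational cones\<close>

definition real_vec :: "int ^ 'n \<Rightarrow> real ^ 'n" where
  "real_vec v = (\<chi> i. real_of_int (v $ i))"

definition rational_polyhedral_cone :: "(real ^ 'n) set \<Rightarrow> bool" where
  "rational_polyhedral_cone \<sigma> \<longleftrightarrow>
     (\<exists>V :: (int ^ 'n) set. finite V \<and> \<sigma> = convex_cone hull (real_vec ` V))"

definition strongly_convex :: "(real ^ 'n) set \<Rightarrow> bool" where
  "strongly_convex \<sigma> \<longleftrightarrow> \<sigma> \<inter> uminus ` \<sigma> = {0}"

definition primitive_vector :: "int ^ 'n \<Rightarrow> bool" where
  "primitive_vector v \<longleftrightarrow> (GCD i. v $ i) = 1"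

definition ray_of :: "(real ^ 'n) set \<Rightarrow> (real ^ 'n) set \<Rightarrow> bool" where
  "ray_of \<rho> \<sigma> \<longleftrightarrow> \<rho> face_of \<sigma> \<and> dim \<rho> = 1"

definition minimal_generators :: "(real ^ 'n) set \<Rightarrow> (int ^ 'n) set" where
  "minimal_generators \<sigma> =
     {u. primitive_vector u \<and> (\<exists>\<rho>. ray_of \<rho> \<sigma> \<and> \<rho> = {t *\<^sub>R real_vec u | t. 0 \<le> t})}"

definition simplicial_cone :: "(real ^ 'n) set \<Rightarrow> bool" where
  "simplicial_cone \<sigma> \<longleftrightarrow>
     rational_polyhedral_cone \<sigma> \<and> strongly_convex \<sigma> \<and>
     independent (real_vec ` minimal_generators \<sigma>)"

definition dual_cone :: "(real ^ 'n) set \<Rightarrow> (real ^ 'n) set" where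
  "dual_cone \<sigma> = {m. \<forall>u\<in>\<sigma>. 0 \<le> m \<bullet> u}"


section \<open>The coordinate ring of an affine toric variety\<close>

text \<open>
  The type \<open>'a \<Rightarrow>\<^sub>0 'k\<close> of finitely supported functions, with convolution as
  multiplication, is the monoid algebra of all of \<open>'a\<close>; the semigroup algebra \<open>k[S]\<close>
  of a submonoid \<open>S\<close> is its subring of elements supported in \<open>S\<close>.
\<close>

definition semigroup_algebra :: "'a::comm_monoid_add set \<Rightarrow> ('a \<Rightarrow>\<^sub>0 'k::field) ring" where
  "semigroup_algebra S =
     \<lparr>carrier = {f. Poly_Mapping.keys f \<subseteq> S}, monoid.mult = (*), monoid.one = 1, ring.zero = 0, ring.add = (+)\<rparr>"

definition toric_ring :: "(real ^ 'n) set \<Rightarrow> (int ^ 'n \<Rightarrow>\<^sub>0 'k::field) ring" where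
  "toric_ring \<sigma> = semigroup_algebra {m. real_vec m \<in> dual_cone \<sigma>}"


section \<open>Localization, length and height\<close>

definition loc_rel :: "('a, 'b) ring_scheme \<Rightarrow> 'a set \<Rightarrow> (('a \<times> 'a) \<times> ('a \<times> 'a)) set" where
  "loc_rel R S =
     {((a, s), (b, t)). a \<in> carrier R \<and> b \<in> carrier R \<and> s \<in> S \<and> t \<in> S \<and>
        (\<exists>u\<in>S. u \<otimes>\<^bsub>R\<^esub> (a \<otimes>\<^bsub>R\<^esub> t) = u \<otimes>\<^bsub>R\<^esub> (b \<otimes>\<^bsub>R\<^esub> s))}"

definition loc_frac :: "('a, 'b) ring_scheme \<Rightarrow> 'a set \<Rightarrow> 'a \<Rightarrow> 'a \<Rightarrow> ('a \<times> 'a) set" where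
  "loc_frac R S a s = loc_rel R S `` {(a, s)}"

text \<open>
  In \<open>mult\<close> and \<open>add\<close> the union is over equal classes, by independence of representatives.
\<close>

definition localization :: "('a, 'b) ring_scheme \<Rightarrow> 'a set \<Rightarrow> (('a \<times> 'a) set) ring" where
  "localization R S =
     \<lparr>carrier = (carrier R \<times> S) // loc_rel R S,
      monoid.mult = (\<lambda>X Y. \<Union>(a, s)\<in>X. \<Union>(b, t)\<in>Y. loc_frac R S (a \<otimes>\<^bsub>R\<^esub> b) (s \<otimes>\<^bsub>R\<^esub> t)),
      monoid.one = loc_frac R S \<one>\<^bsub>R\<^esub> \<one>\<^bsub>R\<^esub>,
      ring.zero = loc_frac R S \<zero>\<^bsub>R\<^esub> \<one>\<^bsub>R\<^esub>,
      ring.add = (\<lambda>X Y. \<Union>(a, s)\<in>X. \<Union>(b, t)\<in>Y.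
               loc_frac R S ((a \<otimes>\<^bsub>R\<^esub> t) \<oplus>\<^bsub>R\<^esub> (b \<otimes>\<^bsub>R\<^esub> s)) (s \<otimes>\<^bsub>R\<^esub> t))\<rparr>"

text \<open>The length of a commutative ring as a module over itself (its submodules are the ideals).\<close>

definition ring_length :: "('a, 'b) ring_scheme \<Rightarrow> enat" where
  "ring_length B =
     Sup {enat n | n. \<exists>J :: nat \<Rightarrow> 'a set. (\<forall>i\<le>n. ideal (J i) B) \<and> (\<forall>i<n. J i \<subset> J (Suc i))}"

definition height :: "('a, 'b) ring_scheme \<Rightarrow> 'a set \<Rightarrow> enat" where
  "height R P =
     Sup {enat n | n. \<exists>Q :: nat \<Rightarrow> 'a set.
            (\<forall>i\<le>n. primeideal (Q i) R) \<and> Q n = P \<and> (\<forall>i<n. Q i \<subset> Q (Suc i))}"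


section \<open>Codimension 1 cycles modulo rational equivalence\<close>

text \<open>
  Let \<open>R\<close> be a Noetherian integral domain and \<open>X = Spec R\<close>. The integral closed subschemes
  of \<open>X\<close> of codimension 1 are the \<open>V(P)\<close> with \<open>P\<close> prime of height 1; such a subscheme is
  represented by \<open>P\<close>.
\<close>

definition codim1_points :: "('a, 'b) ring_scheme \<Rightarrow> 'a set set" where
  "codim1_points R = {P. primeideal P R \<and> height R P = 1}"

text \<open>
  The order of vanishing of \<open>a \<noteq> 0\<close> along \<open>V(P)\<close> is the length of the \<open>R\<^sub>P\<close>-module
  \<open>R\<^sub>P / a R\<^sub>P\<close>; its submodules are the ideals of the quotient ring. It is finite when \<open>P\<close> has
  height 1 and \<open>R\<close> is a Noetherian domain.
\<close>

definition ord_at :: "('a, 'b) ring_scheme \<Rightarrow> 'a set \<Rightarrow> 'a \<Rightarrow> nat" where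
  "ord_at R P a =
     (let S = carrier R - P; L = localization R S
      in the_enat (ring_length (L Quot (PIdl\<^bsub>L\<^esub> (loc_frac R S a \<one>\<^bsub>R\<^esub>)))))"

definition div_of :: "('a, 'b) ring_scheme \<Rightarrow> 'a \<Rightarrow> 'a set \<Rightarrow>\<^sub>0 int" where
  "div_of R a =
     (\<Sum>P \<in> {P \<in> codim1_points R. ord_at R P a \<noteq> 0}. frag_cmul (int (ord_at R P a)) (frag_of P))"

text \<open>
  The divisor of the rational function \<open>a / b\<close> is \<open>div_of R a - div_of R b\<close>. As \<open>X\<close> is the only
  integral closed subscheme of codimension 0 in itself, these divisors are all the codimension 1
  cycles rationally equivalent to 0.
\<close>

definition principal_divisors :: "('a, 'b) ring_scheme \<Rightarrow> ('a set \<Rightarrow>\<^sub>0 int) set" where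
  "principal_divisors R =
     {div_of R a - div_of R b | a b. a \<in> carrier R - {\<zero>\<^bsub>R\<^esub>} \<and> b \<in> carrier R - {\<zero>\<^bsub>R\<^esub>}}"

definition chow_group1 :: "('a, 'b) ring_scheme \<Rightarrow> ('a set \<Rightarrow>\<^sub>0 int) set monoid" where
  "chow_group1 R = free_Abelian_group (codim1_points R) Mod principal_divisors R"

end

theory Submission
  imports Defs "HOL-Computational_Algebra.Polynomial_Factorial" "HOL-Computational_Algebra.Field_as_Ring"
begin

text \<open>
  The coordinate ring of \<open>X\<close> consists of the Laurent polynomials whose exponents \<open>m\<close> pair
  nonnegatively with the minimal generators \<open>u\<^sub>1, u\<^sub>2, u\<^sub>3\<close>. Inverting the monomials gives the
  Laurent polynomial ring, which is factorial. So a prime divisor of \<open>X\<close> that meets the torus is the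
  zero locus of an irreducible Laurent polynomial, and it is linearly equivalent to a divisor supported
  on the boundary of the torus. The boundary has three components \<open>D\<^sub>1, D\<^sub>2, D\<^sub>3\<close>, one for each ray,
  and these generate the class group. The relations between them are the divisors of the rational
  functions without zeros and poles on the torus. These functions are the terms \<open>c \<chi>\<^sup>m\<close>, with divisor
  \<open>\<langle>m, u\<^sub>1\<rangle> D\<^sub>1 + \<langle>m, u\<^sub>2\<rangle> D\<^sub>2 + \<langle>m, u\<^sub>3\<rangle> D\<^sub>3\<close>. Hence the class group is the quotient of the group of
  integral triples by the lattice of all \<open>(\<langle>m, u\<^sub>1\<rangle>, \<langle>m, u\<^sub>2\<rangle>, \<langle>m, u\<^sub>3\<rangle>)\<close>, which is spanned by the
  rows of the generator matrix, and its order is the index of that lattice.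

  The geometry enters through \<open>full_cone_generator_matrix\<close>: the cone is spanned by its minimal
  generators, and membership in the dual cone is a condition on the three pairings. Factoriality is
  \<open>laurent_prime_factorization\<close>; it is carried over from the polynomial ring in three variables
  along a localization. The index of the lattice is computed in \<open>lattice_index\<close>.

  Orders of vanishing are lengths of quotients of local rings. They are reduced to exponents by
  \<open>ord_at_eq\<close>, which applies to a prime \<open>P\<close> for which some \<open>t \<in> P\<close> is a uniformizer: up to factors
  outside \<open>P\<close>, every nonzero element of the ring is a power of \<open>t\<close>. For the \<open>i\<close>-th ray, \<open>t\<close> is a
  monomial whose exponent has pairing \<open>1\<close> with \<open>u\<^sub>i\<close>; it exists as \<open>u\<^sub>i\<close> is primitive. For a prime
  that meets the torus, \<open>t\<close> is an irreducible Laurent polynomial. A prime with a uniformizer has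
  height one, and every nonzero prime contains one of the primes just described, so there are no
  further primes of height one (\<open>codim1_points_R\<close>).

  The class of a divisor is read off from its weight, an integral triple: \<open>D\<^sub>i\<close> has as weight the
  \<open>i\<close>-th unit vector, and a prime that meets the torus has as weight minus the vector of orders of a
  generator along the \<open>D\<^sub>i\<close>. A principal divisor has its weight in the lattice (\<open>weigh_Div\<close>), and
  every divisor differs by a principal one from the boundary divisor with the same weight
  (\<open>divisor_class_toric\<close>).
\<close>

abbreviation keys where "keys \<equiv> Poly_Mapping.keys"
abbreviation lookup where "lookup \<equiv> Poly_Mapping.lookup"

section \<open>The index of a lattice in three-space\<close>

definition span3 :: "int ^ 3 \<Rightarrow> int ^ 3 \<Rightarrow> int ^ 3 \<Rightarrow> (int ^ 3) set" where
  "span3 a b c = {k *s a + l *s b + m *s c | k l m. True}"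

definition det3 :: "int ^ 3 \<Rightarrow> int ^ 3 \<Rightarrow> int ^ 3 \<Rightarrow> int" where
  "det3 a b c = a$1 * b$2 * c$3 + a$2 * b$3 * c$1 + a$3 * b$1 * c$2
     - a$1 * b$3 * c$2 - a$2 * b$1 * c$3 - a$3 * b$2 * c$1"

text \<open>
  The index is expressed by a system of representatives, because the representatives will
  stand for the divisor classes.
\<close>

definition has_transversal :: "int ^ 3 \<Rightarrow> int ^ 3 \<Rightarrow> int ^ 3 \<Rightarrow> bool" where
  "has_transversal a b c \<longleftrightarrow>
     (\<exists>T. finite T \<and> int (card T) = \<bar>det3 a b c\<bar> \<and> (\<forall>z. \<exists>!r. r \<in> T \<and> z - r \<in> span3 a b c))"

lemma span3I: "x = k *s a + l *s b + m *s c \<Longrightarrow> x \<in> span3 a b c"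
  unfolding span3_def by blast

lemma span3E:
  assumes "x \<in> span3 a b c"
  obtains k l m where "x = k *s a + l *s b + m *s c"
  using assms unfolding span3_def by blast

lemma span3_unimodular_subset:
  "span3 (\<alpha> *s p + \<beta> *s q) (\<gamma> *s p + \<delta> *s q) c \<subseteq> span3 p q c"
proof
  fix x assume "x \<in> span3 (\<alpha> *s p + \<beta> *s q) (\<gamma> *s p + \<delta> *s q) c"
  then obtain k l m where "x = k *s (\<alpha> *s p + \<beta> *s q) + l *s (\<gamma> *s p + \<delta> *s q) + m *s c"
    by (rule span3E)
  then have "x = (k * \<alpha> + l * \<gamma>) *s p + (k * \<beta> + l * \<delta>) *s q + m *s c"
    by (simp add: vec_eq_iff algebra_simps)
  then show "x \<in> span3 p q c" by (rule span3I)
qed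

text \<open>
  A combination of determinant \<open>1\<close> can be undone over the integers, so it changes neither
  the lattice nor the determinant.
\<close>

lemma has_transversal_unimodular:
  assumes det: "\<alpha> * \<delta> - \<beta> * \<gamma> = (1 :: int)"
    and "has_transversal (\<alpha> *s p + \<beta> *s q) (\<gamma> *s p + \<delta> *s q) c"
  shows "has_transversal p q c"
proof -
  let ?p = "\<alpha> *s p + \<beta> *s q" and ?q = "\<gamma> *s p + \<delta> *s q"
  have p: "p = \<delta> *s ?p + (- \<beta>) *s ?q"
  proof -
    have "\<delta> *s ?p + (- \<beta>) *s ?q = (\<alpha> * \<delta> - \<beta> * \<gamma>) *s p"
      by (simp add: vec_eq_iff algebra_simps)
    then show ?thesis by (simp add: det)
  qed
  have q: "q = (- \<gamma>) *s ?p + \<alpha> *s ?q"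
  proof -
    have "(- \<gamma>) *s ?p + \<alpha> *s ?q = (\<alpha> * \<delta> - \<beta> * \<gamma>) *s q"
      by (simp add: vec_eq_iff algebra_simps)
    then show ?thesis by (simp add: det)
  qed
  have "span3 p q c \<subseteq> span3 ?p ?q c"
    using span3_unimodular_subset[of \<delta> ?p "- \<beta>" ?q "- \<gamma>" \<alpha> c] unfolding p[symmetric] q[symmetric] .
  then have "span3 ?p ?q c = span3 p q c"
    using span3_unimodular_subset by (rule subset_antisym[OF _ , rotated])
  moreover have "det3 ?p ?q c = (\<alpha> * \<delta> - \<beta> * \<gamma>) * det3 p q c"
    by (simp add: det3_def algebra_simps)
  ultimately show ?thesis
    using assms(2) unfolding has_transversal_def det by simp
qed

lemma has_transversal_swap:
  assumes "has_transversal b a c"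
  shows "has_transversal a b c"
proof -
  have "span3 b a c = span3 a b c"
    unfolding span3_def by (rule Collect_cong) (metis add.commute)
  moreover have "det3 b a c = - det3 a b c"
    by (simp add: det3_def)
  ultimately show ?thesis using assms unfolding has_transversal_def by simp
qed

lemma has_transversal_rotate:
  assumes "has_transversal b c a"
  shows "has_transversal a b c"
proof -
  have "span3 b c a = span3 a b c"
  proof (intro equalityI subsetI)
    show "x \<in> span3 a b c" if "x \<in> span3 b c a" for x
      using that
    proof (rule span3E)
      fix k l m assume "x = k *s b + l *s c + m *s a"
      then show ?thesis by (intro span3I[of _ m _ k _ l]) (simp only: ac_simps)
    qed
    show "x \<in> span3 b c a" if "x \<in> span3 a b c" for x
      using that
    proof (rule span3E)
      fix k l m assume "x = k *s a + l *s b + m *s c"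
      then show ?thesis by (intro span3I[of _ l _ m _ k]) (simp only: ac_simps)
    qed
  qed
  moreover have "det3 b c a = det3 a b c"
    by (simp add: det3_def)
  ultimately show ?thesis using assms unfolding has_transversal_def by simp
qed

text \<open>
  The pair \<open>(\<gamma>, \<delta>)\<close> is a primitive relation between \<open>x\<close> and \<open>y\<close>, and Bezout coefficients
  complete it to a matrix of determinant \<open>1\<close>.
\<close>

lemma unimodular_elimination:
  fixes x y :: int
  obtains \<alpha> \<beta> \<gamma> \<delta> where "\<alpha> * \<delta> - \<beta> * \<gamma> = 1" "\<gamma> * x + \<delta> * y = 0"
proof (cases "gcd x y = 0")
  case True
  then show ?thesis by (intro that[of 1 1 0 0]) simp_all
next
  case False
  define g where "g = gcd x y"
  obtain \<alpha> \<beta> where ab: "\<alpha> * x + \<beta> * y = g" unfolding g_def using bezout_int by blast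
  obtain x' y' where xy: "x = g * x'" "y = g * y'"
    unfolding g_def by (metis dvdE gcd_dvd1 gcd_dvd2)
  have "g * (\<alpha> * x' - \<beta> * (- y')) = g * 1" using ab xy by (simp add: algebra_simps)
  then have "\<alpha> * x' - \<beta> * (- y') = 1" using False unfolding g_def by (simp only: mult_cancel_left) simp
  then show ?thesis using xy by (intro that[of \<alpha> x' \<beta> "- y'"]) simp_all
qed

lemma int_residue:
  fixes z d :: int
  assumes "d \<noteq> 0"
  obtains k where "0 \<le> z - k * d" "z - k * d < \<bar>d\<bar>"
proof (rule that[of "z div \<bar>d\<bar> * sgn d"])
  have "z div \<bar>d\<bar> * sgn d * d = z div \<bar>d\<bar> * \<bar>d\<bar>"
    by (simp only: mult.assoc mult.commute[of "sgn d"] abs_sgn)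
  then have "z - z div \<bar>d\<bar> * sgn d * d = z mod \<bar>d\<bar>"
    by (simp only: minus_div_mult_eq_mod)
  then show "0 \<le> z - z div \<bar>d\<bar> * sgn d * d" "z - z div \<bar>d\<bar> * sgn d * d < \<bar>d\<bar>"
    using assms by simp_all
qed

lemma int_residue_unique:
  fixes r r' d k :: int
  assumes "0 \<le> r" "r < \<bar>d\<bar>" "0 \<le> r'" "r' < \<bar>d\<bar>" "r - r' = k * d"
  shows "k = 0" "r = r'"
proof -
  have "\<bar>k\<bar> * \<bar>d\<bar> < 1 * \<bar>d\<bar>" using assms by (simp flip: abs_mult)
  then have "\<bar>k\<bar> < 1" by (rule mult_right_less_imp_less) simp
  then show "k = 0" by simp
  then show "r = r'" using assms(5) by simp
qed

text \<open>
  Division with remainder by the diagonal entries, one coordinate after the other, moves every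
  vector into a box with these entries as side lengths, and it does so in only one way.
\<close>

lemma has_transversal_triangular:
  assumes b1: "b $ 1 = 0" and c1: "c $ 1 = 0" and c2: "c $ 2 = 0"
    and det: "det3 a b c \<noteq> 0"
  shows "has_transversal a b c"
proof -
  have det_eq: "det3 a b c = a $ 1 * b $ 2 * c $ 3" using b1 c1 c2 by (simp add: det3_def)
  then have nz: "a $ 1 \<noteq> 0" "b $ 2 \<noteq> 0" "c $ 3 \<noteq> 0" using det by auto
  let ?box = "{0..<\<bar>a $ 1\<bar>} \<times> {0..<\<bar>b $ 2\<bar>} \<times> {0..<\<bar>c $ 3\<bar>}"
  define f :: "int \<times> int \<times> int \<Rightarrow> int ^ 3" where "f = (\<lambda>(x, y, z). vector [x, y, z])"
  define T where "T = f ` ?box"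
  have T_iff: "r \<in> T \<longleftrightarrow> r $ 1 \<in> {0..<\<bar>a $ 1\<bar>} \<and> r $ 2 \<in> {0..<\<bar>b $ 2\<bar>} \<and> r $ 3 \<in> {0..<\<bar>c $ 3\<bar>}" for r
  proof
    assume "r \<in> T"
    then show "r $ 1 \<in> {0..<\<bar>a $ 1\<bar>} \<and> r $ 2 \<in> {0..<\<bar>b $ 2\<bar>} \<and> r $ 3 \<in> {0..<\<bar>c $ 3\<bar>}"
      unfolding T_def f_def by (auto simp: vector_3)
  next
    assume "r $ 1 \<in> {0..<\<bar>a $ 1\<bar>} \<and> r $ 2 \<in> {0..<\<bar>b $ 2\<bar>} \<and> r $ 3 \<in> {0..<\<bar>c $ 3\<bar>}"
    moreover have "r = f (r $ 1, r $ 2, r $ 3)" by (simp add: f_def vec_eq_iff forall_3 vector_3)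
    ultimately show "r \<in> T" unfolding T_def by (intro image_eqI[of _ _ "(r $ 1, r $ 2, r $ 3)"]) auto
  qed
  have "inj_on f ?box"
    by (rule inj_onI) (auto simp: f_def vec_eq_iff forall_3 vector_3)
  then have "int (card T) = \<bar>det3 a b c\<bar>"
    unfolding T_def det_eq by (simp add: card_image abs_mult mult.assoc)
  moreover have "finite T" unfolding T_def by simp
  moreover have "\<exists>!r. r \<in> T \<and> z - r \<in> span3 a b c" for z
  proof (rule ex_ex1I)
    obtain k where k: "0 \<le> z $ 1 - k * a $ 1" "z $ 1 - k * a $ 1 < \<bar>a $ 1\<bar>"
      using int_residue[OF nz(1)] .
    obtain l where l: "0 \<le> (z $ 2 - k * a $ 2) - l * b $ 2" "(z $ 2 - k * a $ 2) - l * b $ 2 < \<bar>b $ 2\<bar>"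
      using int_residue[OF nz(2)] .
    obtain m where m: "0 \<le> (z $ 3 - k * a $ 3 - l * b $ 3) - m * c $ 3"
        "(z $ 3 - k * a $ 3 - l * b $ 3) - m * c $ 3 < \<bar>c $ 3\<bar>"
      using int_residue[OF nz(3)] .
    define r where "r = z - (k *s a + l *s b + m *s c)"
    have "r \<in> T" unfolding T_iff r_def using k l m b1 c1 c2 by (simp add: algebra_simps)
    moreover have "z - r \<in> span3 a b c" by (rule span3I[of _ k _ l _ m]) (simp add: r_def)
    ultimately show "\<exists>r. r \<in> T \<and> z - r \<in> span3 a b c" by (intro exI conjI)
  next
    fix r r' assume r: "r \<in> T \<and> z - r \<in> span3 a b c" and r': "r' \<in> T \<and> z - r' \<in> span3 a b c"
    obtain k l m where 1: "z - r = k *s a + l *s b + m *s c" using r by (elim conjE span3E)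
    obtain k' l' m' where 2: "z - r' = k' *s a + l' *s b + m' *s c" using r' by (elim conjE span3E)
    have rr: "r - r' = (k' - k) *s a + (l' - l) *s b + (m' - m) *s c"
    proof -
      have "r - r' = (z - r') - (z - r)" by simp
      then show ?thesis unfolding 1 2 by (simp add: vec_eq_iff algebra_simps)
    qed
    have eq: "r $ j - r' $ j = (k' - k) * a $ j + (l' - l) * b $ j + (m' - m) * c $ j" for j
      using arg_cong[OF rr, of "\<lambda>v. v $ j"] by (simp add: left_diff_distrib)
    have box: "r $ 1 \<in> {0..<\<bar>a $ 1\<bar>}" "r $ 2 \<in> {0..<\<bar>b $ 2\<bar>}" "r $ 3 \<in> {0..<\<bar>c $ 3\<bar>}"
      "r' $ 1 \<in> {0..<\<bar>a $ 1\<bar>}" "r' $ 2 \<in> {0..<\<bar>b $ 2\<bar>}" "r' $ 3 \<in> {0..<\<bar>c $ 3\<bar>}"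
      using r r' unfolding T_iff by simp_all
    have 1: "k' - k = 0" "r $ 1 = r' $ 1"
      using int_residue_unique[of "r $ 1" "a $ 1" "r' $ 1" "k' - k"] box eq[of 1] b1 c1 by simp_all
    have 2: "l' - l = 0" "r $ 2 = r' $ 2"
      using int_residue_unique[of "r $ 2" "b $ 2" "r' $ 2" "l' - l"] box eq[of 2] 1 c2 by simp_all
    have 3: "r $ 3 = r' $ 3"
      using int_residue_unique[of "r $ 3" "c $ 3" "r' $ 3" "m' - m"] box eq[of 3] 1 2 by simp_all
    show "r = r'" using 1 2 3 by (simp add: vec_eq_iff forall_3)
  qed
  ultimately show ?thesis unfolding has_transversal_def by (intro exI conjI allI)
qed

text \<open>
  Triangular form is reached by three eliminations: two clear the first coordinate of all vectors
  but one, and the third clears the second coordinate of one of the other two.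
\<close>

lemma has_transversal:
  assumes "det3 a b c \<noteq> 0"
  shows "has_transversal a b c"
proof -
  have step: "has_transversal p q r"
    if "det3 p q r \<noteq> 0"
      and "\<And>p' q'. det3 p' q' r \<noteq> 0 \<Longrightarrow> q' $ i = 0 \<Longrightarrow> (\<And>j. p $ j = 0 \<Longrightarrow> q $ j = 0 \<Longrightarrow> p' $ j = 0 \<and> q' $ j = 0)
           \<Longrightarrow> has_transversal p' q' r" for p q r i
  proof -
    obtain \<alpha> \<beta> \<gamma> \<delta> where u: "\<alpha> * \<delta> - \<beta> * \<gamma> = 1" "\<gamma> * p $ i + \<delta> * q $ i = 0"
      using unimodular_elimination[of "p $ i" "q $ i"] .
    have "det3 (\<alpha> *s p + \<beta> *s q) (\<gamma> *s p + \<delta> *s q) r = (\<alpha> * \<delta> - \<beta> * \<gamma>) * det3 p q r"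
      by (simp add: det3_def algebra_simps)
    then have "has_transversal (\<alpha> *s p + \<beta> *s q) (\<gamma> *s p + \<delta> *s q) r"
      using that(1) u by (intro that(2)) simp_all
    then show ?thesis by (rule has_transversal_unimodular[OF u(1)])
  qed
  show ?thesis
  proof (rule step[of a b c 1, OF assms])
    fix a' b' assume ab: "det3 a' b' c \<noteq> 0" "b' $ 1 = 0"
    show "has_transversal a' b' c"
    proof (rule has_transversal_swap, rule has_transversal_rotate, rule step[of a' c b' 1])
      show "det3 a' c b' \<noteq> 0" using ab(1) by (simp add: det3_def algebra_simps)
      fix a'' c' assume c: "det3 a'' c' b' \<noteq> 0" "c' $ 1 = 0"
      show "has_transversal a'' c' b'"
      proof (rule has_transversal_rotate, rule step[of c' b' a'' 2])
        show "det3 c' b' a'' \<noteq> 0" using c(1) by (simp add: det3_def algebra_simps)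
        fix p q assume pq: "det3 p q a'' \<noteq> 0" "q $ 2 = 0"
          "\<And>j. c' $ j = 0 \<Longrightarrow> b' $ j = 0 \<Longrightarrow> p $ j = 0 \<and> q $ j = 0"
        show "has_transversal p q a''"
        proof (rule has_transversal_rotate, rule has_transversal_rotate, rule has_transversal_triangular)
          show "p $ 1 = 0" "q $ 1 = 0" using pq(3)[of 1] c(2) ab(2) by simp_all
          show "q $ 2 = 0" by (rule pq(2))
          show "det3 a'' p q \<noteq> 0" using pq(1) by (simp add: det3_def algebra_simps)
        qed
      qed
    qed
  qed
qed

theorem lattice_index:
  fixes M :: "int ^ 3 ^ 3"
  assumes "det M \<noteq> 0"
  shows "\<exists>T. finite T \<and> int (card T) = \<bar>det M\<bar> \<and> (\<forall>z. \<exists>!r. r \<in> T \<and> z - r \<in> range (\<lambda>m. m v* M))"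
proof -
  have "det3 (M $ 1) (M $ 2) (M $ 3) = det M"
    by (simp add: det_3 det3_def algebra_simps)
  moreover have "span3 (M $ 1) (M $ 2) (M $ 3) = range (\<lambda>m. m v* M)"
  proof
    show "range (\<lambda>m. m v* M) \<subseteq> span3 (M $ 1) (M $ 2) (M $ 3)"
    proof
      fix x assume "x \<in> range (\<lambda>m. m v* M)"
      then obtain m where "x = m v* M" by (elim rangeE)
      then show "x \<in> span3 (M $ 1) (M $ 2) (M $ 3)"
        by (intro span3I[of _ "m $ 1" _ "m $ 2" _ "m $ 3"])
          (simp add: vector_matrix_mult_def vec_eq_iff sum_3 mult.commute)
    qed
    show "span3 (M $ 1) (M $ 2) (M $ 3) \<subseteq> range (\<lambda>m. m v* M)"
    proof
      fix x assume "x \<in> span3 (M $ 1) (M $ 2) (M $ 3)"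
      then obtain k l m where "x = k *s (M $ 1) + l *s (M $ 2) + m *s (M $ 3)" by (rule span3E)
      then have "x = vector [k, l, m] v* M"
        by (simp add: vector_matrix_mult_def vec_eq_iff sum_3 vector_3 mult.commute)
      then show "x \<in> range (\<lambda>m. m v* M)" by (rule range_eqI)
    qed
  qed
  ultimately show ?thesis
    using has_transversal[of "M $ 1" "M $ 2" "M $ 3"] assms unfolding has_transversal_def by simp
qed

section \<open>Full-dimensional cones and their minimal generators\<close>

lemma convex_coneI:
  assumes "0 \<in> S" "\<And>x y. x \<in> S \<Longrightarrow> y \<in> S \<Longrightarrow> x + y \<in> S"
    and "\<And>x c. x \<in> S \<Longrightarrow> 0 \<le> c \<Longrightarrow> c *\<^sub>R x \<in> S"
  shows "convex_cone S"
  unfolding convex_cone_iff using assms by simp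

lemma convex_cone_hull_insertE:
  assumes "x \<in> convex_cone hull (insert w S)"
  obtains \<alpha> x' where "0 \<le> \<alpha>" "x' \<in> convex_cone hull S" "x = \<alpha> *\<^sub>R w + x'"
proof -
  define D where "D = {y. \<exists>\<alpha> x'. 0 \<le> \<alpha> \<and> x' \<in> convex_cone hull S \<and> y = \<alpha> *\<^sub>R w + x'}"
  have DI: "y \<in> D" if "0 \<le> \<alpha>" "x' \<in> convex_cone hull S" "y = \<alpha> *\<^sub>R w + x'" for y \<alpha> x'
    unfolding D_def using that by blast
  have DE: "\<exists>\<alpha> x'. 0 \<le> \<alpha> \<and> x' \<in> convex_cone hull S \<and> y = \<alpha> *\<^sub>R w + x'" if "y \<in> D" for y
    using that unfolding D_def by simp
  note zero = convex_cone_hull_contains_0[of S]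
  have "convex_cone D"
  proof (rule convex_coneI)
    show "0 \<in> D" by (rule DI[of 0 0]) (simp_all add: zero)
  next
    fix x y assume "x \<in> D" "y \<in> D"
    then obtain \<alpha> x' \<beta> y' where *: "0 \<le> \<alpha>" "0 \<le> \<beta>" "x' \<in> convex_cone hull S" "y' \<in> convex_cone hull S"
      "x = \<alpha> *\<^sub>R w + x'" "y = \<beta> *\<^sub>R w + y'" using DE by metis
    show "x + y \<in> D"
      by (rule DI[of "\<alpha> + \<beta>" "x' + y'"]) (use * in \<open>simp_all add: convex_cone_hull_add algebra_simps\<close>)
  next
    fix x and c :: real assume c: "x \<in> D" "0 \<le> c"
    then obtain \<alpha> x' where *: "0 \<le> \<alpha>" "x' \<in> convex_cone hull S" "x = \<alpha> *\<^sub>R w + x'" using DE by metis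
    show "c *\<^sub>R x \<in> D"
      by (rule DI[of "c * \<alpha>" "c *\<^sub>R x'"]) (use * c in \<open>simp_all add: convex_cone_hull_mul algebra_simps\<close>)
  qed
  moreover have "insert w S \<subseteq> D"
  proof
    fix y assume "y \<in> insert w S"
    then show "y \<in> D"
    proof
      assume "y = w"
      then show ?thesis by (intro DI[of 1 0]) (simp_all add: zero)
    next
      assume "y \<in> S"
      then show ?thesis by (intro DI[of 0 y]) (simp_all add: hull_inc)
    qed
  qed
  ultimately have "convex_cone hull (insert w S) \<subseteq> D" by (intro hull_minimal)
  then have "x \<in> D" using assms by (rule subsetD)
  from DE[OF this] show ?thesis using that by blast
qed

text \<open>
  Suppose that \<open>x + y\<close> lies on the ray of \<open>w\<close>, and split off from \<open>x\<close> and \<open>y\<close> their multiples of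
  \<open>w\<close>. The remainders \<open>x'\<close> and \<open>y'\<close> lie in the hull of \<open>S\<close> and add up to some \<open>\<gamma> w\<close>. Here \<open>\<gamma>\<close> is not
  positive, since otherwise \<open>w\<close> would lie in the hull of \<open>S\<close>. So \<open>- x'\<close> lies in the cone as well, and
  strong convexity gives \<open>x' = 0\<close>: the summand \<open>x\<close> lies on the ray.
\<close>

lemma irredundant_generator_ray:
  assumes sc: "strongly_convex (convex_cone hull (insert w S))"
    and irr: "w \<notin> convex_cone hull S"
  shows "ray_of {t *\<^sub>R w | t. 0 \<le> t} (convex_cone hull (insert w S))"
proof -
  let ?\<sigma> = "convex_cone hull (insert w S)" and ?\<rho> = "{t *\<^sub>R w | t. 0 \<le> t}"
  have w: "w \<in> ?\<sigma>" by (rule hull_inc) simp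
  have w0: "w \<noteq> 0" using irr convex_cone_hull_contains_0[of S] by auto
  have sub: "convex_cone hull S \<subseteq> ?\<sigma>" by (rule hull_mono) auto
  have summand: "\<exists>s\<ge>0. x = s *\<^sub>R w" if xy: "x \<in> ?\<sigma>" "y \<in> ?\<sigma>" "x + y = t *\<^sub>R w" for x y t
  proof -
    obtain \<alpha> x' where x: "0 \<le> \<alpha>" "x' \<in> convex_cone hull S" "x = \<alpha> *\<^sub>R w + x'"
      using convex_cone_hull_insertE[OF xy(1)] .
    obtain \<beta> y' where y: "0 \<le> \<beta>" "y' \<in> convex_cone hull S" "y = \<beta> *\<^sub>R w + y'"
      using convex_cone_hull_insertE[OF xy(2)] .
    define \<gamma> where "\<gamma> = t - \<alpha> - \<beta>"
    have eq: "x' + y' = \<gamma> *\<^sub>R w" using xy(3) unfolding x(3) y(3) \<gamma>_def by (simp add: algebra_simps)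
    have "\<gamma> \<le> 0"
    proof (rule ccontr)
      assume "\<not> \<gamma> \<le> 0"
      then have g: "0 < \<gamma>" by simp
      have "w = (1 / \<gamma>) *\<^sub>R (x' + y')" unfolding eq using g by simp
      also have "\<dots> \<in> convex_cone hull S"
        using g by (intro convex_cone_hull_mul convex_cone_hull_add x(2) y(2)) simp
      finally show False using irr by simp
    qed
    then have "y' + (- \<gamma>) *\<^sub>R w \<in> ?\<sigma>"
      using w sub y(2) by (intro convex_cone_hull_add convex_cone_hull_mul) auto
    moreover have "x' = - (y' + (- \<gamma>) *\<^sub>R w)" using eq by (simp add: algebra_simps eq_neg_iff_add_eq_0)
    ultimately have "x' \<in> ?\<sigma> \<inter> uminus ` ?\<sigma>"
      using subsetD[OF sub x(2)] by (intro IntI image_eqI)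
    then have "x' = 0" using sc unfolding strongly_convex_def by simp
    then show ?thesis using x(1,3) by (intro exI[of _ \<alpha>]) simp
  qed
  have "?\<rho> face_of ?\<sigma>"
    unfolding face_of_def
  proof (intro conjI ballI impI)
    show "?\<rho> \<subseteq> ?\<sigma>" using convex_cone_hull_mul[OF w] by auto
    have "convex_cone ?\<rho>"
    proof (rule convex_coneI)
      show "0 \<in> ?\<rho>" by (auto intro: exI[of _ 0])
      show "x + y \<in> ?\<rho>" if xy: "x \<in> ?\<rho>" "y \<in> ?\<rho>" for x y
      proof -
        obtain s t where "0 \<le> s" "0 \<le> t" "x = s *\<^sub>R w" "y = t *\<^sub>R w" using xy by auto
        then show ?thesis by (auto simp: scaleR_add_left intro!: exI[of _ "s + t"])
      qed
      show "c *\<^sub>R x \<in> ?\<rho>" if "x \<in> ?\<rho>" "0 \<le> c" for x c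
        using that by auto
    qed
    then show "convex ?\<rho>" by (simp add: convex_cone_def)
    fix a b x assume ab: "a \<in> ?\<sigma>" "b \<in> ?\<sigma>" and x: "x \<in> ?\<rho>" "x \<in> open_segment a b"
    obtain u where u: "0 < u" "u < 1" "x = (1 - u) *\<^sub>R a + u *\<^sub>R b" using x(2) by (auto simp: in_segment)
    obtain t where t: "x = t *\<^sub>R w" using x(1) by auto
    have cl: "(1 - u) *\<^sub>R a \<in> ?\<sigma>" "u *\<^sub>R b \<in> ?\<sigma>"
      using u ab by (auto intro: convex_cone_hull_mul)
    obtain s where s: "s \<ge> 0" "(1 - u) *\<^sub>R a = s *\<^sub>R w"
      using summand[OF cl, of t] u(3) t by auto
    obtain r where r: "r \<ge> 0" "u *\<^sub>R b = r *\<^sub>R w"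
      using summand[OF cl(2) cl(1), of t] u(3) t by (auto simp: add.commute)
    have "a = (1 / (1 - u)) *\<^sub>R ((1 - u) *\<^sub>R a)" using u by simp
    then have "a = (s / (1 - u)) *\<^sub>R w" unfolding s(2) by simp
    then show "a \<in> ?\<rho>" using u s(1) by auto
    have "b = (1 / u) *\<^sub>R (u *\<^sub>R b)" using u by simp
    then have "b = (r / u) *\<^sub>R w" unfolding r(2) by simp
    then show "b \<in> ?\<rho>" using u r(1) by auto
  qed
  moreover have "dim ?\<rho> = 1"
  proof (rule dim_unique)
    show "{w} \<subseteq> ?\<rho>" by (auto intro: exI[of _ 1])
    show "?\<rho> \<subseteq> span {w}" by (auto simp: span_singleton)
    show "independent {w}" using w0 by simp
  qed simp
  ultimately show ?thesis by (simp add: ray_of_def)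
qed

lemma primitive_multiple:
  fixes v :: "int ^ 'n"
  assumes "v \<noteq> 0"
  obtains g u where "0 < g" "v = g *s u" "primitive_vector u"
proof -
  define g where "g = (GCD i. v $ i)"
  have "g \<noteq> 0" unfolding g_def using assms by (auto simp: Gcd_0_iff vec_eq_iff)
  moreover have "0 \<le> g" unfolding g_def by simp
  ultimately have g: "0 < g" by simp
  define u :: "int ^ 'n" where "u = (\<chi> i. v $ i div g)"
  have "g dvd v $ i" for i unfolding g_def by (rule Gcd_dvd) simp
  then have v: "v $ i = g * u $ i" for i unfolding u_def by simp
  define d where "d = (GCD i. u $ i)"
  have "g * d dvd (GCD i. v $ i)"
  proof (rule Gcd_greatest)
    fix x assume "x \<in> range (\<lambda>i. v $ i)"
    then obtain i where x: "x = v $ i" by (rule rangeE)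
    have "d dvd u $ i" unfolding d_def by (rule Gcd_dvd) simp
    then show "g * d dvd x" unfolding x v by (rule mult_dvd_mono[OF dvd_refl])
  qed
  then have "g * d dvd g * 1" by (simp flip: g_def)
  then have "d dvd 1" using g by (simp only: dvd_mult_cancel_left) simp
  moreover have "0 \<le> d" unfolding d_def by simp
  ultimately have "d = 1" by simp
  moreover have "v = g *s u" using v by (simp add: vec_eq_iff)
  ultimately show ?thesis using g by (intro that[of g u]) (simp_all add: primitive_vector_def d_def)
qed

lemma real_vec_scale: "real_vec (g *s u) = real_of_int g *\<^sub>R real_vec u"
  by (simp add: real_vec_def vec_eq_iff)

lemma ray_scale:
  fixes u :: "'a::real_vector"
  assumes "0 < g"
  shows "{t *\<^sub>R (g *\<^sub>R u) | t. 0 \<le> t} = {t *\<^sub>R u | t. 0 \<le> (t::real)}"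
proof (intro equalityI subsetI)
  fix x assume "x \<in> {t *\<^sub>R (g *\<^sub>R u) | t. 0 \<le> t}"
  then obtain t where t: "0 \<le> t" "x = t *\<^sub>R (g *\<^sub>R u)" by auto
  then have "x = (t * g) *\<^sub>R u" by simp
  with t(1) show "x \<in> {t *\<^sub>R u | t. 0 \<le> t}" using assms by (auto intro!: exI[of _ "t * g"])
next
  fix x assume "x \<in> {t *\<^sub>R u | t. 0 \<le> t}"
  then obtain t where "0 \<le> t" "x = t *\<^sub>R u" by auto
  then show "x \<in> {t *\<^sub>R (g *\<^sub>R u) | t. 0 \<le> t}" using assms by (auto intro!: exI[of _ "t / g"])
qed

text \<open>
  In a generating set of least cardinality no element is redundant. So each element spans a ray of
  the cone, and its primitive multiple is a minimal generator.
\<close>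

theorem cone_generated_by_minimal_generators:
  fixes \<sigma> :: "(real ^ 'n) set"
  assumes rat: "rational_polyhedral_cone \<sigma>" and sc: "strongly_convex \<sigma>"
  shows "\<sigma> = convex_cone hull (real_vec ` minimal_generators \<sigma>)"
proof
  obtain V :: "(int ^ 'n) set" where V: "finite V" "\<sigma> = convex_cone hull (real_vec ` V)"
    using rat unfolding rational_polyhedral_cone_def by blast
  let ?Q = "\<lambda>U. U \<subseteq> V \<and> \<sigma> = convex_cone hull (real_vec ` U)"
  obtain U where U: "?Q U" "\<And>U'. ?Q U' \<Longrightarrow> card U \<le> card U'"
    using ex_has_least_nat[of ?Q V card] V(2) by auto
  have gen: "real_vec v \<in> convex_cone hull (real_vec ` minimal_generators \<sigma>)" if v: "v \<in> U" for v
  proof -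
    let ?w = "real_vec v" and ?S = "real_vec ` (U - {v})"
    have fU: "finite U" using U(1) V(1) finite_subset by blast
    have ins: "real_vec ` U = insert ?w ?S" using v by blast
    have \<sigma>U: "\<sigma> = convex_cone hull (real_vec ` U)" using U(1) by (rule conjunct2)
    have \<sigma>: "\<sigma> = convex_cone hull (insert ?w ?S)" by (rule \<sigma>U[unfolded ins])
    have irr: "?w \<notin> convex_cone hull ?S"
    proof
      assume "?w \<in> convex_cone hull ?S"
      then have "convex_cone hull (insert ?w ?S) = convex_cone hull ?S" by (rule hull_redundant)
      then have "\<sigma> = convex_cone hull ?S" unfolding \<sigma>[symmetric] .
      moreover have "U - {v} \<subseteq> V" using U(1) by blast
      ultimately have "card U \<le> card (U - {v})" by (intro U(2) conjI)
      then show False using card_Diff1_less[OF fU v] by linarith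
    qed
    have ray: "ray_of {t *\<^sub>R ?w | t. 0 \<le> t} \<sigma>"
      using irredundant_generator_ray[of ?w ?S, folded \<sigma>, OF sc irr] .
    have "v \<noteq> 0"
    proof
      assume "v = 0"
      then have "?w = 0" by (simp add: real_vec_def vec_eq_iff)
      then show False using irr convex_cone_hull_contains_0[of ?S] by simp
    qed
    then obtain g u where gu: "0 < g" "v = g *s u" "primitive_vector u" by (rule primitive_multiple)
    have w: "?w = real_of_int g *\<^sub>R real_vec u" unfolding gu(2) by (rule real_vec_scale)
    have "{t *\<^sub>R ?w | t. 0 \<le> t} = {t *\<^sub>R real_vec u | t. 0 \<le> t}"
      unfolding w by (rule ray_scale) (use gu(1) in simp)
    then have "u \<in> minimal_generators \<sigma>"
      using ray gu(3) unfolding minimal_generators_def by auto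
    then have "real_vec u \<in> convex_cone hull (real_vec ` minimal_generators \<sigma>)" by (intro hull_inc) simp
    then show ?thesis unfolding w using gu(1) by (intro convex_cone_hull_mul) simp_all
  qed
  then have "real_vec ` U \<subseteq> convex_cone hull (real_vec ` minimal_generators \<sigma>)" by (rule image_subsetI)
  from hull_minimal[of _ _ convex_cone, OF this convex_cone_convex_cone_hull]
  show "\<sigma> \<subseteq> convex_cone hull (real_vec ` minimal_generators \<sigma>)"
    by (rule ord_eq_le_trans[OF conjunct2[OF U(1)]])
  show "convex_cone hull (real_vec ` minimal_generators \<sigma>) \<subseteq> \<sigma>"
  proof (rule hull_minimal)
    show "convex_cone \<sigma>" unfolding V(2) by (rule convex_cone_convex_cone_hull)
    show "real_vec ` minimal_generators \<sigma> \<subseteq> \<sigma>"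
    proof
      fix x assume "x \<in> real_vec ` minimal_generators \<sigma>"
      then obtain u \<rho> where u: "x = real_vec u" "ray_of \<rho> \<sigma>" "\<rho> = {t *\<^sub>R real_vec u | t. 0 \<le> t}"
        unfolding minimal_generators_def by auto
      have "x \<in> \<rho>" unfolding u(1,3) by (auto intro: exI[of _ 1])
      then show "x \<in> \<sigma>" using u(2) face_of_imp_subset unfolding ray_of_def by blast
    qed
  qed
qed

lemma det_real_matrix: "det (\<chi> i j. real_of_int (M $ i $ j)) = real_of_int (det (M :: int ^ 'n ^ 'n))"
  by (simp add: det_def)

text \<open>
  The columns of \<open>M\<close> generate the cone. So they span the whole space, which makes \<open>M\<close> nonsingular, and
  a linear form is nonnegative on the cone as soon as it is nonnegative on them.
\<close>

theorem full_cone_generator_matrix: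
  fixes \<sigma> :: "(real ^ 'n) set" and M :: "int ^ 'n ^ 'n"
  assumes \<sigma>: "simplicial_cone \<sigma>" and dim: "dim \<sigma> = CARD('n)" and M: "columns M = minimal_generators \<sigma>"
  shows "det M \<noteq> 0" and "primitive_vector (column i M)"
    and "real_vec m \<in> dual_cone \<sigma> \<longleftrightarrow> (\<forall>i. 0 \<le> (m v* M) $ i)"
proof -
  have gen: "\<sigma> = convex_cone hull (real_vec ` columns M)"
    unfolding M using \<sigma> unfolding simplicial_cone_def by (intro cone_generated_by_minimal_generators) auto
  let ?R = "\<chi> i j. real_of_int (M $ i $ j)"
  have "columns ?R = real_vec ` columns M"
  proof -
    have "column i ?R = real_vec (column i M)" for i
      by (simp add: column_def real_vec_def vec_eq_iff)
    then show ?thesis unfolding columns_def by auto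
  qed
  moreover have "dim (real_vec ` columns M) = CARD('n)"
  proof -
    have "\<sigma> \<subseteq> span (real_vec ` columns M)"
      unfolding gen by (intro hull_minimal span_superset convex_cone_span)
    then have "dim \<sigma> \<le> dim (real_vec ` columns M)" using dim_subset[of \<sigma> "span (real_vec ` columns M)"] by simp
    moreover have "dim (real_vec ` columns M) \<le> CARD('n)" by (rule dim_subset_UNIV_cart)
    ultimately show ?thesis using dim by simp
  qed
  ultimately have "rank ?R = CARD('n)" by (simp add: column_rank_def)
  then have "det ?R \<noteq> 0" using det_eq_0_rank[of ?R] by simp
  then show "det M \<noteq> 0" unfolding det_real_matrix by simp
  show "primitive_vector (column i M)"
  proof -
    have "column i M \<in> columns M" by (auto simp: columns_def)
    then show ?thesis unfolding M minimal_generators_def by blast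
  qed
  have inner: "real_vec m \<bullet> real_vec (column i M) = real_of_int ((m v* M) $ i)" for i
    by (simp add: real_vec_def inner_vec_def column_def vector_matrix_mult_def mult.commute)
  have "real_vec m \<in> dual_cone \<sigma> \<longleftrightarrow> real_vec ` columns M \<subseteq> {u. 0 \<le> real_vec m \<bullet> u}"
  proof
    assume "real_vec m \<in> dual_cone \<sigma>"
    then show "real_vec ` columns M \<subseteq> {u. 0 \<le> real_vec m \<bullet> u}"
      unfolding dual_cone_def gen using hull_inc[of _ "real_vec ` columns M" convex_cone] by blast
  next
    assume "real_vec ` columns M \<subseteq> {u. 0 \<le> real_vec m \<bullet> u}"
    then have "\<sigma> \<subseteq> {u. 0 \<le> real_vec m \<bullet> u}"
      unfolding gen by (intro hull_minimal convex_cone_halfspace_ge)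
    then show "real_vec m \<in> dual_cone \<sigma>" unfolding dual_cone_def by blast
  qed
  also have "\<dots> \<longleftrightarrow> (\<forall>i. 0 \<le> (m v* M) $ i)"
  proof -
    have "real_vec ` columns M = range (\<lambda>i. real_vec (column i M))" unfolding columns_def by auto
    then show ?thesis by (simp add: image_subset_iff inner)
  qed
  finally show "real_vec m \<in> dual_cone \<sigma> \<longleftrightarrow> (\<forall>i. 0 \<le> (m v* M) $ i)" .
qed

section \<open>Factoriality of the Laurent polynomial ring\<close>

text \<open>
  Polynomial rings over a field become factorial rings, as types, once the field carries a gcd
  structure. The trivial such structure is put on a copy of the field.
\<close>

typedef (overloaded) 'k gcd_copy = "UNIV :: 'k::field set" by simp

setup_lifting type_definition_gcd_copy

instantiation gcd_copy :: (field) field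
begin
lift_definition zero_gcd_copy :: "'a gcd_copy" is 0 .
lift_definition one_gcd_copy :: "'a gcd_copy" is 1 .
lift_definition plus_gcd_copy :: "'a gcd_copy \<Rightarrow> 'a gcd_copy \<Rightarrow> 'a gcd_copy" is "(+)" .
lift_definition minus_gcd_copy :: "'a gcd_copy \<Rightarrow> 'a gcd_copy \<Rightarrow> 'a gcd_copy" is "(-)" .
lift_definition uminus_gcd_copy :: "'a gcd_copy \<Rightarrow> 'a gcd_copy" is uminus .
lift_definition times_gcd_copy :: "'a gcd_copy \<Rightarrow> 'a gcd_copy \<Rightarrow> 'a gcd_copy" is "(*)" .
lift_definition inverse_gcd_copy :: "'a gcd_copy \<Rightarrow> 'a gcd_copy" is inverse .
lift_definition divide_gcd_copy :: "'a gcd_copy \<Rightarrow> 'a gcd_copy \<Rightarrow> 'a gcd_copy" is "(/)" .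
instance
  by standard (transfer; simp add: algebra_simps divide_inverse)+
end

instantiation gcd_copy ::
  (field) "{unique_euclidean_ring, normalization_euclidean_semiring, normalization_semidom_multiplicative}"
begin

definition [simp]: "normalize_gcd_copy = (normalize_field :: 'a gcd_copy \<Rightarrow> _)"
definition [simp]: "unit_factor_gcd_copy = (unit_factor_field :: 'a gcd_copy \<Rightarrow> _)"
definition [simp]: "modulo_gcd_copy = (mod_field :: 'a gcd_copy \<Rightarrow> _)"
definition [simp]: "euclidean_size_gcd_copy = (euclidean_size_field :: 'a gcd_copy \<Rightarrow> _)"
definition [simp]: "division_segment (x :: 'a gcd_copy) = 1"

instance
  by standard
    (simp_all add: dvd_field_iff field_split_simps split: if_splits)

end

instantiation gcd_copy :: (field) euclidean_ring_gcd
begin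

definition gcd_gcd_copy :: "'a gcd_copy \<Rightarrow> 'a gcd_copy \<Rightarrow> 'a gcd_copy" where
  "gcd_gcd_copy = Euclidean_Algorithm.gcd"
definition lcm_gcd_copy :: "'a gcd_copy \<Rightarrow> 'a gcd_copy \<Rightarrow> 'a gcd_copy" where
  "lcm_gcd_copy = Euclidean_Algorithm.lcm"
definition Gcd_gcd_copy :: "'a gcd_copy set \<Rightarrow> 'a gcd_copy" where
 "Gcd_gcd_copy = Euclidean_Algorithm.Gcd"
definition Lcm_gcd_copy :: "'a gcd_copy set \<Rightarrow> 'a gcd_copy" where
 "Lcm_gcd_copy = Euclidean_Algorithm.Lcm"

instance by standard (simp_all add: gcd_gcd_copy_def lcm_gcd_copy_def Gcd_gcd_copy_def Lcm_gcd_copy_def)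

end

instance gcd_copy :: (field) field_gcd ..

definition ring_map :: "('a::comm_ring_1 \<Rightarrow> 'b::comm_ring_1) \<Rightarrow> bool" where
  "ring_map h \<longleftrightarrow> h 1 = 1 \<and> (\<forall>x y. h (x + y) = h x + h y) \<and> (\<forall>x y. h (x * y) = h x * h y)"

lemma ring_mapD:
  assumes "ring_map h"
  shows "h 1 = 1" "h (x + y) = h x + h y" "h (x * y) = h x * h y" "h 0 = 0"
proof -
  show "h 1 = 1" "h (x + y) = h x + h y" "h (x * y) = h x * h y"
    using assms by (auto simp: ring_map_def)
  have "h (0 + 0) = h 0 + h 0"
    using assms unfolding ring_map_def by blast
  then show "h 0 = 0" by simp
qed

lemma ring_map_dvd:
  assumes "ring_map h" "x dvd y"
  shows "h x dvd h y"
  using assms by (auto simp: dvd_def ring_map_def)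

lemma unit_mult:
  fixes u :: "'a::comm_ring_1"
  assumes "u dvd 1" "v dvd 1"
  shows "u * v dvd 1"
  using mult_dvd_mono[OF assms] by simp

lemma dvd_mult_unit_cancel:
  fixes a :: "'a::comm_ring_1"
  assumes "c dvd a * u" "u dvd 1"
  shows "c dvd a"
proof -
  obtain v where v: "1 = u * v" using assms(2) by (elim dvdE)
  have "c dvd (a * u) * v" using assms(1) by simp
  then show ?thesis by (simp add: mult.assoc flip: v)
qed

text \<open>
  Here and in the next lemmas \<open>h\<close> embeds a domain into a ring in which every element becomes a value of
  \<open>h\<close> after multiplication by a unit \<open>h s\<close>. Statements about the ring are reduced to the domain by
  clearing these denominators.
\<close>

lemma ring_map_localization_no_zero_divisors:
  fixes h :: "'a::idom \<Rightarrow> 'b::comm_ring_1"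
  assumes h: "ring_map h" "\<And>x. h x = 0 \<Longrightarrow> x = 0"
    and loc: "\<And>a. \<exists>s x. h s dvd 1 \<and> a * h s = h x"
    and ab: "(a :: 'b) * b = 0"
  shows "a = 0 \<or> b = 0"
proof -
  obtain s x where s: "h s dvd 1" "a * h s = h x" using loc by blast
  obtain t y where t: "h t dvd 1" "b * h t = h y" using loc by blast
  have "h (x * y) = (a * b) * (h s * h t)"
    using s(2) t(2) by (simp add: ring_mapD(3)[OF h(1)] algebra_simps flip: s(2) t(2))
  then have "x * y = 0" using ab h(2)[of "x * y"] by simp
  then have "x = 0 \<or> y = 0" by simp
  then have "a * h s = 0 \<or> b * h t = 0"
    using s(2) t(2) ring_mapD(4)[OF h(1)] by auto
  then show ?thesis
    using dvd_mult_unit_cancel[of 0 a "h s"] dvd_mult_unit_cancel[of 0 b "h t"] s(1) t(1) by auto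
qed

text \<open>
  If \<open>h p\<close> divides \<open>a b\<close>, then \<open>p\<close> divides \<open>x y r\<close> for numerators \<open>x\<close> and \<open>y\<close> of \<open>a\<close> and \<open>b\<close> and a
  denominator \<open>r\<close> of the quotient. It does not divide \<open>r\<close>, because \<open>h r\<close> is a unit and \<open>h p\<close> is not.
\<close>

lemma prime_elem_in_localization:
  fixes h :: "'a::{factorial_semiring,idom} \<Rightarrow> 'b::comm_ring_1"
  assumes h: "ring_map h" "\<And>x. h x = 0 \<Longrightarrow> x = 0"
    and loc: "\<And>a. \<exists>s x. h s dvd 1 \<and> a * h s = h x"
    and p: "prime_elem p" and nu: "\<not> h p dvd 1"
  shows "prime_elem (h p)"
proof (rule prime_elemI)
  show "h p \<noteq> 0" using h(2)[of p] p by (auto simp: prime_elem_def)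
  show "\<not> h p dvd 1" by (fact nu)
next
  fix a b assume "h p dvd a * b"
  then obtain c where c: "a * b = h p * c" by (elim dvdE)
  obtain s x where s: "h s dvd 1" "a * h s = h x" using loc by blast
  obtain t y where t: "h t dvd 1" "b * h t = h y" using loc by blast
  obtain r z where r: "h r dvd 1" "c * h r = h z" using loc by blast
  have "h (x * y * r) = (a * b) * (h s * h t * h r)"
    unfolding ring_mapD(3)[OF h(1)] s(2)[symmetric] t(2)[symmetric] by (simp only: ac_simps)
  also have "\<dots> = h (p * (z * s * t))"
    unfolding c ring_mapD(3)[OF h(1)] r(2)[symmetric] by (simp only: ac_simps)
  finally have "h (x * y * r) = h (p * (z * s * t))" .
  moreover have "h (x * y * r) = h (x * y * r - p * (z * s * t)) + h (p * (z * s * t))"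
    by (simp flip: ring_mapD(2)[OF h(1)])
  ultimately have "x * y * r = p * (z * s * t)"
    using h(2)[of "x * y * r - p * (z * s * t)"] by simp
  then have "p dvd x * y * r" by simp
  then consider "p dvd x" | "p dvd y" | "p dvd r"
    using p by (auto simp: prime_elem_dvd_mult_iff)
  then show "h p dvd a \<or> h p dvd b"
  proof cases
    case 1
    then show ?thesis using ring_map_dvd[OF h(1), of p x] s dvd_mult_unit_cancel[of "h p" a "h s"] by simp
  next
    case 2
    then show ?thesis using ring_map_dvd[OF h(1), of p y] t dvd_mult_unit_cancel[of "h p" b "h t"] by simp
  next
    case 3
    then show ?thesis using dvd_trans[OF ring_map_dvd[OF h(1)] r(1)] nu by blast
  qed
qed

text \<open>
  The prime factors of a numerator of \<open>a\<close> either stay prime or become units, and the latter are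
  collected in \<open>u\<close>.
\<close>

lemma prime_factorization_in_localization:
  fixes h :: "'a::{factorial_semiring,idom} \<Rightarrow> 'b::comm_ring_1"
  assumes h: "ring_map h" "\<And>x. h x = 0 \<Longrightarrow> x = 0"
    and loc: "\<And>a. \<exists>s x. h s dvd 1 \<and> a * h s = h x"
    and a: "(a :: 'b) \<noteq> 0"
  shows "\<exists>u F. u dvd 1 \<and> (\<forall>f\<in>#F. prime_elem f) \<and> a = u * prod_mset F"
proof -
  have *: "\<exists>u F. u dvd 1 \<and> (\<forall>f\<in>#F. prime_elem f) \<and> h (prod_mset P) = u * prod_mset F"
    if "\<forall>p\<in>#P. prime_elem p" for P
    using that
  proof (induction P)
    case empty
    show ?case
      by (rule exI[of _ 1], rule exI[of _ "{#}"]) (simp add: ring_mapD(1)[OF h(1)])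
  next
    case (add p P)
    have "\<forall>p\<in>#P. prime_elem p" using add.prems by simp
    then obtain u F where uF: "u dvd 1" "\<forall>f\<in>#F. prime_elem f" "h (prod_mset P) = u * prod_mset F"
      using add.IH by blast
    show ?case
    proof (cases "h p dvd 1")
      case True
      then have "h p * u dvd 1" using uF(1) by (intro unit_mult)
      then show ?thesis
        using uF(2) by (intro exI[of _ "h p * u"] exI[of _ F]) (simp add: ring_mapD(3)[OF h(1)] mult.assoc uF(3))
    next
      case False
      then have "prime_elem (h p)"
        using prime_elem_in_localization[OF h loc _ False] add.prems by simp
      then show ?thesis
        using uF(1,2) by (intro exI[of _ u] exI[of _ "add_mset (h p) F"])
          (simp add: ring_mapD(3)[OF h(1)] uF(3) mult.left_commute)
    qed
  qed
  obtain s x where s: "h s dvd 1" "a * h s = h x" using loc by blast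
  obtain t where t: "1 = h s * t" using s(1) by (elim dvdE)
  have a_eq: "a = h x * t" unfolding s(2)[symmetric] mult.assoc t[symmetric] by simp
  have "x \<noteq> 0"
  proof
    assume "x = 0"
    then show False using a a_eq ring_mapD(4)[OF h(1)] by simp
  qed
  then obtain P where P: "\<And>p. p \<in># P \<Longrightarrow> prime_elem p" "normalize (prod_mset P) = normalize x"
    using prime_factorization_exists[of x] by blast
  obtain v where v: "is_unit v" "x = v * prod_mset P"
    by (rule associatedE2[OF P(2)]) (rule that)
  have "\<forall>p\<in>#P. prime_elem p" using P(1) by simp
  from *[OF this] obtain u F where uF: "u dvd 1" "\<forall>f\<in>#F. prime_elem f" "h (prod_mset P) = u * prod_mset F"
    by blast
  have "h v dvd 1" using ring_map_dvd[OF h(1) v(1)] ring_mapD(1)[OF h(1)] by simp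
  moreover have "t dvd 1" unfolding t by simp
  ultimately have "h v * u * t dvd 1" using uF(1) by (intro unit_mult)
  moreover have "a = (h v * u * t) * prod_mset F"
    unfolding a_eq v(2) ring_mapD(3)[OF h(1)] uF(3) by (simp only: ac_simps)
  ultimately show ?thesis using uF(2) by blast
qed

definition poly_eval :: "('a::comm_ring_1 \<Rightarrow> 'b::comm_ring_1) \<Rightarrow> 'b \<Rightarrow> 'a poly \<Rightarrow> 'b" where
  "poly_eval h x p = poly (map_poly h p) x"

lemma poly_eval_pCons:
  assumes "ring_map h"
  shows "poly_eval h x (pCons a p) = h a + x * poly_eval h x p"
  using ring_mapD(4)[OF assms] by (simp add: poly_eval_def map_poly_pCons)

lemma ring_map_poly_eval:
  assumes h: "ring_map h"
  shows "ring_map (poly_eval h x)"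
proof -
  note h0 = ring_mapD(4)[OF h] and pC = poly_eval_pCons[OF h]
  have zero: "poly_eval h x 0 = 0" by (simp add: poly_eval_def)
  have one: "poly_eval h x 1 = 1"
    using poly_eval_pCons[OF h, of x 1 0] by (simp add: zero ring_mapD(1)[OF h] flip: one_pCons)
  have add: "poly_eval h x (p + q) = poly_eval h x p + poly_eval h x q" for p q
  proof -
    have "map_poly h (p + q) = map_poly h p + map_poly h q"
      by (rule poly_eqI) (simp add: coeff_map_poly h0 ring_mapD(2)[OF h])
    then show ?thesis by (simp add: poly_eval_def)
  qed
  have smult: "poly_eval h x (smult c p) = h c * poly_eval h x p" for c p
  proof -
    have "map_poly h (smult c p) = smult (h c) (map_poly h p)"
      by (rule poly_eqI) (simp add: coeff_map_poly h0 ring_mapD(3)[OF h])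
    then show ?thesis by (simp add: poly_eval_def)
  qed
  have "poly_eval h x (p * q) = poly_eval h x p * poly_eval h x q" for p q
  proof (induction p)
    case (pCons a p)
    have "poly_eval h x (pCons a p * q) = h a * poly_eval h x q + x * poly_eval h x (p * q)"
      unfolding mult_pCons_left add smult pC h0 by simp
    then show ?case unfolding pCons.IH pC by (simp only: distrib_right mult.assoc)
  qed (simp add: zero)
  then show ?thesis using one add by (simp add: ring_map_def)
qed

lemma poly_eval_const:
  assumes "ring_map h"
  shows "poly_eval h x [:c:] = h c"
  using poly_eval_pCons[OF assms, of x c 0] by (simp add: poly_eval_def)

lemma poly_eval_X:
  assumes "ring_map h"
  shows "poly_eval h x [:0, 1:] = x"
  using poly_eval_pCons[OF assms, of x 0 "[:1:]"] ring_mapD(1,4)[OF assms]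
  by (simp add: poly_eval_const[OF assms])

lemma poly_eval_in:
  assumes "ring_map h" "\<And>c. h c \<in> B" "x \<in> B"
    and "\<And>a b. a \<in> B \<Longrightarrow> b \<in> B \<Longrightarrow> a + b \<in> B" "\<And>a b. a \<in> B \<Longrightarrow> b \<in> B \<Longrightarrow> a * b \<in> B"
  shows "poly_eval h x p \<in> B"
proof (induction p)
  case 0
  show ?case using assms(2)[of 0] ring_mapD(4)[OF assms(1)] by (simp add: poly_eval_def)
next
  case (pCons a p)
  then show ?case using assms by (simp add: poly_eval_pCons)
qed

lemma lookup_mult_single:
  fixes f :: "'a::ab_group_add \<Rightarrow>\<^sub>0 'b::comm_semiring_1"
  shows "lookup (f * Poly_Mapping.single m c) k = lookup f (k - m) * c"
proof -
  have *: "(\<Sum>q. lookup (Poly_Mapping.single m c) q when k = l + q) = (c when l = k - m)" for l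
  proof -
    have "(\<lambda>q. lookup (Poly_Mapping.single m c) q when k = l + q)
        = (\<lambda>q. (c when l = k - m) when q = m)"
      by (rule ext) (auto simp: lookup_single when_def)
    then show ?thesis by (simp only: Sum_any_when_equal)
  qed
  have "lookup (f * Poly_Mapping.single m c) k
    = (\<Sum>l. lookup f l * (c when l = k - m))"
    by (simp add: lookup_mult *)
  also have "(\<lambda>l. lookup f l * (c when l = k - m)) = (\<lambda>l. (lookup f l * c) when l = k - m)"
    by (rule ext) (simp add: when_def)
  finally show ?thesis by simp
qed

abbreviation monomial :: "'a \<Rightarrow> 'a \<Rightarrow>\<^sub>0 'b::zero_neq_one" where
  "monomial m \<equiv> Poly_Mapping.single m 1"

lemma monomial_power:
  "(monomial (axis j 1) :: int ^ 'n \<Rightarrow>\<^sub>0 'k::comm_semiring_1) ^ i = monomial (axis j (int i))"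
proof (induction i)
  case 0
  have "axis j (int 0) = (0 :: int ^ 'n)" by (simp add: axis_def vec_eq_iff)
  then show ?case by (simp only: power_0 single_one)
next
  case (Suc i)
  have "axis j 1 + axis j (int i) = (axis j (int (Suc i)) :: int ^ 'n)"
    by (simp add: axis_def vec_eq_iff)
  then show ?case by (simp only: power_Suc Suc.IH mult_single mult_1_left)
qed

text \<open>
  The terms of degree \<open>n\<close> in the new variable are the ones whose exponents have \<open>n\<close> as \<open>j\<close>-th
  coordinate, so terms of different degrees do not cancel.
\<close>

lemma poly_eval_monomial_inj:
  fixes h :: "'a::comm_ring_1 \<Rightarrow> int ^ 'n \<Rightarrow>\<^sub>0 'k::comm_ring_1"
  assumes h: "ring_map h" "\<And>x. h x = 0 \<Longrightarrow> x = 0"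
    and supp: "\<And>a m. m \<in> keys (h a) \<Longrightarrow> m $ j = 0"
    and p: "poly_eval h (monomial (axis j 1)) p = 0"
  shows "p = 0"
proof (rule poly_eqI)
  fix n
  have "lookup (h (coeff p n)) m = 0" for m
  proof (cases "m $ j = 0")
    case False
    then have "m \<notin> keys (h (coeff p n))" using supp by blast
    then show ?thesis by (simp add: in_keys_iff)
  next
    case True
    define M where "M = m + axis j (int n)"
    have "0 = lookup (\<Sum>i\<le>degree (map_poly h p). h (coeff p i) * monomial (axis j (int i))) M"
      using p unfolding poly_eval_def poly_altdef monomial_power coeff_map_poly[where f = h, OF ring_mapD(4)[OF h(1)]] by simp
    also have "\<dots> = (\<Sum>i\<le>degree (map_poly h p). lookup (h (coeff p i)) (M - axis j (int i)))"
      unfolding lookup_sum lookup_mult_single by simp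
    also have "\<dots> = (\<Sum>i\<le>degree (map_poly h p). if i = n then lookup (h (coeff p n)) m else 0)"
    proof (rule sum.cong)
      fix i
      show "lookup (h (coeff p i)) (M - axis j (int i)) =
         (if i = n then lookup (h (coeff p n)) m else 0)"
      proof (cases "i = n")
        case False
        then have "(M - axis j (int i)) $ j \<noteq> 0" using True by (simp add: M_def)
        then have "M - axis j (int i) \<notin> keys (h (coeff p i))" using supp by blast
        then show ?thesis using False by (simp add: in_keys_iff)
      qed (simp add: M_def)
    qed simp
    also have "\<dots> = (if n \<le> degree (map_poly h p) then lookup (h (coeff p n)) m else 0)"
      by simp
    finally have *: "n \<le> degree (map_poly h p) \<Longrightarrow> ?thesis" by metis
    have "n > degree (map_poly h p) \<Longrightarrow> h (coeff p n) = 0"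
      using coeff_eq_0[of "map_poly h p" n] by (simp add: coeff_map_poly ring_mapD(4)[OF h(1)])
    then show ?thesis using * by (cases "n \<le> degree (map_poly h p)") auto
  qed
  then have "h (coeff p n) = 0" by (intro poly_mapping_eqI) simp
  then show "coeff p n = coeff 0 n" using h(2) by simp
qed

lemma monomial_unit:
  fixes m :: "'a::ab_group_add" and c :: "'k::field"
  assumes "c \<noteq> 0"
  shows "Poly_Mapping.single m c dvd 1"
proof
  show "1 = Poly_Mapping.single m c * Poly_Mapping.single (- m) (inverse c)"
    using assms by (simp add: mult_single)
qed

lemma sum_of_monomials:
  "f = (\<Sum>k\<in>keys f. Poly_Mapping.single k (lookup f k))"
proof (rule poly_mapping_eqI)
  fix k
  show "lookup f k =
    lookup (\<Sum>k\<in>keys f. Poly_Mapping.single k (lookup f k)) k"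
    by (simp add: lookup_sum lookup_single when_def in_keys_iff)
qed

lemma keys_mult_monomial:
  fixes f :: "'a::ab_group_add \<Rightarrow>\<^sub>0 'b::comm_semiring_1"
  shows "keys (f * monomial w) = (\<lambda>m. m + w) ` keys f"
proof -
  have "m \<in> keys (f * monomial w) \<longleftrightarrow> m - w \<in> keys f" for m
    by (simp add: in_keys_iff lookup_mult_single)
  then show ?thesis by (force simp: image_iff)
qed

definition laurent_const :: "'k::field gcd_copy \<Rightarrow> int ^ 3 \<Rightarrow>\<^sub>0 'k" where
  "laurent_const c = Poly_Mapping.single 0 (Rep_gcd_copy c)"

text \<open>
  The inclusion of the polynomials in three variables, obtained by evaluating one variable after the
  other at a monomial.
\<close>

definition laurent_of_poly :: "'k::field gcd_copy poly poly poly \<Rightarrow> int ^ 3 \<Rightarrow>\<^sub>0 'k" where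
  "laurent_of_poly =
     poly_eval (poly_eval (poly_eval laurent_const (monomial (axis 1 1))) (monomial (axis 2 1))) (monomial (axis 3 1))"

lemma ring_map_laurent_const: "ring_map laurent_const"
  unfolding ring_map_def laurent_const_def
  by (simp add: one_gcd_copy.rep_eq plus_gcd_copy.rep_eq times_gcd_copy.rep_eq single_add mult_single)

lemma poly_eval_supp:
  fixes h :: "'a::comm_ring_1 \<Rightarrow> int ^ 'n \<Rightarrow>\<^sub>0 'k::comm_ring_1"
  assumes h: "ring_map h" and supp: "\<And>a m. m \<in> keys (h a) \<Longrightarrow> m $ j = 0"
    and ij: "i \<noteq> j" and m: "m \<in> keys (poly_eval h (monomial (axis i 1)) p)"
  shows "m $ j = 0"
proof -
  have "poly_eval h (monomial (axis i 1)) p \<in> {f. \<forall>m\<in>keys f. m $ j = 0}"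
  proof (rule poly_eval_in[OF h])
    show "h c \<in> {f. \<forall>m\<in>keys f. m $ j = 0}" for c using supp by blast
    show "monomial (axis i 1) \<in> {f. \<forall>m\<in>keys f. m $ j = 0}"
      using ij by (simp add: axis_def)
    fix a b :: "int ^ 'n \<Rightarrow>\<^sub>0 'k"
    assume *: "a \<in> {f. \<forall>m\<in>keys f. m $ j = 0}" "b \<in> {f. \<forall>m\<in>keys f. m $ j = 0}"
    then show "a + b \<in> {f. \<forall>m\<in>keys f. m $ j = 0}"
      using keys_add[of a b] by blast
    show "a * b \<in> {f. \<forall>m\<in>keys f. m $ j = 0}"
      using * keys_mult[of a b] by fastforce
  qed
  then show ?thesis using m by blast
qed

lemma
  fixes p :: "'k::field gcd_copy poly poly poly"
  shows laurent_of_poly_ring_map: "ring_map (laurent_of_poly :: 'k gcd_copy poly poly poly \<Rightarrow> _)"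
    and laurent_of_poly_inj: "laurent_of_poly p = 0 \<Longrightarrow> p = 0"
proof -
  define h1 :: "'k gcd_copy poly \<Rightarrow> int ^ 3 \<Rightarrow>\<^sub>0 'k" where "h1 = poly_eval laurent_const (monomial (axis 1 1))"
  define h2 where "h2 = poly_eval h1 (monomial (axis 2 1))"
  have h3: "laurent_of_poly = poly_eval h2 (monomial (axis 3 1))"
    by (simp add: laurent_of_poly_def h2_def h1_def)
  have r1: "ring_map h1" unfolding h1_def by (intro ring_map_poly_eval ring_map_laurent_const)
  have r2: "ring_map h2" unfolding h2_def by (intro ring_map_poly_eval r1)
  show "ring_map (laurent_of_poly :: 'k gcd_copy poly poly poly \<Rightarrow> _)"
    unfolding h3 by (intro ring_map_poly_eval r2)
  have supp0: "m $ j = 0" if "m \<in> keys (laurent_const c)" for m j and c :: "'k gcd_copy"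
    using that by (auto simp: laurent_const_def split: if_splits)
  have supp1: "m $ j = 0" if "m \<in> keys (h1 a)" "j \<noteq> 1" for m j a
    by (rule poly_eval_supp[OF ring_map_laurent_const supp0 that(2)[symmetric] that(1)[unfolded h1_def]])
  have supp2: "m $ 3 = 0" if "m \<in> keys (h2 a)" for m a
    by (rule poly_eval_supp[OF r1 supp1 _ that[unfolded h2_def]]) auto
  have i0: "c = 0" if "laurent_const c = 0" for c :: "'k gcd_copy"
  proof -
    have "Rep_gcd_copy c = Rep_gcd_copy 0"
      using arg_cong[OF that, of "\<lambda>f. lookup f 0"]
      by (simp add: laurent_const_def zero_gcd_copy.rep_eq)
    then show ?thesis by (simp add: Rep_gcd_copy_inject)
  qed
  have i1: "a = 0" if "h1 a = 0" for a
    by (rule poly_eval_monomial_inj[OF ring_map_laurent_const i0 supp0 that[unfolded h1_def]])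
  have i2: "a = 0" if "h2 a = 0" for a
    by (rule poly_eval_monomial_inj[OF r1 i1 supp1 that[unfolded h2_def]]) auto
  show "laurent_of_poly p = 0 \<Longrightarrow> p = 0"
    unfolding h3 by (rule poly_eval_monomial_inj[OF r2 i2 supp2])
qed

lemma laurent_of_poly_surj:
  fixes f :: "int ^ 3 \<Rightarrow>\<^sub>0 'k::field"
  assumes "\<And>m j. m \<in> keys f \<Longrightarrow> 0 \<le> m $ j"
  shows "f \<in> range laurent_of_poly"
proof -
  let ?B = "range laurent_of_poly :: (int ^ 3 \<Rightarrow>\<^sub>0 'k) set"
  note r0 = ring_map_laurent_const
  note r1 = ring_map_poly_eval[OF r0, of "monomial (axis 1 1)"]
  note r2 = ring_map_poly_eval[OF r1, of "monomial (axis 2 1)"]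
  note r3 = laurent_of_poly_ring_map
  have add: "a + b \<in> ?B" if "a \<in> ?B" "b \<in> ?B" for a b
    using that by (auto simp flip: ring_mapD(2)[OF r3])
  have mult: "a * b \<in> ?B" if "a \<in> ?B" "b \<in> ?B" for a b
    using that by (auto simp flip: ring_mapD(3)[OF r3])
  have zero: "0 \<in> ?B" using ring_mapD(4)[OF r3] by (metis rangeI)
  have one: "1 \<in> ?B" using ring_mapD(1)[OF r3] by (metis rangeI)
  have pow: "a ^ n \<in> ?B" if "a \<in> ?B" for a n
    using that by (induction n) (auto intro: one mult)
  have "Poly_Mapping.single 0 c = laurent_of_poly [:[:[:Abs_gcd_copy c:]:]:]" for c :: 'k
    unfolding laurent_of_poly_def poly_eval_const[OF r2] poly_eval_const[OF r1] poly_eval_const[OF r0]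
    by (simp add: laurent_const_def Abs_gcd_copy_inverse)
  then have const: "Poly_Mapping.single 0 c \<in> ?B" for c by (metis rangeI)
  have "monomial (axis 1 1) = (laurent_of_poly [:[:[:0, 1:]:]:] :: int ^ 3 \<Rightarrow>\<^sub>0 'k)"
    unfolding laurent_of_poly_def poly_eval_const[OF r2] poly_eval_const[OF r1] poly_eval_X[OF r0] ..
  then have X1: "monomial (axis 1 1) \<in> ?B" by (metis rangeI)
  have "monomial (axis 2 1) = (laurent_of_poly [:[:0, 1:]:] :: int ^ 3 \<Rightarrow>\<^sub>0 'k)"
    unfolding laurent_of_poly_def poly_eval_const[OF r2] poly_eval_X[OF r1] ..
  then have X2: "monomial (axis 2 1) \<in> ?B" by (metis rangeI)
  have "monomial (axis 3 1) = (laurent_of_poly [:0, 1:] :: int ^ 3 \<Rightarrow>\<^sub>0 'k)"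
    unfolding laurent_of_poly_def poly_eval_X[OF r2] ..
  then have X3: "monomial (axis 3 1) \<in> ?B" by (metis rangeI)
  have mono: "Poly_Mapping.single m c \<in> ?B" if m: "\<And>j. 0 \<le> m $ j" for m c
  proof -
    have "m = axis 1 (int (nat (m $ 1))) + axis 2 (int (nat (m $ 2))) + axis 3 (int (nat (m $ 3)))"
      using m by (simp add: vec_eq_iff forall_3 axis_def)
    then have "Poly_Mapping.single m c = Poly_Mapping.single 0 c * (monomial (axis 1 1) ^ nat (m $ 1)
        * monomial (axis 2 1) ^ nat (m $ 2) * monomial (axis 3 1) ^ nat (m $ 3))"
      unfolding monomial_power mult_single by simp
    also have "\<dots> \<in> ?B" by (intro mult pow const X1 X2 X3)
    finally show ?thesis .
  qed
  have "(\<Sum>k\<in>K. Poly_Mapping.single k (lookup f k)) \<in> ?B" if "K \<subseteq> keys f" for K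
    using finite_subset[OF that finite_keys] that
  proof (induction K rule: finite_induct)
    case (insert k K)
    then have "Poly_Mapping.single k (lookup f k) \<in> ?B" by (intro mono assms) simp
    then show ?case using insert by (simp add: add)
  qed (simp add: zero)
  from this[OF order_refl] show ?thesis by (simp only: sum_of_monomials[symmetric])
qed

lemma laurent_localization:
  fixes a :: "int ^ 3 \<Rightarrow>\<^sub>0 'k::field"
  shows "\<exists>s x. laurent_of_poly s dvd (1 :: int ^ 3 \<Rightarrow>\<^sub>0 'k) \<and> a * laurent_of_poly s = laurent_of_poly x"
proof -
  define N where "N = (\<Sum>m\<in>keys a. \<Sum>j\<in>UNIV. \<bar>m $ j\<bar>)"
  define w :: "int ^ 3" where "w = (\<chi> j. N)"
  have N: "\<bar>m $ j\<bar> \<le> N" if "m \<in> keys a" for m j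
  proof -
    have "\<bar>m $ j\<bar> \<le> (\<Sum>j\<in>UNIV. \<bar>m $ j\<bar>)" by (rule member_le_sum) auto
    also have "\<dots> \<le> N" unfolding N_def by (rule member_le_sum) (use that in \<open>auto intro: sum_nonneg\<close>)
    finally show ?thesis .
  qed
  have "0 \<le> N" unfolding N_def by (intro sum_nonneg) auto
  then have "monomial w \<in> range (laurent_of_poly :: _ \<Rightarrow> int ^ 3 \<Rightarrow>\<^sub>0 'k)"
    by (intro laurent_of_poly_surj) (auto simp: w_def)
  then obtain s where s: "monomial w = (laurent_of_poly s :: int ^ 3 \<Rightarrow>\<^sub>0 'k)" by auto
  have "a * monomial w \<in> range laurent_of_poly"
  proof (rule laurent_of_poly_surj)
    fix m j assume "m \<in> keys (a * monomial w)"
    then obtain m' where "m' \<in> keys a" "m = m' + w" by (auto simp: keys_mult_monomial)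
    then show "0 \<le> m $ j" using N[of m' j] by (simp add: w_def)
  qed
  then obtain x where x: "a * monomial w = laurent_of_poly x" by auto
  have "(monomial w :: int ^ 3 \<Rightarrow>\<^sub>0 'k) dvd 1" by (intro monomial_unit) simp
  then show ?thesis using x unfolding s by blast
qed

theorem laurent_no_zero_divisors:
  fixes a b :: "int ^ 3 \<Rightarrow>\<^sub>0 'k::field"
  shows "a * b = 0 \<Longrightarrow> a = 0 \<or> b = 0"
  by (rule ring_map_localization_no_zero_divisors[OF laurent_of_poly_ring_map laurent_of_poly_inj laurent_localization])

theorem laurent_prime_factorization:
  fixes a :: "int ^ 3 \<Rightarrow>\<^sub>0 'k::field"
  assumes "a \<noteq> 0"
  shows "\<exists>u F. u dvd 1 \<and> (\<forall>f\<in>#F. prime_elem f) \<and> a = u * prod_mset F"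
  by (rule prime_factorization_in_localization[OF laurent_of_poly_ring_map laurent_of_poly_inj laurent_localization assms])

section \<open>Orders of vanishing and primes of height one\<close>

text \<open>
  An ideal is determined by the least power of \<open>\<tau>\<close> that it contains, so the ideals are the members
  of the chain generated by \<open>\<tau>\<^sup>n, \<dots>, \<tau>, 1\<close>.
\<close>

lemma ring_length_uniserial:
  assumes "cring B" and \<tau>: "\<tau> \<in> carrier B"
    and gen: "\<And>x. x \<in> carrier B \<Longrightarrow> \<exists>u\<in>Units B. \<exists>j::nat. x = u \<otimes>\<^bsub>B\<^esub> \<tau> [^]\<^bsub>B\<^esub> j"
    and nil: "\<And>m::nat. \<tau> [^]\<^bsub>B\<^esub> m = \<zero>\<^bsub>B\<^esub> \<longleftrightarrow> n \<le> m"
  shows "ring_length B = enat n"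
proof -
  interpret B: cring B by fact
  have pow_closed: "\<tau> [^]\<^bsub>B\<^esub> (j::nat) \<in> carrier B" for j using \<tau> by simp
  define \<kappa> where "\<kappa> J = (LEAST m::nat. \<tau> [^]\<^bsub>B\<^esub> m \<in> J)" for J
  have \<kappa>_mem: "\<tau> [^]\<^bsub>B\<^esub> \<kappa> J \<in> J" and \<kappa>_le: "\<kappa> J \<le> n" if "ideal J B" for J
  proof -
    have "\<tau> [^]\<^bsub>B\<^esub> n = \<zero>\<^bsub>B\<^esub>" using nil by simp
    then have *: "\<tau> [^]\<^bsub>B\<^esub> n \<in> J" using that by (simp add: additive_subgroup.zero_closed ideal_def)
    show "\<tau> [^]\<^bsub>B\<^esub> \<kappa> J \<in> J" unfolding \<kappa>_def by (rule LeastI[of _ n]) (rule *)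
    show "\<kappa> J \<le> n" unfolding \<kappa>_def by (rule Least_le) (rule *)
  qed
  have \<kappa>_less: "\<kappa> J' < \<kappa> J" if J: "ideal J B" "ideal J' B" "J \<subset> J'" for J J'
  proof (rule ccontr)
    assume "\<not> \<kappa> J' < \<kappa> J"
    then have le: "\<kappa> J \<le> \<kappa> J'" by simp
    have "x \<in> J" if x: "x \<in> J'" for x
    proof -
      have xB: "x \<in> carrier B" by (rule ideal.Icarr[OF J(2) x])
      obtain u j where u: "u \<in> Units B" "x = u \<otimes>\<^bsub>B\<^esub> \<tau> [^]\<^bsub>B\<^esub> (j::nat)" using gen[OF xB] by blast
      have uB: "u \<in> carrier B" "inv\<^bsub>B\<^esub> u \<in> carrier B" using u(1) by auto
      have "\<tau> [^]\<^bsub>B\<^esub> j = inv\<^bsub>B\<^esub> u \<otimes>\<^bsub>B\<^esub> x"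
        unfolding u(2) B.m_assoc[OF uB(2) uB(1) pow_closed, symmetric] using u(1) \<tau> by simp
      then have "\<tau> [^]\<^bsub>B\<^esub> j \<in> J'" using ideal.I_l_closed[OF J(2) x uB(2)] by simp
      then have "\<kappa> J' \<le> j" unfolding \<kappa>_def by (rule Least_le)
      then have "j = (j - \<kappa> J) + \<kappa> J" using le by simp
      then have "x = (u \<otimes>\<^bsub>B\<^esub> \<tau> [^]\<^bsub>B\<^esub> (j - \<kappa> J)) \<otimes>\<^bsub>B\<^esub> \<tau> [^]\<^bsub>B\<^esub> \<kappa> J"
        unfolding u(2) using uB(1) \<tau> pow_closed by (metis B.m_assoc B.nat_pow_mult)
      then show ?thesis
        using ideal.I_l_closed[OF J(1) \<kappa>_mem[OF J(1)], of "u \<otimes>\<^bsub>B\<^esub> \<tau> [^]\<^bsub>B\<^esub> (j - \<kappa> J)"] uB(1) pow_closed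
        by simp
    qed
    then show False using J(3) by blast
  qed
  have upper: "k \<le> n" if J: "\<forall>i\<le>k. ideal (J i) B" "\<forall>i<k. J i \<subset> J (Suc i)" for k and J :: "nat \<Rightarrow> _"
  proof -
    have "i \<le> k \<Longrightarrow> \<kappa> (J i) + i \<le> n" for i
    proof (induction i)
      case 0 then show ?case using \<kappa>_le J(1) by simp
    next
      case (Suc i)
      then have "\<kappa> (J (Suc i)) < \<kappa> (J i)" using J by (intro \<kappa>_less) auto
      then show ?case using Suc by simp
    qed
    from this[of k] show ?thesis by simp
  qed
  define K where "K i = PIdl\<^bsub>B\<^esub> (\<tau> [^]\<^bsub>B\<^esub> (n - i))" for i
  have K_ideal: "ideal (K i) B" for i
    unfolding K_def by (rule B.cgenideal_ideal) (rule pow_closed)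
  have K_strict: "K i \<subset> K (Suc i)" if i: "i < n" for i
  proof -
    define m where "m = n - Suc i"
    have m: "n - i = Suc m" "m < n" using i by (simp_all add: m_def)
    have self: "\<tau> [^]\<^bsub>B\<^esub> m \<in> K (Suc i)"
      unfolding K_def m_def[symmetric] by (rule B.cgenideal_self) (rule pow_closed)
    have "\<tau> [^]\<^bsub>B\<^esub> Suc m \<in> K (Suc i)"
      using ideal.I_r_closed[OF K_ideal self \<tau>] by simp
    then have sub: "K i \<subseteq> K (Suc i)"
      unfolding K_def[of i] m(1) by (intro B.cgenideal_minimal K_ideal)
    have "\<tau> [^]\<^bsub>B\<^esub> m \<notin> K i"
    proof
      assume "\<tau> [^]\<^bsub>B\<^esub> m \<in> K i"
      then obtain y where y: "y \<in> carrier B" "\<tau> [^]\<^bsub>B\<^esub> m = y \<otimes>\<^bsub>B\<^esub> \<tau> [^]\<^bsub>B\<^esub> Suc m"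
        unfolding K_def m(1) cgenideal_def by blast
      define l where "l = n - Suc m"
      have l: "m + l < n" "Suc m + l = n" using m(2) by (simp_all add: l_def)
      have "\<tau> [^]\<^bsub>B\<^esub> (m + l) = y \<otimes>\<^bsub>B\<^esub> \<tau> [^]\<^bsub>B\<^esub> (Suc m + l)"
        unfolding B.nat_pow_mult[OF \<tau>, symmetric] y(2)
        by (rule B.m_assoc) (use y(1) pow_closed \<tau> in simp_all)
      also have "\<dots> = \<zero>\<^bsub>B\<^esub>" using nil[of n] y(1) unfolding l(2) by simp
      finally show False using nil[of "m + l"] l(1) by simp
    qed
    then show ?thesis using sub self by blast
  qed
  show ?thesis
    unfolding ring_length_def
  proof (rule antisym)
    show "Sup {enat n |n. \<exists>J::nat \<Rightarrow> _ set. (\<forall>i\<le>n. ideal (J i) B) \<and> (\<forall>i<n. J i \<subset> J (Suc i))} \<le> enat n"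
      by (rule Sup_least) (use upper in auto)
    show "enat n \<le> Sup {enat n |n. \<exists>J::nat \<Rightarrow> _ set. (\<forall>i\<le>n. ideal (J i) B) \<and> (\<forall>i<n. J i \<subset> J (Suc i))}"
      by (rule Sup_upper) (use K_ideal K_strict in blast)
  qed
qed

text \<open>
  The domain is a subset of a commutative ring type, so that calculations in it, and in its
  localizations, are calculations in the type.
\<close>

locale subdomain =
  fixes C :: "'a::comm_ring_1 set"
  assumes zero_closed: "0 \<in> C" and one_closed: "1 \<in> C"
    and add_closed: "a \<in> C \<Longrightarrow> b \<in> C \<Longrightarrow> a + b \<in> C"
    and uminus_closed: "a \<in> C \<Longrightarrow> - a \<in> C"
    and mult_closed: "a \<in> C \<Longrightarrow> b \<in> C \<Longrightarrow> a * b \<in> C"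
    and no_zero_divisors: "a \<in> C \<Longrightarrow> b \<in> C \<Longrightarrow> a * b = 0 \<Longrightarrow> a = 0 \<or> b = 0"
begin

definition R :: "'a ring" where
  "R = \<lparr>carrier = C, monoid.mult = (*), monoid.one = 1, ring.zero = 0, ring.add = (+)\<rparr>"

lemma R_simps [simp]:
  "carrier R = C" "x \<otimes>\<^bsub>R\<^esub> y = x * y" "\<one>\<^bsub>R\<^esub> = 1" "\<zero>\<^bsub>R\<^esub> = 0" "x \<oplus>\<^bsub>R\<^esub> y = x + y"
  by (simp_all add: R_def)

lemma cring_R: "cring R"
proof (rule cringI)
  show "abelian_group R"
    by (rule abelian_groupI)
      (auto simp: zero_closed add_closed algebra_simps intro: bexI[of _ "- x" for x] uminus_closed)
  show "Group.comm_monoid R"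
    by (rule comm_monoidI) (auto simp: one_closed mult_closed algebra_simps)
qed (auto simp: algebra_simps)

lemma domain_R: "domain R"
  by (intro domain.intro cring_R domain_axioms.intro) (use no_zero_divisors in auto)

lemma power_closed: "a \<in> C \<Longrightarrow> a ^ n \<in> C"
  by (induction n) (auto intro: one_closed mult_closed)

lemma minus_closed: "a \<in> C \<Longrightarrow> b \<in> C \<Longrightarrow> a - b \<in> C"
  using add_closed[of a "- b"] uminus_closed by simp

lemma cancel:
  assumes "u \<in> C" "u \<noteq> 0" "a \<in> C" "b \<in> C" "u * a = u * b"
  shows "a = b"
proof -
  have "u * (a - b) = 0" using assms(5) by (simp add: algebra_simps)
  then have "a - b = 0" using no_zero_divisors[OF assms(1) minus_closed[OF assms(3,4)]] assms(2) by blast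
  then show ?thesis by simp
qed

lemma primeideal_RI:
  assumes "P \<subseteq> C" "0 \<in> P" "1 \<notin> P"
    and add: "\<And>a b. a \<in> P \<Longrightarrow> b \<in> P \<Longrightarrow> a + b \<in> P"
    and mult: "\<And>c a. c \<in> C \<Longrightarrow> a \<in> P \<Longrightarrow> c * a \<in> P"
    and prime: "\<And>a b. a \<in> C \<Longrightarrow> b \<in> C \<Longrightarrow> a * b \<in> P \<Longrightarrow> a \<in> P \<or> b \<in> P"
  shows "primeideal P R"
proof (rule primeidealI)
  interpret R: cring R by (rule cring_R)
  have uminus: "- a \<in> P" if "a \<in> P" for a
    using mult[OF uminus_closed[OF one_closed] that] by simp
  have inv: "inv\<^bsub>add_monoid R\<^esub> a = - a" if "a \<in> C" for a
    using that by (intro monoid.inv_unique'[OF R.add.is_monoid, symmetric]) (auto simp: uminus_closed)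
  show "ideal P R"
  proof (rule idealI)
    show "ring R" by (rule R.ring_axioms)
    show "subgroup P (add_monoid R)"
      by (rule group.subgroupI[OF R.add.is_group]) (use assms(1,2) inv uminus add in auto)
    show "x \<otimes>\<^bsub>R\<^esub> a \<in> P" "a \<otimes>\<^bsub>R\<^esub> x \<in> P" if "a \<in> P" "x \<in> carrier R" for a x
      using mult[of x a] that by (simp_all add: mult.commute)
  qed
  show "cring R" by (rule cring_R)
  show "carrier R \<noteq> P" using assms(3) one_closed by auto
qed (use prime in auto)

lemma primeidealD:
  assumes "primeideal P R"
  shows "P \<subseteq> C" "0 \<in> P" "1 \<notin> P"
    and "a \<in> P \<Longrightarrow> b \<in> P \<Longrightarrow> a + b \<in> P"
    and "c \<in> C \<Longrightarrow> a \<in> P \<Longrightarrow> c * a \<in> P"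
    and "a \<in> C \<Longrightarrow> b \<in> C \<Longrightarrow> a * b \<in> P \<Longrightarrow> a \<in> P \<or> b \<in> P"
proof -
  interpret P: primeideal P R by fact
  show "P \<subseteq> C" using P.a_subset by simp
  show "0 \<in> P" using additive_subgroup.zero_closed[OF P.additive_subgroup_axioms] by simp
  show "1 \<notin> P" using P.one_imp_carrier P.I_notcarr by auto
  show "a \<in> P \<Longrightarrow> b \<in> P \<Longrightarrow> a + b \<in> P" using additive_subgroup.a_closed[OF P.additive_subgroup_axioms, of a b] by simp
  show "c \<in> C \<Longrightarrow> a \<in> P \<Longrightarrow> c * a \<in> P" using P.I_l_closed[of a c] by simp
  show "a \<in> C \<Longrightarrow> b \<in> C \<Longrightarrow> a * b \<in> P \<Longrightarrow> a \<in> P \<or> b \<in> P" using P.I_prime[of a b] by simp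
qed

end

locale localized_subdomain = subdomain +
  fixes P
  assumes prime: "primeideal P R"
begin

definition T where "T = C - P"
definition L where "L = localization R T"

abbreviation frac where "frac \<equiv> loc_frac R T"

lemma T_closed: "1 \<in> T" "s \<in> T \<Longrightarrow> t \<in> T \<Longrightarrow> s * t \<in> T" "s \<in> T \<Longrightarrow> s \<in> C" "0 \<notin> T"
  using primeidealD(2,3)[OF prime] primeidealD(6)[OF prime, of s t]
  by (auto simp: T_def one_closed mult_closed)

lemma cancel_T: "u \<in> T \<Longrightarrow> a \<in> C \<Longrightarrow> b \<in> C \<Longrightarrow> u * a = u * b \<Longrightarrow> a = b"
  using cancel[of u a b] T_closed(3,4) by metis

lemma frac_eq_set:
  assumes "a \<in> C" "s \<in> T"
  shows "frac a s = {(b, t). b \<in> C \<and> t \<in> T \<and> a * t = b * s}"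
proof -
  have "(\<exists>u\<in>T. u * (a * t) = u * (b * s)) \<longleftrightarrow> a * t = b * s" if "b \<in> C" "t \<in> T" for b t
  proof
    assume "\<exists>u\<in>T. u * (a * t) = u * (b * s)"
    then obtain u where u: "u \<in> T" "u * (a * t) = u * (b * s)" ..
    show "a * t = b * s"
      by (rule cancel_T[OF u(1) _ _ u(2)]) (simp_all add: mult_closed that assms T_closed(3))
  next
    assume "a * t = b * s"
    then show "\<exists>u\<in>T. u * (a * t) = u * (b * s)" by (intro bexI[of _ 1]) (simp_all add: T_closed)
  qed
  then show ?thesis
    using assms by (auto simp: loc_frac_def loc_rel_def)
qed

lemma frac_eq:
  assumes "a \<in> C" "s \<in> T" "b \<in> C" "t \<in> T"
  shows "frac a s = frac b t \<longleftrightarrow> a * t = b * s"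
proof
  assume "frac a s = frac b t"
  moreover have "(b, t) \<in> frac b t" using assms by (simp add: frac_eq_set)
  ultimately have "(b, t) \<in> frac a s" by simp
  then show "a * t = b * s" using assms by (simp add: frac_eq_set)
next
  assume eq: "a * t = b * s"
  have "a * r = c * s \<longleftrightarrow> b * r = c * t" if "c \<in> C" "r \<in> T" for c r
  proof
    assume *: "a * r = c * s"
    have "s * (b * r) = (a * t) * r" by (simp add: eq ac_simps)
    also have "\<dots> = t * (a * r)" by (simp add: ac_simps)
    also have "\<dots> = s * (c * t)" by (simp add: * ac_simps)
    finally show "b * r = c * t"
      by (rule cancel_T[rotated 3]) (simp_all add: assms that T_closed(3) mult_closed)
  next
    assume *: "b * r = c * t"
    have "t * (a * r) = (a * t) * r" by (simp add: ac_simps)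
    also have "\<dots> = s * (b * r)" by (simp add: eq ac_simps)
    also have "\<dots> = t * (c * s)" by (simp add: * ac_simps)
    finally show "a * r = c * s"
      by (rule cancel_T[rotated 3]) (simp_all add: assms that T_closed(3) mult_closed)
  qed
  then show "frac a s = frac b t"
    using assms by (auto simp: frac_eq_set)
qed

lemma carrier_L: "carrier L = {frac a s | a s. a \<in> C \<and> s \<in> T}"
  by (auto simp: L_def localization_def quotient_def loc_frac_def)

lemma L_cases:
  assumes "x \<in> carrier L"
  obtains a s where "a \<in> C" "s \<in> T" "x = frac a s"
  using assms by (auto simp: carrier_L)

lemma frac_in_L: "a \<in> C \<Longrightarrow> s \<in> T \<Longrightarrow> frac a s \<in> carrier L"
  by (auto simp: carrier_L)

text \<open>
  Evaluates the unions over representatives by which the operations of the localization are defined.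
\<close>

lemma UN_frac:
  assumes ab: "a \<in> C" "s \<in> T" "b \<in> C" "t \<in> T"
    and F: "\<And>a' s' b' t'. a' \<in> C \<Longrightarrow> s' \<in> T \<Longrightarrow> b' \<in> C \<Longrightarrow> t' \<in> T \<Longrightarrow> a * s' = a' * s \<Longrightarrow> b * t' = b' * t
      \<Longrightarrow> F a' s' b' t' = Z"
  shows "(\<Union>(a', s')\<in>frac a s. \<Union>(b', t')\<in>frac b t. F a' s' b' t') = Z"
proof (rule SUP_eq_const)
  show "frac a s \<noteq> {}" using ab by (auto simp: frac_eq_set)
  fix p assume p: "p \<in> frac a s"
  obtain a' s' where p_eq: "p = (a', s')" by (cases p)
  have "(\<Union>(b', t')\<in>frac b t. F a' s' b' t') = Z"
  proof (rule SUP_eq_const)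
    show "frac b t \<noteq> {}" using ab by (auto simp: frac_eq_set)
    fix q assume q: "q \<in> frac b t"
    obtain b' t' where q_eq: "q = (b', t')" by (cases q)
    show "(case q of (b', t') \<Rightarrow> F a' s' b' t') = Z"
      using F[of a' s' b' t'] p q ab unfolding p_eq q_eq by (simp add: frac_eq_set)
  qed
  then show "(case p of (a', s') \<Rightarrow> \<Union>(b', t')\<in>frac b t. F a' s' b' t') = Z"
    by (simp add: p_eq)
qed

lemma L_mult:
  assumes "a \<in> C" "s \<in> T" "b \<in> C" "t \<in> T"
  shows "frac a s \<otimes>\<^bsub>L\<^esub> frac b t = frac (a * b) (s * t)"
proof -
  have "frac (a' * b') (s' * t') = frac (a * b) (s * t)"
    if "a' \<in> C" "s' \<in> T" "b' \<in> C" "t' \<in> T" "a * s' = a' * s" "b * t' = b' * t" for a' s' b' t'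
  proof -
    have "(a' * b') * (s * t) = (a' * s) * (b' * t)" by (simp add: ac_simps)
    also have "\<dots> = (a * b) * (s' * t')" by (simp add: that(5,6)[symmetric] ac_simps)
    finally show ?thesis using assms that T_closed by (subst frac_eq) (auto intro: mult_closed)
  qed
  then show ?thesis
    using UN_frac[OF assms, of "\<lambda>a s b t. frac (a * b) (s * t)"] by (simp add: L_def localization_def)
qed

lemma L_add:
  assumes "a \<in> C" "s \<in> T" "b \<in> C" "t \<in> T"
  shows "frac a s \<oplus>\<^bsub>L\<^esub> frac b t = frac (a * t + b * s) (s * t)"
proof -
  have "frac (a' * t' + b' * s') (s' * t') = frac (a * t + b * s) (s * t)"
    if "a' \<in> C" "s' \<in> T" "b' \<in> C" "t' \<in> T" "a * s' = a' * s" "b * t' = b' * t" for a' s' b' t'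
  proof -
    have "(a' * t' + b' * s') * (s * t) = (a' * s) * (t * t') + (b' * t) * (s * s')"
      by (simp add: algebra_simps)
    also have "\<dots> = (a * t + b * s) * (s' * t')"
      unfolding that(5,6)[symmetric] by (simp add: algebra_simps)
    finally show ?thesis
      using assms that T_closed by (subst frac_eq) (simp_all add: mult_closed add_closed)
  qed
  then show ?thesis
    using UN_frac[OF assms, of "\<lambda>a s b t. frac (a * t + b * s) (s * t)"] by (simp add: L_def localization_def)
qed

lemma L_one: "\<one>\<^bsub>L\<^esub> = frac 1 1" and L_zero: "\<zero>\<^bsub>L\<^esub> = frac 0 1"
  by (simp_all add: L_def localization_def)

lemma cring_L: "cring L"
proof (rule cringI)
  note closed = T_closed add_closed mult_closed zero_closed one_closed uminus_closed
  note simps = L_add L_mult L_one L_zero closed frac_in_L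
  show "abelian_group L"
  proof (rule abelian_groupI)
    show "x \<oplus>\<^bsub>L\<^esub> y \<in> carrier L" if "x \<in> carrier L" "y \<in> carrier L" for x y
      using that by (elim L_cases) (simp add: simps)
    show "\<zero>\<^bsub>L\<^esub> \<in> carrier L" by (simp add: simps)
    show "x \<oplus>\<^bsub>L\<^esub> y \<oplus>\<^bsub>L\<^esub> z = x \<oplus>\<^bsub>L\<^esub> (y \<oplus>\<^bsub>L\<^esub> z)"
      if "x \<in> carrier L" "y \<in> carrier L" "z \<in> carrier L" for x y z
      using that by (elim L_cases) (simp add: simps algebra_simps)
    show "x \<oplus>\<^bsub>L\<^esub> y = y \<oplus>\<^bsub>L\<^esub> x" if "x \<in> carrier L" "y \<in> carrier L" for x y
      using that by (elim L_cases) (simp add: simps algebra_simps)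
    show "\<zero>\<^bsub>L\<^esub> \<oplus>\<^bsub>L\<^esub> x = x" if "x \<in> carrier L" for x
      using that by (elim L_cases) (simp add: simps)
    show "\<exists>y\<in>carrier L. y \<oplus>\<^bsub>L\<^esub> x = \<zero>\<^bsub>L\<^esub>" if x: "x \<in> carrier L" for x
      using x
    proof (rule L_cases)
      fix a s assume as: "a \<in> C" "s \<in> T" "x = frac a s"
      then have "frac (- a) s \<oplus>\<^bsub>L\<^esub> x = \<zero>\<^bsub>L\<^esub>"
        by (simp add: simps frac_eq)
      then show ?thesis using as by (intro bexI[of _ "frac (- a) s"]) (simp_all add: simps)
    qed
  qed
  show "Group.comm_monoid L"
  proof (rule comm_monoidI)
    show "x \<otimes>\<^bsub>L\<^esub> y \<in> carrier L" if "x \<in> carrier L" "y \<in> carrier L" for x y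
      using that by (elim L_cases) (simp add: simps)
    show "\<one>\<^bsub>L\<^esub> \<in> carrier L" by (simp add: simps)
    show "x \<otimes>\<^bsub>L\<^esub> y \<otimes>\<^bsub>L\<^esub> z = x \<otimes>\<^bsub>L\<^esub> (y \<otimes>\<^bsub>L\<^esub> z)"
      if "x \<in> carrier L" "y \<in> carrier L" "z \<in> carrier L" for x y z
      using that by (elim L_cases) (simp add: simps algebra_simps)
    show "x \<otimes>\<^bsub>L\<^esub> y = y \<otimes>\<^bsub>L\<^esub> x" if "x \<in> carrier L" "y \<in> carrier L" for x y
      using that by (elim L_cases) (simp add: simps algebra_simps)
    show "\<one>\<^bsub>L\<^esub> \<otimes>\<^bsub>L\<^esub> x = x" if "x \<in> carrier L" for x
      using that by (elim L_cases) (simp add: simps)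
  qed
  show "(x \<oplus>\<^bsub>L\<^esub> y) \<otimes>\<^bsub>L\<^esub> z = x \<otimes>\<^bsub>L\<^esub> z \<oplus>\<^bsub>L\<^esub> y \<otimes>\<^bsub>L\<^esub> z"
    if "x \<in> carrier L" "y \<in> carrier L" "z \<in> carrier L" for x y z
    using that by (elim L_cases) (simp add: simps frac_eq algebra_simps)
qed

text \<open>
  In the quotient, every element is a unit times a power of the image of \<open>t\<close>. The \<open>m\<close>-th power of this
  image vanishes if and only if \<open>a\<close> divides \<open>t\<^sup>m\<close> in the local ring, that is, if \<open>n \<le> m\<close>.
\<close>

lemma ring_length_quotient:
  assumes a: "a \<in> C" and t: "t \<in> P" "t \<noteq> 0"
    and local_param: "\<And>b. b \<in> C \<Longrightarrow> b \<noteq> 0 \<Longrightarrow> \<exists>m. \<exists>s\<in>T. \<exists>s'\<in>T. s * b = s' * t ^ m"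
    and n: "s \<in> T" "s' \<in> T" "s * a = s' * t ^ n"
  shows "ring_length (L Quot (PIdl\<^bsub>L\<^esub> (frac a 1))) = enat n"
proof -
  interpret L: cring L by (rule cring_L)
  define I where "I = PIdl\<^bsub>L\<^esub> (frac a 1)"
  define B where "B = L Quot I"
  note closed = T_closed mult_closed zero_closed one_closed
  have tC: "t \<in> C" using t primeidealD(1)[OF prime] by blast
  have tm: "t ^ m \<in> C" for m using tC by (rule power_closed)
  have I: "ideal I L" unfolding I_def by (intro L.cgenideal_ideal frac_in_L a closed)
  then interpret I: ideal I L .
  interpret B: cring B unfolding B_def by (rule I.quotient_is_cring) (rule cring_L)
  interpret q: ring_hom_cring L B "(+>\<^bsub>L\<^esub>) I"
    unfolding B_def by (rule I.rcos_ring_hom_cring) (rule cring_L)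
  define \<pi> where "\<pi> x = I +>\<^bsub>L\<^esub> frac x 1" for x
  have \<pi>_closed: "\<pi> x \<in> carrier B" if "x \<in> C" for x
    unfolding \<pi>_def using that by (intro q.hom_closed) (simp add: frac_in_L closed)
  have \<pi>_mult: "\<pi> (x * y) = \<pi> x \<otimes>\<^bsub>B\<^esub> \<pi> y" if "x \<in> C" "y \<in> C" for x y
    unfolding \<pi>_def using that q.hom_mult[of "frac x 1" "frac y 1"]
    by (simp add: frac_in_L closed L_mult)
  have \<pi>_one: "\<pi> 1 = \<one>\<^bsub>B\<^esub>"
    unfolding \<pi>_def using q.hom_one by (simp add: L_one)
  have \<pi>_pow: "\<pi> (t ^ m) = \<pi> t [^]\<^bsub>B\<^esub> m" for m
    by (induction m) (simp_all add: \<pi>_one \<pi>_mult tC tm mult.commute[of t])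
  have inv_frac: "(I +>\<^bsub>L\<^esub> frac 1 r) \<otimes>\<^bsub>B\<^esub> \<pi> r = \<one>\<^bsub>B\<^esub>" "I +>\<^bsub>L\<^esub> frac 1 r \<in> carrier B"
    if "r \<in> T" for r
  proof -
    have "frac 1 r \<otimes>\<^bsub>L\<^esub> frac r 1 = \<one>\<^bsub>L\<^esub>"
      using that by (simp add: L_mult L_one closed frac_eq)
    then show "(I +>\<^bsub>L\<^esub> frac 1 r) \<otimes>\<^bsub>B\<^esub> \<pi> r = \<one>\<^bsub>B\<^esub>"
      unfolding \<pi>_def using q.hom_mult[of "frac 1 r" "frac r 1"] that q.hom_one
      by (simp add: frac_in_L closed)
    show "I +>\<^bsub>L\<^esub> frac 1 r \<in> carrier B"
      using that by (intro q.hom_closed) (simp add: frac_in_L closed)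
  qed
  have inv_frac': "\<pi> r \<otimes>\<^bsub>B\<^esub> (I +>\<^bsub>L\<^esub> frac 1 r) = \<one>\<^bsub>B\<^esub>" if "r \<in> T" for r
    using inv_frac[OF that] B.m_comm[OF \<pi>_closed[OF closed(3)[OF that]] inv_frac(2)[OF that]] by simp
  have unit1: "\<pi> r \<in> Units B" if "r \<in> T" for r
    using inv_frac[OF that] inv_frac'[OF that] \<pi>_closed[OF closed(3)[OF that]]
    unfolding Units_def by blast
  have unit2: "I +>\<^bsub>L\<^esub> frac 1 r \<in> Units B" if "r \<in> T" for r
    using inv_frac[OF that] inv_frac'[OF that] \<pi>_closed[OF closed(3)[OF that]]
    unfolding Units_def by blast
  have zero_iff: "\<pi> x = \<zero>\<^bsub>B\<^esub> \<longleftrightarrow> (\<exists>b\<in>C. \<exists>r\<in>T. r * x = b * a)" if x: "x \<in> C" for x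
  proof -
    have "\<pi> x = \<zero>\<^bsub>B\<^esub> \<longleftrightarrow> frac x 1 \<in> I"
    proof -
      have zero_B: "\<zero>\<^bsub>B\<^esub> = I" unfolding B_def FactRing_def by simp
      have self: "frac x 1 \<in> \<pi> x"
        unfolding \<pi>_def by (rule I.a_rcos_self[OF frac_in_L[OF x closed(1)]])
      show ?thesis
        unfolding zero_B
      proof
        assume "\<pi> x = I"
        then show "frac x 1 \<in> I" using self by (rule subst)
      next
        assume "frac x 1 \<in> I"
        then show "\<pi> x = I" unfolding \<pi>_def by (rule L.a_rcos_zero[OF I])
      qed
    qed
    also have "\<dots> \<longleftrightarrow> (\<exists>b\<in>C. \<exists>r\<in>T. frac x 1 = frac b r \<otimes>\<^bsub>L\<^esub> frac a 1)"
      unfolding I_def cgenideal_def carrier_L by auto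
    also have "\<dots> \<longleftrightarrow> (\<exists>b\<in>C. \<exists>r\<in>T. r * x = b * a)"
      using x a by (intro bex_cong refl) (simp add: L_mult closed frac_eq mult.commute)
    finally show ?thesis .
  qed
  have "\<exists>u\<in>Units B. \<exists>j::nat. x = u \<otimes>\<^bsub>B\<^esub> \<pi> t [^]\<^bsub>B\<^esub> j" if x: "x \<in> carrier B" for x
  proof -
    obtain y where y: "y \<in> carrier L" "x = I +>\<^bsub>L\<^esub> y"
      using x by (auto simp: B_def FactRing_def A_RCOSETS_def' a_r_coset_def)
    obtain b r where b: "b \<in> C" "r \<in> T" "y = frac b r" using y(1) by (rule L_cases)
    have "y = frac 1 r \<otimes>\<^bsub>L\<^esub> frac b 1" unfolding b(3) using b by (simp add: L_mult closed)
    then have x_eq: "x = (I +>\<^bsub>L\<^esub> frac 1 r) \<otimes>\<^bsub>B\<^esub> \<pi> b"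
      unfolding y(2) \<pi>_def using b by (simp add: q.hom_mult frac_in_L closed)
    have "\<exists>u\<in>Units B. \<exists>j::nat. \<pi> b = u \<otimes>\<^bsub>B\<^esub> \<pi> t [^]\<^bsub>B\<^esub> j"
    proof (cases "b = 0")
      case True
      have "s' * t ^ n \<in> C" using n(2) tm by (simp add: closed)
      moreover have "\<exists>b\<in>C. \<exists>r\<in>T. r * t ^ n = b * a"
        using n by (intro bexI[of _ s] bexI[of _ s']) (simp_all add: closed)
      ultimately have "\<pi> t [^]\<^bsub>B\<^esub> n = \<zero>\<^bsub>B\<^esub>" using zero_iff[OF tm] by (simp add: \<pi>_pow)
      moreover have "\<exists>b\<in>C. \<exists>r\<in>T. r * 0 = b * a"
        by (intro bexI[of _ 0] bexI[of _ 1]) (simp_all add: closed)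
      then have "\<pi> b = \<zero>\<^bsub>B\<^esub>" using zero_iff[of 0] True by (simp add: closed)
      ultimately show ?thesis by (intro bexI[of _ "\<one>\<^bsub>B\<^esub>"] exI[of _ n]) simp_all
    next
      case False
      obtain m r r' where r: "r \<in> T" "r' \<in> T" "r * b = r' * t ^ m"
        using local_param[OF b(1) False] by (elim exE bexE) (rule that)
      have "\<pi> r \<otimes>\<^bsub>B\<^esub> \<pi> b = \<pi> r' \<otimes>\<^bsub>B\<^esub> \<pi> t [^]\<^bsub>B\<^esub> m"
        using arg_cong[OF r(3), of \<pi>] r(1,2) b(1) tm by (simp add: \<pi>_mult \<pi>_pow closed)
      moreover have "\<pi> b = inv\<^bsub>B\<^esub> (\<pi> r) \<otimes>\<^bsub>B\<^esub> (\<pi> r \<otimes>\<^bsub>B\<^esub> \<pi> b)"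
        using unit1[OF r(1)] B.Units_closed[OF unit1[OF r(1)]] \<pi>_closed[OF b(1)]
        by (simp add: B.m_assoc[symmetric])
      ultimately have "\<pi> b = (inv\<^bsub>B\<^esub> (\<pi> r) \<otimes>\<^bsub>B\<^esub> \<pi> r') \<otimes>\<^bsub>B\<^esub> \<pi> t [^]\<^bsub>B\<^esub> m"
        using unit1[OF r(1)] B.Units_closed[OF unit1[OF r(2)]] \<pi>_closed[OF tC] by (simp add: B.m_assoc)
      then show ?thesis using unit1[OF r(1)] unit1[OF r(2)]
        by (intro bexI[of _ "inv\<^bsub>B\<^esub> (\<pi> r) \<otimes>\<^bsub>B\<^esub> \<pi> r'"] exI[of _ m]) auto
    qed
    then obtain u j where u: "u \<in> Units B" "\<pi> b = u \<otimes>\<^bsub>B\<^esub> \<pi> t [^]\<^bsub>B\<^esub> (j::nat)"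
      by (elim exE bexE) (rule that)
    have "x = ((I +>\<^bsub>L\<^esub> frac 1 r) \<otimes>\<^bsub>B\<^esub> u) \<otimes>\<^bsub>B\<^esub> \<pi> t [^]\<^bsub>B\<^esub> j"
      unfolding x_eq u(2) using B.Units_closed[OF unit2[OF b(2)]] B.Units_closed[OF u(1)] \<pi>_closed[OF tC]
      by (simp add: B.m_assoc)
    then show ?thesis using unit2[OF b(2)] u(1)
      by (intro bexI[of _ "(I +>\<^bsub>L\<^esub> frac 1 r) \<otimes>\<^bsub>B\<^esub> u"] exI[of _ j]) auto
  qed
  moreover have "\<pi> t [^]\<^bsub>B\<^esub> m = \<zero>\<^bsub>B\<^esub> \<longleftrightarrow> n \<le> m" for m
  proof -
    have "(\<exists>b\<in>C. \<exists>r\<in>T. r * t ^ m = b * a) \<longleftrightarrow> n \<le> m"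
    proof
      assume "n \<le> m"
      then have tm_eq: "t ^ m = t ^ n * t ^ (m - n)" by (simp flip: power_add)
      have "s' * t ^ m = (s' * t ^ n) * t ^ (m - n)" unfolding tm_eq by (simp only: mult.assoc)
      then have "s' * t ^ m = (s * t ^ (m - n)) * a"
        unfolding n(3)[symmetric] by (simp only: ac_simps)
      then show "\<exists>b\<in>C. \<exists>r\<in>T. r * t ^ m = b * a"
        using n(1,2) tm by (intro bexI[of _ "s * t ^ (m - n)"] bexI[of _ s']) (simp_all add: closed)
    next
      assume "\<exists>b\<in>C. \<exists>r\<in>T. r * t ^ m = b * a"
      then obtain b r where br: "b \<in> C" "r \<in> T" "r * t ^ m = b * a"
        by (elim bexE) (rule that)
      show "n \<le> m"
      proof (rule ccontr)
        assume "\<not> n \<le> m"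
        then have "t ^ n = t ^ (m + (n - m - 1) + 1)" by simp
        then have tn: "t ^ n = t ^ m * (t ^ (n - m - 1) * t)"
          by (simp only: power_add power_one_right mult.assoc)
        have "t ^ m * (s * r) = s * (r * t ^ m)" by (simp only: ac_simps)
        also have "\<dots> = b * (s * a)" unfolding br(3) by (simp only: ac_simps)
        also have "\<dots> = t ^ m * (b * s' * t ^ (n - m - 1) * t)"
          unfolding n(3) tn by (simp only: ac_simps)
        finally have eq': "t ^ m * (s * r) = t ^ m * (b * s' * t ^ (n - m - 1) * t)" .
        have tm0: "t ^ m \<noteq> 0"
        proof (induction m)
          case (Suc m)
          then show ?case using no_zero_divisors[OF tC tm[of m]] t(2) by auto
        qed simp
        have "s * r \<in> C" by (intro T_closed(2,3) n br)
        moreover have "b * s' * t ^ (n - m - 1) * t \<in> C"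
          by (intro mult_closed br tm tC T_closed(3) n)
        ultimately have eq: "s * r = b * s' * t ^ (n - m - 1) * t"
          by (rule cancel[OF tm tm0 _ _ eq'])
        have "b * s' * t ^ (n - m - 1) * t \<in> P"
          by (rule primeidealD(5)[OF prime mult_closed[OF mult_closed[OF br(1) T_closed(3)[OF n(2)]] tm] t(1)])
        moreover have "s * r \<in> T" using n(1) br(2) by (rule T_closed(2))
        ultimately show False unfolding eq T_def by blast
      qed
    qed
    then show ?thesis using zero_iff[OF tm[of m]] by (simp add: \<pi>_pow)
  qed
  ultimately show ?thesis
    unfolding I_def[symmetric] B_def[symmetric]
    by (intro ring_length_uniserial[OF B.is_cring \<pi>_closed[OF tC]])
qed

end

context subdomain
begin

text \<open>
  The elements \<open>s\<close> and \<open>s'\<close> are units of the local ring at \<open>P\<close>. So the condition says that this local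
  ring is a discrete valuation ring with uniformizer \<open>t\<close>.
\<close>

definition uniformizer :: "'a set \<Rightarrow> 'a \<Rightarrow> bool" where
  "uniformizer P t \<longleftrightarrow> t \<in> P \<and> t \<noteq> 0 \<and>
     (\<forall>b\<in>C - {0}. \<exists>m. \<exists>s\<in>C - P. \<exists>s'\<in>C - P. s * b = s' * t ^ m)"

lemma uniformizerE:
  assumes "uniformizer P t" "b \<in> C" "b \<noteq> 0"
  obtains m s s' where "s \<in> C - P" "s' \<in> C - P" "s * b = s' * t ^ m"
proof -
  have "b \<in> C - {0}" using assms by simp
  with assms(1) have "\<exists>m. \<exists>s\<in>C - P. \<exists>s'\<in>C - P. s * b = s' * t ^ m"
    unfolding uniformizer_def by (elim conjE bspec)
  then show ?thesis by (elim exE bexE) (rule that)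
qed

lemma uniformizerD: "uniformizer P t \<Longrightarrow> t \<in> P" "uniformizer P t \<Longrightarrow> t \<noteq> 0"
  by (simp_all add: uniformizer_def)

lemma ord_at_eq:
  assumes P: "primeideal P R" and t: "uniformizer P t"
    and "a \<in> C" "s \<in> C - P" "s' \<in> C - P" "s * a = s' * t ^ n"
  shows "ord_at R P a = n"
proof -
  interpret localized_subdomain C P 
    by (rule localized_subdomain.intro[OF subdomain_axioms localized_subdomain_axioms.intro[OF P]])
  have "ring_length (L Quot (PIdl\<^bsub>L\<^esub> (frac a 1))) = enat n"
  proof (rule ring_length_quotient[OF assms(3) _ _ _ _ _ assms(6)])
    show "t \<in> P" "t \<noteq> 0" using t by (rule uniformizerD)+
    show "\<exists>m. \<exists>s\<in>T. \<exists>s'\<in>T. s * b = s' * t ^ m" if "b \<in> C" "b \<noteq> 0" for b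
      unfolding T_def by (rule uniformizerE[OF t that]) (intro exI bexI, assumption+)
    show "s \<in> T" "s' \<in> T" using assms(4,5) unfolding T_def .
  qed
  then show ?thesis unfolding ord_at_def Let_def L_def T_def R_simps by simp
qed

lemma ord_at_witness:
  assumes P: "primeideal P R" and t: "uniformizer P t" and a: "a \<in> C" "a \<noteq> 0"
  obtains s s' where "s \<in> C - P" "s' \<in> C - P" "s * a = s' * t ^ ord_at R P a"
proof -
  obtain m s s' where *: "s \<in> C - P" "s' \<in> C - P" "s * a = s' * t ^ m"
    using t a by (rule uniformizerE)
  have "ord_at R P a = m" by (rule ord_at_eq[OF P t a(1) *])
  then show ?thesis by (intro that[OF *(1,2)]) (simp only: *(3))
qed

lemma compl_prime_mult:
  assumes P: "primeideal P R" and "s \<in> C - P" "t \<in> C - P"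
  shows "s * t \<in> C - P"
  using primeidealD(6)[OF P, of s t] assms(2,3) by (auto simp: mult_closed)

lemma ord_at_mult:
  assumes P: "primeideal P R" and t: "uniformizer P t"
    and a: "a \<in> C" "a \<noteq> 0" and b: "b \<in> C" "b \<noteq> 0"
  shows "ord_at R P (a * b) = ord_at R P a + ord_at R P b"
proof -
  obtain s s' where s: "s \<in> C - P" "s' \<in> C - P" "s * a = s' * t ^ ord_at R P a"
    using ord_at_witness[OF P t a] .
  obtain r r' where r: "r \<in> C - P" "r' \<in> C - P" "r * b = r' * t ^ ord_at R P b"
    using ord_at_witness[OF P t b] .
  have "(s * r) * (a * b) = (s * a) * (r * b)" by (simp only: ac_simps)
  also have "\<dots> = (s' * r') * t ^ (ord_at R P a + ord_at R P b)"
    unfolding s(3) r(3) power_add by (simp only: ac_simps)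
  finally show ?thesis
    by (rule ord_at_eq[OF P t mult_closed[OF a(1) b(1)] compl_prime_mult[OF P s(1) r(1)] compl_prime_mult[OF P s(2) r(2)]])
qed

lemma ord_at_eq_0:
  assumes P: "primeideal P R" and t: "uniformizer P t" and a: "a \<in> C - P"
  shows "ord_at R P a = 0"
  by (rule ord_at_eq[OF P t, of a 1 a]) (use a primeidealD(3)[OF P] in \<open>simp_all add: one_closed\<close>)

text \<open>
  A nonzero element of \<open>Q\<close> is a power of \<open>t\<close> up to factors outside \<open>P\<close>, so \<open>Q\<close> contains \<open>t\<close>. Every
  element of \<open>P\<close> is a multiple of \<open>t\<close> up to such factors, so \<open>Q\<close> contains it too.
\<close>

lemma prime_below_uniformizer:
  assumes P: "primeideal P R" and t: "uniformizer P t"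
    and Q: "primeideal Q R" "Q \<subseteq> P" "Q \<noteq> {0}"
  shows "Q = P"
proof -
  have tC: "t \<in> C" using uniformizerD(1)[OF t] primeidealD(1)[OF P] by blast
  obtain a where a: "a \<in> Q" "a \<noteq> 0" using Q(3) primeidealD(2)[OF Q(1)] by blast
  have aC: "a \<in> C" using a(1) primeidealD(1)[OF Q(1)] by blast
  obtain s s' where s: "s \<in> C - P" "s' \<in> C - P" "s * a = s' * t ^ ord_at R P a"
    using ord_at_witness[OF P t aC a(2)] .
  have *: "t ^ m \<in> Q \<Longrightarrow> t \<in> Q" for m
  proof (induction m)
    case 0
    then show ?case using primeidealD(3)[OF Q(1)] by simp
  next
    case (Suc m)
    then show ?case using primeidealD(6)[OF Q(1) tC power_closed[OF tC, of m]] by auto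
  qed
  have "s * a \<in> Q" using s(1) a(1) by (intro primeidealD(5)[OF Q(1)]) simp_all
  then have "s' * t ^ ord_at R P a \<in> Q" by (simp only: s(3))
  then have "s' \<in> Q \<or> t ^ ord_at R P a \<in> Q"
    by (rule primeidealD(6)[OF Q(1), rotated 2]) (use s(2) power_closed[OF tC] in auto)
  then have tQ: "t \<in> Q" using * s(2) Q(2) by blast
  have "b \<in> Q" if b: "b \<in> P" for b
  proof (cases "b = 0")
    case True
    then show ?thesis using primeidealD(2)[OF Q(1)] by simp
  next
    case False
    have bC: "b \<in> C" using b primeidealD(1)[OF P] by blast
    obtain m r r' where r: "r \<in> C - P" "r' \<in> C - P" "r * b = r' * t ^ m"
      using t bC False by (rule uniformizerE)
    have "m \<noteq> 0"
    proof
      assume "m = 0"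
      then have "r' = r * b" using r(3) by simp
      also have "\<dots> \<in> P" using r(1) b by (intro primeidealD(5)[OF P]) simp_all
      finally show False using r(2) by simp
    qed
    then have "t ^ m = t ^ (m - 1) * t" by (cases m) (simp_all add: mult.commute)
    then have "r * b = (r' * t ^ (m - 1)) * t" unfolding r(3) by (simp only: mult.assoc)
    also have "\<dots> \<in> Q"
      by (intro primeidealD(5)[OF Q(1)] mult_closed power_closed tC tQ) (use r(2) in simp)
    finally have "r \<in> Q \<or> b \<in> Q"
      by (rule primeidealD(6)[OF Q(1), rotated 2]) (use r(1) bC in auto)
    then show ?thesis using r(1) Q(2) by blast
  qed
  then show ?thesis using Q(2) by blast
qed

lemma zero_primeideal: "primeideal {0} R"
  by (rule domain.zeroprimeideal[OF domain_R, unfolded R_simps])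

text \<open>
  The only nonzero prime inside a prime with a uniformizer is that prime itself, which gives it
  height one. Conversely, a prime of height one cannot properly contain a member of the family.
\<close>

lemma codim1_points_eq:
  assumes prime: "\<And>P. P \<in> \<P> \<Longrightarrow> primeideal P R \<and> (\<exists>t. uniformizer P t)"
    and below: "\<And>Q. primeideal Q R \<Longrightarrow> Q \<noteq> {0} \<Longrightarrow> \<exists>P\<in>\<P>. P \<subseteq> Q"
  shows "codim1_points R = \<P>"
proof (intro equalityI subsetI)
  fix P assume "P \<in> \<P>"
  then obtain t where P: "primeideal P R" and t: "uniformizer P t" using prime by blast
  have P0: "{0} \<subset> P" using uniformizerD[OF t] primeidealD(2)[OF P] by blast
  have le: "n \<le> 1" if Q: "\<forall>i\<le>n. primeideal (Q i) R" "Q n = P" "\<forall>i<n. Q i \<subset> Q (Suc i)"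
    for n and Q :: "nat \<Rightarrow> 'a set"
  proof (rule ccontr)
    assume "\<not> n \<le> 1"
    then have n: "n = Suc (Suc (n - 2))" by simp
    define k where "k = n - 2"
    note n = n[folded k_def]
    have sub: "Q k \<subset> Q (Suc k)" "Q (Suc k) \<subset> P" using Q(2,3) n by auto
    have pk: "primeideal (Q k) R" "primeideal (Q (Suc k)) R"
      by (rule Q(1)[rule_format], simp add: n)+
    have ne: "Q (Suc k) \<noteq> {0}"
    proof
      assume "Q (Suc k) = {0}"
      then have "Q k \<subset> {0}" using sub(1) by simp
      then have "0 \<notin> Q k" by auto
      then show False using primeidealD(2)[OF pk(1)] by simp
    qed
    from pk(2) have "Q (Suc k) = P" using sub(2) ne by (intro prime_below_uniformizer[OF P t]) simp_all
    then show False using sub(2) by simp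
  qed
  have "height R P = 1"
    unfolding height_def one_enat_def
  proof (rule antisym)
    show "Sup {enat n |n. \<exists>Q::nat \<Rightarrow> _ set. (\<forall>i\<le>n. primeideal (Q i) R) \<and> Q n = P \<and> (\<forall>i<n. Q i \<subset> Q (Suc i))} \<le> enat 1"
      by (rule Sup_least) (use le in auto)
    have "\<exists>Q::nat \<Rightarrow> _ set. (\<forall>i\<le>1. primeideal (Q i) R) \<and> Q 1 = P \<and> (\<forall>i<1. Q i \<subset> Q (Suc i))"
      using P P0 zero_primeideal
      by (intro exI[of _ "\<lambda>i. if i = 0 then {0} else P"]) auto
    then show "enat 1 \<le> Sup {enat n |n. \<exists>Q::nat \<Rightarrow> _ set. (\<forall>i\<le>n. primeideal (Q i) R) \<and> Q n = P \<and> (\<forall>i<n. Q i \<subset> Q (Suc i))}"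
      by (intro Sup_upper) blast
  qed
  then show "P \<in> codim1_points R" using P by (simp add: codim1_points_def)
next
  fix Q assume "Q \<in> codim1_points R"
  then have Q: "primeideal Q R" "height R Q = 1" by (auto simp: codim1_points_def)
  have "Q \<noteq> {0}"
  proof
    assume Q0: "Q = {0}"
    have "n = 0" if F: "\<forall>i\<le>n. primeideal (F i) R" "F n = Q" "\<forall>i<n. F i \<subset> F (Suc i)"
      for n and F :: "nat \<Rightarrow> 'a set"
    proof (rule ccontr)
      assume "n \<noteq> 0"
      then obtain k where n: "n = Suc k" by (cases n) auto
      have "F k \<subset> F (Suc k)" by (rule F(3)[rule_format]) (simp add: n)
      then have "F k \<subset> {0}" using F(2) Q0 n by simp
      then have "0 \<notin> F k" by auto
      moreover have "primeideal (F k) R" by (rule F(1)[rule_format]) (simp add: n)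
      ultimately show False using primeidealD(2) by simp
    qed
    then have "height R Q \<le> enat 0" unfolding height_def by (intro Sup_least) auto
    then show False using Q(2) by (simp add: one_enat_def)
  qed
  then obtain P where P: "P \<in> \<P>" "P \<subseteq> Q" using below Q(1) by blast
  obtain t where PR: "primeideal P R" and t: "uniformizer P t" using prime P(1) by blast
  have "P = Q"
  proof (rule ccontr)
    assume "P \<noteq> Q"
    then have "P \<subset> Q" using P(2) by blast
    moreover have "{0} \<subset> P" using uniformizerD[OF t] primeidealD(2)[OF PR] by blast
    ultimately have "\<exists>F::nat \<Rightarrow> _ set. (\<forall>i\<le>2. primeideal (F i) R) \<and> F 2 = Q \<and> (\<forall>i<2. F i \<subset> F (Suc i))"
      using PR Q(1) zero_primeideal
      by (intro exI[of _ "\<lambda>i. if i = 0 then {0} else if i = 1 then P else Q"]) (auto simp: less_2_cases_iff)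
    then have "enat 2 \<le> height R Q" unfolding height_def by (intro Sup_upper) blast
    then show False using Q(2) by (simp add: one_enat_def)
  qed
  then show "Q \<in> \<P>" using P(1) by simp
qed

end

section \<open>Exponents and prime factors of Laurent polynomials\<close>

definition minval :: "(int ^ 3 \<Rightarrow> int) \<Rightarrow> (int ^ 3 \<Rightarrow>\<^sub>0 'k::field) \<Rightarrow> int" where
  "minval lam f = Min (lam ` keys f)"

lemma minval_le: "m \<in> keys f \<Longrightarrow> minval lam f \<le> lam m"
  unfolding minval_def by (rule Min_le) auto

lemma minval_attained:
  assumes "f \<noteq> 0"
  obtains m where "m \<in> keys f" "lam m = minval lam f"
proof -
  have "minval lam f \<in> lam ` keys f"
    unfolding minval_def using assms by (intro Min_in) auto
  then show ?thesis using that by auto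
qed

lemma minval_eqI:
  assumes "m \<in> keys f" "lam m = c" "\<And>n. n \<in> keys f \<Longrightarrow> c \<le> lam n"
  shows "minval lam f = c"
  unfolding minval_def by (rule Min_eqI) (use assms in auto)

definition restrict_keys :: "'a set \<Rightarrow> ('a \<Rightarrow>\<^sub>0 'b::comm_monoid_add) \<Rightarrow> 'a \<Rightarrow>\<^sub>0 'b" where
  "restrict_keys A f = (\<Sum>m\<in>keys f \<inter> A. Poly_Mapping.single m (lookup f m))"

lemma lookup_restrict_keys: "lookup (restrict_keys A f) m = (if m \<in> A then lookup f m else 0)"
proof -
  have "lookup (restrict_keys A f) m = (\<Sum>n\<in>keys f \<inter> A. if n = m then lookup f m else 0)"
    unfolding restrict_keys_def lookup_sum by (rule sum.cong) (auto simp: lookup_single when_def)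
  also have "\<dots> = (if m \<in> keys f \<inter> A then lookup f m else 0)" by simp
  also have "\<dots> = (if m \<in> A then lookup f m else 0)" by (simp add: in_keys_iff)
  finally show ?thesis .
qed

lemma keys_restrict_keys: "keys (restrict_keys A f) = keys f \<inter> A"
  by (auto simp: in_keys_iff lookup_restrict_keys split: if_splits)

lemma keys_multE:
  assumes "m \<in> keys (f * g)"
  obtains a b where "a \<in> keys f" "b \<in> keys g" "m = a + b"
  using keys_mult[of f g] assms by auto

text \<open>
  The parts of \<open>f\<close> and \<open>g\<close> on which \<open>lam\<close> is minimal have a nonzero product, and on all other products
  of terms \<open>lam\<close> is larger.
\<close>

lemma minval_mult:
  fixes f g :: "int ^ 3 \<Rightarrow>\<^sub>0 'k::field"
  assumes lam: "\<And>x y. lam (x + y) = lam x + lam y" and f: "f \<noteq> 0" and g: "g \<noteq> 0"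
  shows "minval lam (f * g) = minval lam f + minval lam g"
proof -
  let ?a = "minval lam f" and ?b = "minval lam g"
  define f0 where "f0 = restrict_keys {m. lam m = ?a} f"
  define g0 where "g0 = restrict_keys {m. lam m = ?b} g"
  have f0: "f0 \<noteq> 0"
  proof -
    obtain m where "m \<in> keys f" "lam m = ?a" using minval_attained[OF f] .
    then have "m \<in> keys f0" unfolding f0_def keys_restrict_keys by simp
    then show ?thesis by auto
  qed
  have g0: "g0 \<noteq> 0"
  proof -
    obtain m where "m \<in> keys g" "lam m = ?b" using minval_attained[OF g] .
    then have "m \<in> keys g0" unfolding g0_def keys_restrict_keys by simp
    then show ?thesis by auto
  qed
  have f1: "?a < lam m" if "m \<in> keys (f - f0)" for m
  proof -
    have "m \<in> keys f" "lam m \<noteq> ?a"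
      using that by (auto simp: in_keys_iff lookup_minus f0_def lookup_restrict_keys split: if_splits)
    then show ?thesis using minval_le[of m f lam] by simp
  qed
  have g1: "?b < lam m" if "m \<in> keys (g - g0)" for m
  proof -
    have "m \<in> keys g" "lam m \<noteq> ?b"
      using that by (auto simp: in_keys_iff lookup_minus g0_def lookup_restrict_keys split: if_splits)
    then show ?thesis using minval_le[of m g lam] by simp
  qed
  have g_le: "?b \<le> lam m" if "m \<in> keys g" for m using minval_le[OF that] .
  have keys_f0: "lam m = ?a" if "m \<in> keys f0" for m
    using that unfolding f0_def keys_restrict_keys by simp
  have keys_g0: "lam m = ?b" if "m \<in> keys g0" for m
    using that unfolding g0_def keys_restrict_keys by simp
  have "f0 * g0 \<noteq> 0" using laurent_no_zero_divisors[of f0 g0] f0 g0 by blast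
  then obtain m where m: "m \<in> keys (f0 * g0)" using keys_eq_empty by fastforce
  then have lm: "lam m = ?a + ?b"
    by (elim keys_multE) (simp add: lam keys_f0 keys_g0)
  have "m \<notin> keys ((f - f0) * g)"
  proof
    assume "m \<in> keys ((f - f0) * g)"
    then obtain x y where "x \<in> keys (f - f0)" "y \<in> keys g" "m = x + y" by (rule keys_multE)
    then show False using f1[of x] g_le[of y] lm by (simp add: lam)
  qed
  moreover have "m \<notin> keys (f0 * (g - g0))"
  proof
    assume "m \<in> keys (f0 * (g - g0))"
    then obtain x y where "x \<in> keys f0" "y \<in> keys (g - g0)" "m = x + y" by (rule keys_multE)
    then show False using keys_f0[of x] g1[of y] lm by (simp add: lam)
  qed
  moreover have "f * g = f0 * g0 + (f - f0) * g + f0 * (g - g0)" by (simp add: algebra_simps)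
  ultimately have "lookup (f * g) m = lookup (f0 * g0) m"
    by (simp add: lookup_add in_keys_iff)
  then have "m \<in> keys (f * g)" using m by (simp add: in_keys_iff)
  then show ?thesis
  proof (rule minval_eqI)
    show "lam m = ?a + ?b" by (rule lm)
    fix n assume "n \<in> keys (f * g)"
    then obtain x y where "x \<in> keys f" "y \<in> keys g" "n = x + y" by (rule keys_multE)
    then show "?a + ?b \<le> lam n" using minval_le[of x f lam] minval_le[of y g lam] by (simp add: lam)
  qed
qed

text \<open>
  The minimum of a coordinate over the exponents is additive under products, and so is the maximum.
  For a unit and its inverse the differences between maximum and minimum therefore add up to \<open>0\<close>, so
  both differences vanish.
\<close>

lemma laurent_unit_is_term:
  fixes u :: "int ^ 3 \<Rightarrow>\<^sub>0 'k::field"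
  assumes "u dvd 1"
  obtains m c where "c \<noteq> 0" "u = Poly_Mapping.single m c"
proof -
  obtain v where v: "1 = u * v" using assms by (elim dvdE)
  have u0: "u \<noteq> 0" and v0: "v \<noteq> 0" using v by auto
  have eq: "m $ j = n $ j" if mn: "m \<in> keys u" "n \<in> keys u" for m n j
  proof -
    let ?p = "\<lambda>x :: int ^ 3. x $ j" and ?q = "\<lambda>x :: int ^ 3. - (x $ j)"
    have one: "minval ?p (1 :: int ^ 3 \<Rightarrow>\<^sub>0 'k) = 0" "minval ?q (1 :: int ^ 3 \<Rightarrow>\<^sub>0 'k) = 0"
      by (simp_all add: minval_def)
    have p: "minval ?p u + minval ?p v = 0"
      using minval_mult[of ?p u v] u0 v0 one by (simp flip: v)
    have q: "minval ?q u + minval ?q v = 0"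
      using minval_mult[of ?q u v] u0 v0 one by (simp flip: v)
    obtain k where k: "k \<in> keys v" using v0 keys_eq_empty by fastforce
    show ?thesis
      using p q minval_le[OF mn(1), of ?p] minval_le[OF mn(1), of ?q] minval_le[OF mn(2), of ?p]
        minval_le[OF mn(2), of ?q] minval_le[OF k, of ?p] minval_le[OF k, of ?q]
      by linarith
  qed
  obtain m where m: "m \<in> keys u" using u0 keys_eq_empty by fastforce
  have "lookup u n = lookup (Poly_Mapping.single m (lookup u m)) n" for n
  proof (cases "n = m")
    case False
    then have "n \<notin> keys u" using eq[OF _ m] by (auto simp: vec_eq_iff)
    then show ?thesis using False by (simp add: in_keys_iff lookup_single)
  qed simp
  then have "u = Poly_Mapping.single m (lookup u m)" by (rule poly_mapping_eqI)
  then show ?thesis using m by (intro that[of "lookup u m" m]) (simp_all add: in_keys_iff)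
qed

lemma monomial_nonzero [simp]: "monomial w \<noteq> (0 :: 'a \<Rightarrow>\<^sub>0 'b::zero_neq_one)"
proof
  assume "monomial w = (0 :: 'a \<Rightarrow>\<^sub>0 'b)"
  from arg_cong[OF this, of "\<lambda>f. lookup f w"] show False by simp
qed

lemma laurent_mult_nonzero:
  fixes a b :: "int ^ 3 \<Rightarrow>\<^sub>0 'k::field"
  shows "a \<noteq> 0 \<Longrightarrow> b \<noteq> 0 \<Longrightarrow> a * b \<noteq> 0"
  using laurent_no_zero_divisors[of a b] by blast

lemma dvd_mult_monomial_iff:
  fixes a f :: "int ^ 3 \<Rightarrow>\<^sub>0 'k::field"
  shows "f dvd a * monomial w \<longleftrightarrow> f dvd a"
proof
  have "(monomial w :: int ^ 3 \<Rightarrow>\<^sub>0 'k) dvd 1" by (rule monomial_unit) simp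
  then show "f dvd a * monomial w \<Longrightarrow> f dvd a" by (rule dvd_mult_unit_cancel[rotated])
qed (rule dvd_mult2)

lemma laurent_cancel:
  fixes a b c :: "int ^ 3 \<Rightarrow>\<^sub>0 'k::field"
  assumes "c \<noteq> 0" "c * a = c * b"
  shows "a = b"
proof -
  have "c * (a - b) = 0" using assms(2) by (simp add: algebra_simps)
  then have "a - b = 0" using laurent_no_zero_divisors[of c "a - b"] assms(1) by blast
  then show ?thesis by simp
qed

lemma prime_elem_nonzero: "prime_elem p \<Longrightarrow> p \<noteq> 0"
  and prime_elem_nonunit: "prime_elem p \<Longrightarrow> \<not> p dvd 1"
  by (simp_all add: prime_elem_def)

lemma prime_elem_dvd_multE: "prime_elem p \<Longrightarrow> p dvd a * b \<Longrightarrow> p dvd a \<or> p dvd b"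
  unfolding prime_elem_def by blast

lemma laurent_prime_dvd_prime:
  fixes f g :: "int ^ 3 \<Rightarrow>\<^sub>0 'k::field"
  assumes f: "prime_elem f" and g: "prime_elem g" and "f dvd g"
  obtains c where "c dvd 1" "g = f * c"
proof -
  obtain c where c: "g = f * c" using assms(3) by (elim dvdE)
  have "g dvd f * c" by (simp add: c)
  then have "g dvd f \<or> g dvd c" by (rule prime_elem_dvd_multE[OF g])
  then show ?thesis
  proof
    assume "g dvd f"
    then obtain e where e: "f = g * e" by (elim dvdE)
    have "f * (c * e) = f * 1"
      unfolding mult.assoc[symmetric] c[symmetric] e[symmetric] by (rule mult_1_right[symmetric])
    then have "c * e = 1" by (rule laurent_cancel[OF prime_elem_nonzero[OF f]])
    then have "c dvd 1" by (rule dvdI[OF sym])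
    then show ?thesis using c by (rule that)
  next
    assume "g dvd c"
    then obtain d where d: "c = g * d" by (elim dvdE)
    have "g * (f * d) = f * (g * d)" by (simp only: ac_simps)
    then have "g * (f * d) = g * 1" unfolding d[symmetric] c[symmetric] by (simp only: mult_1_right)
    then have "f * d = 1" by (rule laurent_cancel[OF prime_elem_nonzero[OF g]])
    then have "f dvd 1" by (rule dvdI[OF sym])
    then show ?thesis using prime_elem_nonunit[OF f] by simp
  qed
qed

lemma laurent_prime_power_split:
  fixes f b :: "int ^ 3 \<Rightarrow>\<^sub>0 'k::field"
  assumes f: "prime_elem f" and b: "b \<noteq> 0"
  obtains n a where "b = f ^ n * a" "\<not> f dvd a"
proof -
  have nu: "\<not> f dvd 1" by (rule prime_elem_nonunit[OF f])
  have "\<exists>n a. prod_mset F = f ^ n * a \<and> \<not> f dvd a" if "\<forall>g\<in>#F. prime_elem g" for F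
    using that
  proof (induction F)
    case empty
    then show ?case using nu by (intro exI[of _ 0] exI[of _ 1]) simp
  next
    case (add g F)
    have "\<forall>g\<in>#F. prime_elem g" and g: "prime_elem g" using add.prems by simp_all
    from add.IH[OF this(1)] obtain n a where na: "prod_mset F = f ^ n * a" "\<not> f dvd a" by (elim exE conjE)
    show ?case
    proof (cases "f dvd g")
      case True
      obtain c where c: "c dvd 1" "g = f * c" using laurent_prime_dvd_prime[OF f g True] .
      have "\<not> f dvd a * c" using na(2) dvd_mult_unit_cancel[OF _ c(1)] by blast
      moreover have "prod_mset (add_mset g F) = f ^ Suc n * (a * c)"
        by (simp add: na(1) c(2) ac_simps)
      ultimately show ?thesis by (intro exI conjI)
    next
      case False
      then have "\<not> f dvd g * a" using prime_elem_dvd_multE[OF f, of g a] na(2) by blast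
      moreover have "prod_mset (add_mset g F) = f ^ n * (g * a)" by (simp add: na(1) ac_simps)
      ultimately show ?thesis by (intro exI conjI)
    qed
  qed
  note * = this
  obtain u F where uF: "u dvd 1" "\<forall>g\<in>#F. prime_elem g" "b = u * prod_mset F"
    using laurent_prime_factorization[OF b] by (elim exE conjE)
  from *[OF uF(2)] obtain n a where na: "prod_mset F = f ^ n * a" "\<not> f dvd a" by (elim exE conjE)
  have "\<not> f dvd a * u" using na(2) dvd_mult_unit_cancel[OF _ uF(1)] by blast
  moreover have "b = f ^ n * (a * u)" unfolding uF(3) na(1) by (simp only: ac_simps)
  ultimately show ?thesis by (intro that)
qed

lemma monomial_pow: "(monomial m :: int ^ 3 \<Rightarrow>\<^sub>0 'k::field) ^ n = monomial (int n *s m)"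
proof (induction n)
  case 0
  have "int 0 *s m = 0" by (simp add: vec_eq_iff)
  then show ?case by (simp only: power_0 single_one)
next
  case (Suc n)
  have "m + int n *s m = int (Suc n) *s m" by (simp add: vec_eq_iff algebra_simps)
  then show ?case by (simp only: power_Suc Suc.IH mult_single mult_1_left)
qed

section \<open>The prime divisors of the toric variety\<close>

text \<open>
  The columns of \<open>M\<close> are the minimal generators, so the coordinates of \<open>m v* M\<close> are the pairings of
  \<open>m\<close> with them.
\<close>

locale simplicial_toric =
  fixes M :: "int ^ 3 ^ 3" and C :: "(int ^ 3 \<Rightarrow>\<^sub>0 'k::field) set"
  assumes det_nonzero: "det M \<noteq> 0"
    and primitive: "primitive_vector (column i M)"
    and C_eq: "C = {f. keys f \<subseteq> {m. \<forall>i. 0 \<le> (m v* M) $ i}}"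
begin

definition S :: "(int ^ 3) set" where "S = {m. \<forall>i. 0 \<le> (m v* M) $ i}"

lemma C_iff: "f \<in> C \<longleftrightarrow> keys f \<subseteq> S"
  by (simp add: C_eq S_def)

lemma S_iff: "m \<in> S \<longleftrightarrow> (\<forall>i. 0 \<le> (m v* M) $ i)"
  by (simp add: S_def)

lemma ell_add: "(m + n) v* M = m v* M + n v* M"
  and ell_diff: "(m - n) v* M = m v* M - n v* M"
  and ell_scale: "(c *s m) v* M = c *s (m v* M)"
  and ell_zero: "0 v* M = 0"
  by (simp_all add: vector_matrix_mult_def vec_eq_iff sum_3 algebra_simps)

lemma S_add: "m \<in> S \<Longrightarrow> n \<in> S \<Longrightarrow> m + n \<in> S"
  by (simp add: S_iff ell_add)

lemma S_zero: "0 \<in> S"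
  by (simp add: S_iff ell_zero)

lemma S_scale: "m \<in> S \<Longrightarrow> 0 \<le> c \<Longrightarrow> c *s m \<in> S"
  by (simp add: S_iff ell_scale)

lemma ell_det_multiple: "\<exists>w. w v* M = \<bar>det M\<bar> *s e"
proof -
  \<comment> \<open>The row vector \<open>e\<close> times the adjugate of \<open>M\<close>.\<close>
  define w :: "int ^ 3" where "w = vector [
     e$1 * (M$2$2 * M$3$3 - M$3$2 * M$2$3) - e$2 * (M$2$1 * M$3$3 - M$3$1 * M$2$3) + e$3 * (M$2$1 * M$3$2 - M$3$1 * M$2$2),
     - e$1 * (M$1$2 * M$3$3 - M$3$2 * M$1$3) + e$2 * (M$1$1 * M$3$3 - M$3$1 * M$1$3) - e$3 * (M$1$1 * M$3$2 - M$3$1 * M$1$2),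
     e$1 * (M$1$2 * M$2$3 - M$2$2 * M$1$3) - e$2 * (M$1$1 * M$2$3 - M$2$1 * M$1$3) + e$3 * (M$1$1 * M$2$2 - M$2$1 * M$1$2)]"
  have "w v* M = det M *s e"
    by (simp add: w_def vector_matrix_mult_def vec_eq_iff forall_3 sum_3 vector_3 det_3 algebra_simps)
  then have "(sgn (det M) *s w) v* M = \<bar>det M\<bar> *s e"
    by (simp add: ell_scale vec_eq_iff abs_sgn mult.commute mult.left_commute)
  then show ?thesis by (rule exI)
qed

text \<open>
  Provides the monomials that clear denominators at some of the rays and are units at the others.
\<close>

lemma ell_large:
  assumes "\<And>j. 0 \<le> e $ j"
  obtains w where "w \<in> S" "\<forall>j. e $ j \<le> (w v* M) $ j" "\<forall>j. e $ j = 0 \<longrightarrow> (w v* M) $ j = 0"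
proof -
  obtain w where w: "w v* M = \<bar>det M\<bar> *s e" using ell_det_multiple ..
  have wj: "(w v* M) $ j = \<bar>det M\<bar> * e $ j" for j by (simp add: w)
  have "1 \<le> \<bar>det M\<bar>" using det_nonzero by simp
  then have le: "e $ j \<le> (w v* M) $ j" for j
    unfolding wj using mult_right_mono[of 1 "\<bar>det M\<bar>" "e $ j"] assms by simp
  show ?thesis
  proof (rule that)
    show "w \<in> S" unfolding S_iff using le assms order_trans by blast
    show "\<forall>j. e $ j \<le> (w v* M) $ j" using le ..
    show "\<forall>j. e $ j = 0 \<longrightarrow> (w v* M) $ j = 0" by (simp add: wj)
  qed
qed

text \<open>
  Bezout coefficients of a primitive vector give an exponent with pairing \<open>1\<close>. It is moved into the
  dual cone by adding an exponent that has pairing \<open>0\<close> with the generator in question and large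
  pairings with the others.
\<close>

lemma ell_one: obtains m where "m \<in> S" "(m v* M) $ i = 1"
proof -
  let ?v = "column i M"
  have "range (\<lambda>r. ?v $ r) = {?v $ 1, ?v $ 2, ?v $ 3}"
    unfolding UNIV_3 by simp
  then have g: "gcd (?v $ 1) (gcd (?v $ 2) (?v $ 3)) = 1"
    using primitive[of i] unfolding primitive_vector_def by simp
  obtain y z where yz: "y * ?v $ 2 + z * ?v $ 3 = gcd (?v $ 2) (?v $ 3)" using bezout_int by blast
  obtain a b where ab: "a * ?v $ 1 + b * gcd (?v $ 2) (?v $ 3) = 1" using bezout_int g by metis
  define n :: "int ^ 3" where "n = vector [a, b * y, b * z]"
  have "(n v* M) $ i = a * ?v $ 1 + b * (y * ?v $ 2 + z * ?v $ 3)"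
    by (simp add: n_def vector_matrix_mult_def sum_3 vector_3 column_def algebra_simps)
  then have n: "(n v* M) $ i = 1" using yz ab by simp
  define e :: "int ^ 3" where "e = (\<chi> j. if j = i then 0 else \<bar>(n v* M) $ j\<bar>)"
  have e0: "0 \<le> e $ j" for j by (simp add: e_def)
  obtain w where w: "w \<in> S" "\<forall>j. e $ j \<le> (w v* M) $ j" "\<forall>j. e $ j = 0 \<longrightarrow> (w v* M) $ j = 0"
    using ell_large[OF e0] .
  have wi: "(w v* M) $ i = 0" by (rule w(3)[rule_format]) (simp add: e_def)
  have "0 \<le> ((n + w) v* M) $ j" for j
  proof (cases "j = i")
    case True
    then show ?thesis using n wi by (simp add: ell_add)
  next
    case False
    then show ?thesis using w(2)[rule_format, of j] by (simp add: ell_add e_def)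
  qed
  then have "n + w \<in> S" by (simp add: S_iff)
  moreover have "((n + w) v* M) $ i = 1" using n wi by (simp add: ell_add)
  ultimately show ?thesis by (rule that)
qed

sublocale subdomain C
proof
  show "0 \<in> C" by (simp add: C_iff)
  show "1 \<in> C" by (simp add: C_iff S_zero)
  show "a + b \<in> C" if "a \<in> C" "b \<in> C" for a b
    using that keys_add[of a b] unfolding C_iff by blast
  show "- a \<in> C" if "a \<in> C" for a using that by (simp add: C_iff)
  show "a * b \<in> C" if "a \<in> C" "b \<in> C" for a b
    unfolding C_iff
  proof
    fix m assume "m \<in> keys (a * b)"
    then obtain x y where "x \<in> keys a" "y \<in> keys b" "m = x + y" by (rule keys_multE)
    then show "m \<in> S" using that by (auto simp: C_iff intro!: S_add)
  qed
  show "a = 0 \<or> b = 0" if "a * b = 0" for a b :: "int ^ 3 \<Rightarrow>\<^sub>0 'k"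
    using that by (rule laurent_no_zero_divisors)
qed

lemma monomial_in_C: "w \<in> S \<Longrightarrow> monomial w \<in> C"
  by (simp add: C_iff)

lemma clear_denominators:
  fixes f :: "int ^ 3 \<Rightarrow>\<^sub>0 'k"
  obtains w where "w \<in> S" "f * monomial w \<in> C"
proof -
  define N where "N = (\<Sum>m\<in>keys f. \<Sum>j\<in>UNIV. \<bar>(m v* M) $ j\<bar>)"
  have N: "\<bar>(m v* M) $ j\<bar> \<le> N" if "m \<in> keys f" for m j
  proof -
    have "\<bar>(m v* M) $ j\<bar> \<le> (\<Sum>j\<in>UNIV. \<bar>(m v* M) $ j\<bar>)" by (rule member_le_sum) auto
    also have "\<dots> \<le> N" unfolding N_def by (rule member_le_sum) (use that in \<open>auto intro: sum_nonneg\<close>)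
    finally show ?thesis .
  qed
  have N0: "0 \<le> N" unfolding N_def by (intro sum_nonneg) auto
  have N0': "0 \<le> (\<chi> j. N) $ j" for j :: 3 using N0 by simp
  obtain w where w0: "w \<in> S" "\<forall>j. (\<chi> j. N) $ j \<le> (w v* M) $ j"
    using ell_large[OF N0'] .
  then have w: "w \<in> S" "N \<le> (w v* M) $ j" for j by simp_all
  have "m + w \<in> S" if "m \<in> keys f" for m
    unfolding S_iff
  proof
    fix j
    show "0 \<le> ((m + w) v* M) $ j" using N[OF that, of j] w(2)[of j] by (simp add: ell_add)
  qed
  then have "f * monomial w \<in> C" unfolding C_iff keys_mult_monomial by blast
  then show ?thesis using w(1) that by blast
qed

definition val :: "3 \<Rightarrow> (int ^ 3 \<Rightarrow>\<^sub>0 'k) \<Rightarrow> int" where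
  "val i = minval (\<lambda>m. (m v* M) $ i)"

lemma val_mult: "f \<noteq> 0 \<Longrightarrow> g \<noteq> 0 \<Longrightarrow> val i (f * g) = val i f + val i g"
  unfolding val_def by (rule minval_mult) (simp_all add: ell_add)

lemma val_single: "c \<noteq> 0 \<Longrightarrow> val i (Poly_Mapping.single m c) = (m v* M) $ i"
  by (simp add: val_def minval_def)

lemma val_le: "m \<in> keys f \<Longrightarrow> val i f \<le> (m v* M) $ i"
  unfolding val_def by (rule minval_le)

lemma val_attained:
  assumes "f \<noteq> 0"
  obtains m where "m \<in> keys f" "(m v* M) $ i = val i f"
  using minval_attained[OF assms] unfolding val_def .

lemma C_iff_val: "f \<noteq> 0 \<Longrightarrow> f \<in> C \<longleftrightarrow> (\<forall>i. 0 \<le> val i f)"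
proof
  assume "f \<noteq> 0" "f \<in> C"
  show "\<forall>i. 0 \<le> val i f"
  proof
    fix i
    obtain m where "m \<in> keys f" "(m v* M) $ i = val i f" using val_attained[OF \<open>f \<noteq> 0\<close>] .
    moreover have "m \<in> S" using \<open>f \<in> C\<close> \<open>m \<in> keys f\<close> unfolding C_iff by blast
    ultimately show "0 \<le> val i f" unfolding S_iff by metis
  qed
next
  assume "f \<noteq> 0" and *: "\<forall>i. 0 \<le> val i f"
  have "m \<in> S" if "m \<in> keys f" for m
    unfolding S_iff using * order_trans[OF _ val_le[OF that]] by simp
  then show "f \<in> C" unfolding C_iff by (rule subsetI)
qed

text \<open>
  The prime of the boundary divisor that belongs to the \<open>i\<close>-th ray.
\<close>

definition P :: "3 \<Rightarrow> (int ^ 3 \<Rightarrow>\<^sub>0 'k) set" where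
  "P i = {f \<in> C. f \<noteq> 0 \<longrightarrow> 0 < val i f}"

lemma P_iff_keys: "f \<in> P i \<longleftrightarrow> f \<in> C \<and> (\<forall>m\<in>keys f. 0 < (m v* M) $ i)"
proof (cases "f = 0")
  case False
  obtain n where n: "n \<in> keys f" "(n v* M) $ i = val i f" using val_attained[OF False] .
  have "0 < val i f \<longleftrightarrow> (\<forall>m\<in>keys f. 0 < (m v* M) $ i)"
  proof
    assume "0 < val i f"
    then show "\<forall>m\<in>keys f. 0 < (m v* M) $ i" using val_le[of _ f i] by force
  next
    assume "\<forall>m\<in>keys f. 0 < (m v* M) $ i"
    then show "0 < val i f" using n by force
  qed
  then show ?thesis using False by (simp add: P_def)
qed (simp add: P_def)

lemma P_prime: "primeideal (P i) R"
proof (rule primeideal_RI)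
  show "P i \<subseteq> C" by (auto simp: P_def)
  show "0 \<in> P i" by (simp add: P_def zero_closed)
  show "1 \<notin> P i" by (simp add: P_iff_keys ell_zero)
  show "a + b \<in> P i" if "a \<in> P i" "b \<in> P i" for a b
    using that keys_add[of a b] add_closed[of a b] unfolding P_iff_keys by blast
  show "c * a \<in> P i" if "c \<in> C" "a \<in> P i" for c a
  proof (cases "c = 0 \<or> a = 0")
    case True
    then show ?thesis by (auto simp: P_def zero_closed)
  next
    case False
    then have "0 \<le> val i c" "0 < val i a" using that C_iff_val[of c] by (simp_all add: P_def)
    then show ?thesis using that False by (simp add: P_def val_mult mult_closed)
  qed
  show "a \<in> P i \<or> b \<in> P i" if ab: "a \<in> C" "b \<in> C" "a * b \<in> P i" for a b
  proof (cases "a = 0 \<or> b = 0")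
    case True
    then show ?thesis by (auto simp: P_def zero_closed)
  next
    case False
    then have "a * b \<noteq> 0" using laurent_no_zero_divisors[of a b] by blast
    then have "0 < val i a + val i b" using ab(3) False by (simp add: P_def val_mult)
    then have "0 < val i a \<or> 0 < val i b" by linarith
    then show ?thesis using ab by (auto simp: P_def)
  qed
qed

text \<open>
  Dividing \<open>b\<close> by a power of the monomial of \<open>m\<close> lowers its order along the \<open>i\<close>-th ray to \<open>0\<close>. A
  monomial outside \<open>P i\<close> then makes the orders along the other rays nonnegative.
\<close>

lemma P_uniformizer:
  assumes m: "m \<in> S" "(m v* M) $ i = 1"
  shows "uniformizer (P i) (monomial m)"
    and "b \<in> C \<Longrightarrow> b \<noteq> 0 \<Longrightarrow> \<exists>s\<in>C - P i. \<exists>s'\<in>C - P i. s * b = s' * monomial m ^ nat (val i b)"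
proof -
  show *: "\<exists>s\<in>C - P i. \<exists>s'\<in>C - P i. s * b = s' * monomial m ^ nat (val i b)" if b: "b \<in> C" "b \<noteq> 0" for b
  proof -
    define n where "n = val i b"
    have n0: "0 \<le> n" unfolding n_def using C_iff_val[OF b(2)] b(1) by simp
    \<comment> \<open>The \<open>i\<close>-th entry is \<open>0\<close> to keep the monomial of \<open>w\<close> outside \<open>P i\<close>.\<close>
    define e :: "int ^ 3" where "e = (\<chi> j. if j = i then 0 else n * (m v* M) $ j)"
    have e0: "0 \<le> e $ j" for j using m(1) n0 by (simp add: e_def S_iff)
    obtain w where w: "w \<in> S" "\<forall>j. e $ j \<le> (w v* M) $ j" "\<forall>j. e $ j = 0 \<longrightarrow> (w v* M) $ j = 0"
      using ell_large[OF e0] .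
    have wi: "(w v* M) $ i = 0" by (rule w(3)[rule_format]) (simp add: e_def)
    have n_nat: "int (nat n) = n" using n0 by simp
    define s' where "s' = b * monomial (w - n *s m)"
    have s'0: "s' \<noteq> 0"
      unfolding s'_def using b(2) by (intro laurent_mult_nonzero monomial_nonzero)
    have val_s': "val j s' = val j b + (w v* M) $ j - n * (m v* M) $ j" for j
      unfolding s'_def using b(2) by (simp add: val_mult val_single ell_diff ell_scale)
    have "0 \<le> val j s'" for j
    proof (cases "j = i")
      case True
      then show ?thesis unfolding val_s' using wi m(2) by (simp add: n_def)
    next
      case False
      then show ?thesis unfolding val_s' using w(2)[rule_format, of j] C_iff_val[OF b(2)] b(1) by (simp add: e_def add_increasing)
    qed
    then have "s' \<in> C" using C_iff_val[OF s'0] by blast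
    moreover have "val i s' = 0" unfolding val_s' using wi m(2) by (simp add: n_def)
    ultimately have s': "s' \<in> C - P i" using s'0 by (simp add: P_def)
    have s: "monomial w \<in> C - P i" using w(1) wi by (simp add: P_iff_keys monomial_in_C)
    have "s' * monomial m ^ nat n = b * (monomial (w - n *s m) * monomial (n *s m))"
      unfolding monomial_pow n_nat s'_def by (simp only: mult.assoc)
    also have "\<dots> = monomial w * b" by (simp add: mult_single mult.commute)
    finally show ?thesis unfolding n_def[symmetric] using s s' by (intro bexI[of _ "monomial w"] bexI[of _ s']) simp_all
  qed
  show "uniformizer (P i) (monomial m)"
    unfolding uniformizer_def
  proof (intro conjI ballI)
    show "monomial m \<in> P i" using m by (simp add: P_iff_keys monomial_in_C)
    show "monomial m \<noteq> (0 :: int ^ 3 \<Rightarrow>\<^sub>0 'k)" by simp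
    fix b assume "b \<in> C - {0}"
    then have "b \<in> C" "b \<noteq> 0" by simp_all
    then show "\<exists>n. \<exists>s\<in>C - P i. \<exists>s'\<in>C - P i. s * b = s' * monomial m ^ n"
      by (intro exI[of _ "nat (val i b)"] *)
  qed
qed

lemma P_has_uniformizer: "\<exists>t. uniformizer (P i) t"
proof -
  obtain m where "m \<in> S" "(m v* M) $ i = 1" using ell_one .
  then show ?thesis using P_uniformizer(1) by blast
qed

lemma ord_P:
  assumes "b \<in> C" "b \<noteq> 0"
  shows "int (ord_at R (P i) b) = val i b"
proof -
  obtain m where m: "m \<in> S" "(m v* M) $ i = 1" using ell_one .
  obtain s s' where "s \<in> C - P i" "s' \<in> C - P i" "s * b = s' * monomial m ^ nat (val i b)"
    using P_uniformizer(2)[OF m assms] by (elim bexE)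
  then have "ord_at R (P i) b = nat (val i b)"
    by (rule ord_at_eq[OF P_prime P_uniformizer(1)[OF m] assms(1)])
  then show ?thesis using C_iff_val[OF assms(2)] assms(1) by simp
qed

lemma P_inj: "P i = P j \<Longrightarrow> i = j"
proof (rule ccontr)
  assume eq: "P i = P j" and ne: "i \<noteq> j"
  define e :: "int ^ 3" where "e = (\<chi> k. if k = i then 0 else 1)"
  have e0: "0 \<le> e $ k" for k by (simp add: e_def)
  obtain w where w: "w \<in> S" "\<forall>k. e $ k \<le> (w v* M) $ k" "\<forall>k. e $ k = 0 \<longrightarrow> (w v* M) $ k = 0"
    using ell_large[OF e0] .
  have "(w v* M) $ i = 0" by (rule w(3)[rule_format]) (simp add: e_def)
  then have "monomial w \<notin> P i" by (simp add: P_iff_keys)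
  moreover have "0 < (w v* M) $ j" using w(2)[rule_format, of j] ne by (simp add: e_def)
  then have "monomial w \<in> P j" using w(1) by (simp add: P_iff_keys monomial_in_C)
  ultimately show False using eq by blast
qed

text \<open>
  For an irreducible \<open>f\<close>, this is the prime of the closure in the toric variety of the zero locus of
  \<open>f\<close> in the torus.
\<close>

definition Q :: "(int ^ 3 \<Rightarrow>\<^sub>0 'k) \<Rightarrow> (int ^ 3 \<Rightarrow>\<^sub>0 'k) set" where
  "Q f = {b \<in> C. f dvd b}"

lemma monomial_dvd_1: "(monomial w :: int ^ 3 \<Rightarrow>\<^sub>0 'k) dvd 1"
  by (rule monomial_unit) simp

lemma unit_notin_Q:
  assumes "prime_elem f" "u dvd 1"
  shows "u \<notin> Q f"
proof
  assume "u \<in> Q f"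
  then have "f dvd u" by (simp add: Q_def)
  then have "f dvd 1" using assms(2) by (rule dvd_trans)
  then show False using prime_elem_nonunit[OF assms(1)] by simp
qed

lemma Q_prime:
  assumes f: "prime_elem f"
  shows "primeideal (Q f) R"
proof (rule primeideal_RI)
  show "Q f \<subseteq> C" by (auto simp: Q_def)
  show "0 \<in> Q f" by (simp add: Q_def zero_closed)
  show "1 \<notin> Q f" by (rule unit_notin_Q[OF f]) simp
  show "a + b \<in> Q f" if "a \<in> Q f" "b \<in> Q f" for a b
    using that by (simp add: Q_def add_closed dvd_add)
  show "c * a \<in> Q f" if "c \<in> C" "a \<in> Q f" for c a
    using that by (simp add: Q_def mult_closed)
  show "a \<in> Q f \<or> b \<in> Q f" if "a \<in> C" "b \<in> C" "a * b \<in> Q f" for a b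
    using that prime_elem_dvd_multE[OF f, of a b] by (auto simp: Q_def)
qed

text \<open>
  Monomials lie outside \<open>Q f\<close>, so the exponent in question is the multiplicity of \<open>f\<close> as a factor of
  \<open>b\<close> in the Laurent polynomial ring.
\<close>

lemma Q_uniformizer:
  assumes f: "prime_elem f" and w: "w \<in> S" "f * monomial w \<in> C"
  shows "uniformizer (Q f) (f * monomial w)"
  unfolding uniformizer_def
proof (intro conjI ballI)
  show "f * monomial w \<in> Q f" using w by (simp add: Q_def)
  show "f * monomial w \<noteq> 0"
    by (intro laurent_mult_nonzero monomial_nonzero prime_elem_nonzero[OF f])
  fix b assume "b \<in> C - {0}"
  then have b: "b \<in> C" "b \<noteq> 0" by simp_all
  obtain n a where na: "b = f ^ n * a" "\<not> f dvd a" using laurent_prime_power_split[OF f b(2)] .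
  obtain w' where w': "w' \<in> S" "a * monomial w' \<in> C" using clear_denominators .
  let ?s = "monomial (int n *s w + w') :: int ^ 3 \<Rightarrow>\<^sub>0 'k"
  have "?s \<in> C" by (intro monomial_in_C S_add S_scale w w') simp
  then have s: "?s \<in> C - Q f" using unit_notin_Q[OF f monomial_dvd_1] by blast
  have "\<not> f dvd a * monomial w'"
    unfolding dvd_mult_monomial_iff by (rule na(2))
  then have s': "a * monomial w' \<in> C - Q f" using w'(2) by (simp add: Q_def)
  have "?s * b = (monomial (int n *s w) * monomial w') * (f ^ n * a)"
    unfolding na(1) by (simp add: mult_single)
  also have "\<dots> = (a * monomial w') * (f ^ n * monomial (int n *s w))" by (simp only: ac_simps)
  also have "\<dots> = (a * monomial w') * (f * monomial w) ^ n"
    unfolding power_mult_distrib monomial_pow ..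
  finally show "\<exists>m. \<exists>s\<in>C - Q f. \<exists>s'\<in>C - Q f. s * b = s' * (f * monomial w) ^ m"
    by (intro exI bexI[OF _ s] bexI[OF _ s'])
qed

lemma Q_has_uniformizer: "prime_elem f \<Longrightarrow> \<exists>t. uniformizer (Q f) t"
  using clear_denominators Q_uniformizer by blast

text \<open>
  Otherwise some \<open>b\<close> outside \<open>p\<close> lies in all \<open>P i\<close>. All exponents of \<open>b\<close> have positive pairings, so a
  high power of \<open>b\<close> is a multiple of the monomial of \<open>w\<close> and lies in \<open>p\<close>.
\<close>

lemma prime_above_monomial:
  assumes p: "primeideal p R" and w: "w \<in> S" "monomial w \<in> p"
  shows "\<exists>i. P i \<subseteq> p"
proof (rule ccontr)
  assume "\<not> (\<exists>i. P i \<subseteq> p)"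
  then have "\<exists>a. a \<in> P i \<and> a \<notin> p" for i by blast
  then obtain a where a: "\<And>i. a i \<in> P i" "\<And>i. a i \<notin> p" by metis
  have aC: "a i \<in> C" for i using a(1)[of i] by (simp add: P_def)
  define b where "b = a 1 * a 2 * a 3"
  have bC: "b \<in> C" unfolding b_def by (intro mult_closed aC)
  have "a 1 * a 2 \<in> C - p" by (rule compl_prime_mult[OF p]) (simp_all add: a(2) aC)
  then have "b \<in> C - p" unfolding b_def by (rule compl_prime_mult[OF p]) (simp add: a(2) aC)
  then have bp: "b \<notin> p" by simp
  then have b0: "b \<noteq> 0" using primeidealD(2)[OF p] by auto
  have bP: "b \<in> P i" for i
  proof -
    note m = primeidealD(5)[OF P_prime]
    consider "i = 1" | "i = 2" | "i = 3" using exhaust_3 by blast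
    then show ?thesis
    proof cases
      case 1
      have "(a 2 * a 3) * a 1 \<in> P 1" by (intro m mult_closed aC a(1))
      then show ?thesis unfolding 1 b_def by (simp only: ac_simps)
    next
      case 2
      have "(a 1 * a 3) * a 2 \<in> P 2" by (intro m mult_closed aC a(1))
      then show ?thesis unfolding 2 b_def by (simp only: ac_simps)
    next
      case 3
      show ?thesis unfolding 3 b_def by (intro m mult_closed aC a(1))
    qed
  qed
  have valb: "1 \<le> val i b" for i using bP[of i] b0 by (simp add: P_def)
  \<comment> \<open>All pairings of \<open>w\<close> are at most \<open>N\<close>, while those of the exponents in the \<open>N\<close>-th power of \<open>b\<close> are at least \<open>N\<close>.\<close>
  define N where "N = nat (\<Sum>i\<in>UNIV. (w v* M) $ i)"
  have pow0: "b ^ n \<noteq> 0" for n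
    by (induction n) (simp_all add: laurent_mult_nonzero b0)
  have valpow: "val i (b ^ n) = int n * val i b" for i n
  proof (induction n)
    case 0
    show ?case by (simp add: val_single ell_zero flip: single_one)
  next
    case (Suc n)
    then show ?case using b0 pow0[of n] by (simp add: val_mult algebra_simps)
  qed
  define c where "c = b ^ N * monomial (- w)"
  have c0: "c \<noteq> 0"
    unfolding c_def by (intro laurent_mult_nonzero monomial_nonzero pow0)
  have "0 \<le> val i c" for i
  proof -
    have "(w v* M) $ i \<le> (\<Sum>i\<in>UNIV. (w v* M) $ i)"
      by (rule member_le_sum) (use w(1) in \<open>auto simp: S_iff\<close>)
    then have "(w v* M) $ i \<le> int N" unfolding N_def by simp
    also have "\<dots> \<le> int N * val i b" using valb[of i] mult_left_mono[of 1 "val i b" "int N"] by simp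
    finally have le: "(w v* M) $ i \<le> int N * val i b" .
    have "- w v* M = - (w v* M)" using ell_diff[of 0 w] by (simp add: ell_zero)
    then have "val i c = int N * val i b - (w v* M) $ i"
      unfolding c_def using pow0[of N] by (simp add: val_mult val_single valpow)
    then show ?thesis using le by simp
  qed
  then have "c \<in> C" using C_iff_val[OF c0] by blast
  then have "c * monomial w \<in> p" using w(2) by (rule primeidealD(5)[OF p])
  moreover have "c * monomial w = b ^ N"
    unfolding c_def mult.assoc by (simp add: mult_single)
  ultimately have bN: "b ^ N \<in> p" by simp
  have "b ^ n \<in> p \<Longrightarrow> b \<in> p" for n
  proof (induction n)
    case 0
    then show ?case using primeidealD(3)[OF p] by simp
  next
    case (Suc n)
    then have "b * b ^ n \<in> p" by simp
    then have "b \<in> p \<or> b ^ n \<in> p" by (rule primeidealD(6)[OF p bC power_closed[OF bC]])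
    then show ?case using Suc.IH by blast
  qed
  then show False using bN bp by blast
qed

text \<open>
  The prime \<open>p\<close> contains a monomial, or one of the factors \<open>f\<close> multiplied by a monomial. In the second
  case, an element of \<open>Q f\<close> becomes a multiple of this product when it is multiplied by a suitable
  monomial; so \<open>p\<close> contains the element or the monomial.
\<close>

lemma prime_above_factor:
  assumes p: "primeideal p R" and F: "\<forall>f\<in>#F. prime_elem f" and u: "u dvd 1" and a: "u * prod_mset F \<in> p"
  shows "(\<exists>w\<in>S. monomial w \<in> p) \<or> (\<exists>f\<in>#F. Q f \<subseteq> p)"
  using F u a
proof (induction F arbitrary: u)
  case empty
  then obtain v where v: "1 = u * v" by (elim dvdE)
  obtain w where w: "w \<in> S" "v * monomial w \<in> C" using clear_denominators .
  have "u \<in> p" using empty.prems(3) by simp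
  with w(2) have "(v * monomial w) * u \<in> p" by (rule primeidealD(5)[OF p])
  moreover have "(v * monomial w) * u = (u * v) * monomial w" by (simp only: ac_simps)
  ultimately have "monomial w \<in> p" by (simp flip: v)
  then show ?case using w(1) by blast
next
  case (add f F)
  obtain w where w: "w \<in> S" "f * monomial w \<in> C" using clear_denominators .
  obtain w' where w': "w' \<in> S" "(u * prod_mset F) * monomial w' \<in> C" using clear_denominators .
  have "(monomial (w + w') :: int ^ 3 \<Rightarrow>\<^sub>0 'k) = monomial w * monomial w'" by (simp add: mult_single)
  then have eq: "monomial (w + w') * (u * prod_mset (add_mset f F)) =
      (f * monomial w) * ((u * prod_mset F) * monomial w')"
    by (simp only: prod_mset.add_mset ac_simps)
  have "monomial (w + w') * (u * prod_mset (add_mset f F)) \<in> p"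
    by (rule primeidealD(5)[OF p monomial_in_C[OF S_add[OF w(1) w'(1)]] add.prems(3)])
  then have "(f * monomial w) * ((u * prod_mset F) * monomial w') \<in> p" unfolding eq .
  then have "f * monomial w \<in> p \<or> (u * prod_mset F) * monomial w' \<in> p"
    by (rule primeidealD(6)[OF p w(2) w'(2)])
  then show ?case
  proof
    assume fp: "f * monomial w \<in> p"
    show ?thesis
    proof (rule disjCI)
      assume "\<not> (\<exists>f\<in>#add_mset f F. Q f \<subseteq> p)"
      then have "\<not> Q f \<subseteq> p" by simp
      then obtain b where b: "b \<in> Q f" "b \<notin> p" by blast
      then have bC: "b \<in> C" by (simp add: Q_def)
      have "f dvd b" using b(1) by (simp add: Q_def)
      then obtain g where g: "b = f * g" by (elim dvdE)
      obtain w2 where w2: "w2 \<in> S" "g * monomial w2 \<in> C" using clear_denominators .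
      have "(monomial (w2 + w) :: int ^ 3 \<Rightarrow>\<^sub>0 'k) = monomial w2 * monomial w" by (simp add: mult_single)
      then have eq: "(g * monomial w2) * (f * monomial w) = b * monomial (w2 + w)"
        unfolding g by (simp only: ac_simps)
      have "(g * monomial w2) * (f * monomial w) \<in> p" by (rule primeidealD(5)[OF p w2(2) fp])
      then have "b * monomial (w2 + w) \<in> p" unfolding eq .
      then have "b \<in> p \<or> monomial (w2 + w) \<in> p"
        by (rule primeidealD(6)[OF p bC monomial_in_C[OF S_add[OF w2(1) w(1)]]])
      then have "monomial (w2 + w) \<in> p" by (rule disjE) (use b(2) in simp_all)
      then show "\<exists>w\<in>S. monomial w \<in> p" using S_add[OF w2(1) w(1)] by (rule bexI)
    qed
  next
    assume "(u * prod_mset F) * monomial w' \<in> p"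
    then have *: "(u * monomial w') * prod_mset F \<in> p" by (simp only: ac_simps)
    have "\<forall>f\<in>#F. prime_elem f" using add.prems(1) by simp
    from add.IH[OF this unit_mult[OF add.prems(2) monomial_dvd_1] *] show ?thesis by auto
  qed
qed

definition codim1 :: "(int ^ 3 \<Rightarrow>\<^sub>0 'k) set set" where
  "codim1 = range P \<union> Q ` {f. prime_elem f}"

theorem codim1_points_R: "codim1_points R = codim1"
proof (rule codim1_points_eq)
  fix p assume "p \<in> codim1"
  then show "primeideal p R \<and> (\<exists>t. uniformizer p t)"
    unfolding codim1_def using P_prime P_has_uniformizer Q_prime Q_has_uniformizer by auto
next
  fix p assume p: "primeideal p R" "p \<noteq> {0}"
  obtain a where a: "a \<in> p" "a \<noteq> 0" using p(2) primeidealD(2)[OF p(1)] by blast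
  obtain u F where uF: "u dvd 1" "\<forall>f\<in>#F. prime_elem f" "a = u * prod_mset F"
    using laurent_prime_factorization[OF a(2)] by (elim exE conjE)
  have "(\<exists>w\<in>S. monomial w \<in> p) \<or> (\<exists>f\<in>#F. Q f \<subseteq> p)"
    using prime_above_factor[OF p(1) uF(2,1)] a(1) uF(3) by simp
  then show "\<exists>q\<in>codim1. q \<subseteq> p"
  proof
    assume "\<exists>w\<in>S. monomial w \<in> p"
    then obtain w where w: "w \<in> S" "monomial w \<in> p" by (elim bexE)
    obtain i where i: "P i \<subseteq> p" using prime_above_monomial[OF p(1) w] by (elim exE)
    have "P i \<in> codim1" unfolding codim1_def by simp
    then show ?thesis using i by (intro bexI)
  next
    assume "\<exists>f\<in>#F. Q f \<subseteq> p"
    then obtain f where f: "f \<in># F" "Q f \<subseteq> p" by (elim bexE)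
    have "Q f \<in> codim1" using f(1) uF(2) unfolding codim1_def by simp
    then show ?thesis using f(2) by (intro bexI)
  qed
qed

end

section \<open>The divisor class group\<close>

lemma lookup_div_of:
  assumes "finite {p \<in> codim1_points A. ord_at A p a \<noteq> 0}"
  shows "lookup (div_of A a) p = (if p \<in> codim1_points A then int (ord_at A p a) else 0)"
proof -
  have "lookup (div_of A a) p =
      (\<Sum>q\<in>{p \<in> codim1_points A. ord_at A p a \<noteq> 0}. if q = p then int (ord_at A p a) else 0)"
    unfolding div_of_def lookup_sum by (rule sum.cong) auto
  also have "\<dots> = (if p \<in> {p \<in> codim1_points A. ord_at A p a \<noteq> 0} then int (ord_at A p a) else 0)"
    using assms by simp
  finally show ?thesis by simp
qed

text \<open>
  The group is written additively and \<open>N\<close> is given by its closure properties, so that the hypotheses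
  can be checked by calculations with divisors.
\<close>

lemma transversal_bij_cosets:
  fixes N :: "('a \<Rightarrow>\<^sub>0 int) set" and E :: "'b \<Rightarrow> 'a \<Rightarrow>\<^sub>0 int"
  assumes zero: "0 \<in> N" and minus: "\<And>x y. x \<in> N \<Longrightarrow> y \<in> N \<Longrightarrow> x - y \<in> N"
    and E: "\<And>r. r \<in> T \<Longrightarrow> keys (E r) \<subseteq> A"
    and ex: "\<And>D. keys D \<subseteq> A \<Longrightarrow> \<exists>r\<in>T. D - E r \<in> N"
    and uniq: "\<And>r r'. r \<in> T \<Longrightarrow> r' \<in> T \<Longrightarrow> E r - E r' \<in> N \<Longrightarrow> r = r'"
  shows "bij_betw (\<lambda>r. N #>\<^bsub>free_Abelian_group A\<^esub> E r) T (carrier (free_Abelian_group A Mod N))"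
proof -
  let ?c = "\<lambda>x. N #>\<^bsub>free_Abelian_group A\<^esub> x"
  have coset: "?c x = {h + x | h. h \<in> N}" for x
    by (auto simp: r_coset_def)
  have self: "x \<in> ?c x" for x unfolding coset using zero by force
  have plus: "x + y \<in> N" if "x \<in> N" "y \<in> N" for x y
    using minus[OF that(1) minus[OF zero that(2)]] by simp
  have eq_iff: "?c x = ?c y \<longleftrightarrow> x - y \<in> N" for x y
  proof
    assume "?c x = ?c y"
    then have "x \<in> ?c y" using self[of x] by simp
    then obtain h where "h \<in> N" "x = h + y" unfolding coset by blast
    then show "x - y \<in> N" by simp
  next
    assume xy: "x - y \<in> N"
    have yx: "y - x \<in> N" using minus[OF zero xy] by simp
    show "?c x = ?c y"
    proof (intro equalityI subsetI)
      fix z assume "z \<in> ?c x"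
      then obtain h where h: "h \<in> N" "z = h + x" unfolding coset by blast
      then have "z = (h + (x - y)) + y" by simp
      then show "z \<in> ?c y" unfolding coset using plus[OF h(1) xy] by blast
    next
      fix z assume "z \<in> ?c y"
      then obtain h where h: "h \<in> N" "z = h + y" unfolding coset by blast
      then have "z = (h + (y - x)) + x" by simp
      then show "z \<in> ?c x" unfolding coset using plus[OF h(1) yx] by blast
    qed
  qed
  have "carrier (free_Abelian_group A Mod N) = ?c ` {D. keys D \<subseteq> A}"
    by (auto simp: FactGroup_def RCOSETS_def)
  also have "\<dots> = (\<lambda>r. ?c (E r)) ` T"
  proof (intro equalityI subsetI)
    fix z assume "z \<in> ?c ` {D. keys D \<subseteq> A}"
    then obtain D where D: "keys D \<subseteq> A" "z = ?c D" by blast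
    obtain r where "r \<in> T" "D - E r \<in> N" using ex[OF D(1)] by (elim bexE)
    then show "z \<in> (\<lambda>r. ?c (E r)) ` T" unfolding D(2) by (intro image_eqI[of _ _ r]) (simp_all add: eq_iff)
  next
    fix z assume "z \<in> (\<lambda>r. ?c (E r)) ` T"
    then obtain r where r: "r \<in> T" "z = ?c (E r)" by (elim imageE)
    then show "z \<in> ?c ` {D. keys D \<subseteq> A}" using E[OF r(1)] by (intro image_eqI[of _ _ "E r"]) simp_all
  qed
  finally have img: "carrier (free_Abelian_group A Mod N) = (\<lambda>r. ?c (E r)) ` T" .
  have "inj_on (\<lambda>r. ?c (E r)) T"
    by (rule inj_onI) (simp add: eq_iff uniq)
  then show ?thesis unfolding img by (rule inj_on_imp_bij_betw)
qed

text \<open>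
  The additive extension of \<open>g\<close> from prime divisors to all divisors.
\<close>

definition weigh :: "('a \<Rightarrow> int ^ 3) \<Rightarrow> ('a \<Rightarrow>\<^sub>0 int) \<Rightarrow> int ^ 3" where
  "weigh g D = (\<Sum>p\<in>keys D. lookup D p *s g p)"

lemma weigh_superset:
  assumes "finite A" "keys D \<subseteq> A"
  shows "weigh g D = (\<Sum>p\<in>A. lookup D p *s g p)"
  unfolding weigh_def by (rule sum.mono_neutral_left[OF assms]) (simp add: in_keys_iff vec_eq_iff)

lemma weigh_frag_of: "weigh g (frag_of p) = g p"
  by (simp add: weigh_def keys_frag_of vec_eq_iff)

lemma weigh_add: "weigh g (D + E) = weigh g D + weigh g E"
proof -
  let ?A = "keys D \<union> keys E"
  have "weigh g (D + E) = (\<Sum>p\<in>?A. lookup (D + E) p *s g p)"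
    by (rule weigh_superset) (simp_all add: keys_add)
  also have "\<dots> = (\<Sum>p\<in>?A. lookup D p *s g p) + (\<Sum>p\<in>?A. lookup E p *s g p)"
    unfolding sum.distrib[symmetric] by (rule sum.cong) (simp_all add: lookup_add vec_eq_iff algebra_simps)
  also have "(\<Sum>p\<in>?A. lookup D p *s g p) = weigh g D"
    by (rule weigh_superset[symmetric]) simp_all
  also have "(\<Sum>p\<in>?A. lookup E p *s g p) = weigh g E"
    by (rule weigh_superset[symmetric]) simp_all
  finally show ?thesis .
qed

lemma weigh_cmul: "weigh g (frag_cmul c D) = c *s weigh g D"
proof -
  have "weigh g (frag_cmul c D) = (\<Sum>p\<in>keys D. lookup (frag_cmul c D) p *s g p)"
    by (rule weigh_superset) (simp_all add: keys_cmul)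
  then show ?thesis by (simp add: weigh_def vec_eq_iff sum_distrib_left mult.assoc)
qed

lemma weigh_diff: "weigh g (D - E) = weigh g D - weigh g E"
  using weigh_add[of g "D - E" E] by simp

lemma weigh_zero: "weigh g 0 = 0"
  by (simp add: weigh_def)

context simplicial_toric
begin

abbreviation ord where "ord \<equiv> ord_at R"
abbreviation Div where "Div \<equiv> div_of R"
abbreviation Prin where "Prin \<equiv> principal_divisors R"

lemma codim1_cases:
  assumes "p \<in> codim1"
  obtains i where "p = P i" | f where "prime_elem f" "p = Q f"
  using assms unfolding codim1_def by auto

lemma codim1_prime: "p \<in> codim1 \<Longrightarrow> primeideal p R"
  using P_prime Q_prime by (elim codim1_cases) simp_all

lemma codim1_uniformizer: "p \<in> codim1 \<Longrightarrow> \<exists>t. uniformizer p t"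
  using P_has_uniformizer Q_has_uniformizer by (elim codim1_cases) simp_all

lemma ord_mult:
  assumes "p \<in> codim1" "a \<in> C" "a \<noteq> 0" "b \<in> C" "b \<noteq> 0"
  shows "ord p (a * b) = ord p a + ord p b"
proof -
  obtain t where "uniformizer p t" using codim1_uniformizer[OF assms(1)] by (elim exE)
  then show ?thesis by (rule ord_at_mult[OF codim1_prime[OF assms(1)] _ assms(2-5)])
qed

lemma ord_eq_0:
  assumes "p \<in> codim1" "a \<in> C" "a \<notin> p"
  shows "ord p a = 0"
proof -
  obtain t where "uniformizer p t" using codim1_uniformizer[OF assms(1)] by (elim exE)
  then show ?thesis by (rule ord_at_eq_0[OF codim1_prime[OF assms(1)]]) (simp add: assms)
qed

lemma Q_dvd_eq:
  assumes f: "prime_elem f" and g: "prime_elem g" and "f dvd g"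
  shows "Q f = Q g"
proof -
  obtain c where c: "c dvd 1" "g = f * c" using laurent_prime_dvd_prime[OF assms] .
  have "f dvd b \<longleftrightarrow> g dvd b" for b
  proof
    assume "f dvd b"
    then obtain e where e: "b = f * e" by (elim dvdE)
    have "g dvd b * c" unfolding e c(2) by (rule dvdI[of _ _ e]) (simp only: ac_simps)
    then show "g dvd b" using c(1) by (rule dvd_mult_unit_cancel)
  next
    assume "g dvd b"
    then show "f dvd b" using assms(3) dvd_trans by blast
  qed
  then show ?thesis by (simp add: Q_def)
qed

lemma prime_dvd_prod_mset:
  assumes f: "prime_elem f" and "f dvd u * prod_mset F" "u dvd 1"
  shows "\<exists>g\<in>#F. f dvd g"
  using assms(2)
proof (induction F)
  case empty
  then have "f dvd u" by simp
  then have "f dvd 1" using assms(3) by (rule dvd_trans)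
  then show ?case using prime_elem_nonunit[OF f] by simp
next
  case (add g F)
  have "u * prod_mset (add_mset g F) = g * (u * prod_mset F)"
    by (simp only: prod_mset.add_mset ac_simps)
  then have "f dvd g * (u * prod_mset F)" using add.prems by simp
  then have "f dvd g \<or> f dvd u * prod_mset F" by (rule prime_elem_dvd_multE[OF f])
  then show ?case
  proof
    assume "f dvd u * prod_mset F"
    from add.IH[OF this] show ?thesis by auto
  qed simp
qed

text \<open>
  A prime at which \<open>a\<close> vanishes belongs to a ray or to one of the finitely many prime factors of \<open>a\<close>.
\<close>

lemma finite_ord_support:
  assumes a: "a \<in> C" "a \<noteq> 0"
  shows "finite {p \<in> codim1_points R. ord p a \<noteq> 0}"
proof -
  obtain u F where uF: "u dvd 1" "\<forall>f\<in>#F. prime_elem f" "a = u * prod_mset F"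
    using laurent_prime_factorization[OF a(2)] by (elim exE conjE)
  have "{p \<in> codim1_points R. ord p a \<noteq> 0} \<subseteq> range P \<union> Q ` set_mset F"
  proof
    fix p assume "p \<in> {p \<in> codim1_points R. ord p a \<noteq> 0}"
    then have p: "p \<in> codim1" "ord p a \<noteq> 0" unfolding codim1_points_R by simp_all
    then have ap: "a \<in> p" using ord_eq_0[OF p(1) a(1)] by (rule_tac ccontr) simp
    show "p \<in> range P \<union> Q ` set_mset F"
      using p(1)
    proof (cases rule: codim1_cases)
      case (1 i)
      then show ?thesis by simp
    next
      case (2 f)
      have "f dvd u * prod_mset F" using ap unfolding 2(2) Q_def uF(3) by simp
      from prime_dvd_prod_mset[OF 2(1) this uF(1)] obtain g where g: "g \<in># F" "f dvd g" by (elim bexE)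
      have "p = Q g" unfolding 2(2) using g uF(2) by (intro Q_dvd_eq[OF 2(1)]) simp_all
      then show ?thesis using g(1) by simp
    qed
  qed
  then show ?thesis by (rule finite_subset) simp
qed

lemma lookup_Div:
  assumes "a \<in> C" "a \<noteq> 0"
  shows "lookup (Div a) p = (if p \<in> codim1 then int (ord p a) else 0)"
  using lookup_div_of[OF finite_ord_support[OF assms]] unfolding codim1_points_R .

lemma Div_mult:
  assumes "a \<in> C" "a \<noteq> 0" "b \<in> C" "b \<noteq> 0"
  shows "Div (a * b) = Div a + Div b"
proof (rule poly_mapping_eqI)
  fix p
  have ab: "a * b \<in> C" "a * b \<noteq> 0"
    using assms by (simp_all add: mult_closed laurent_mult_nonzero)
  show "lookup (Div (a * b)) p = lookup (Div a + Div b) p"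
    using ord_mult[OF _ assms, of p]
    by (simp add: lookup_add lookup_Div[OF ab] lookup_Div[OF assms(1,2)] lookup_Div[OF assms(3,4)])
qed

lemma Prin_iff: "D \<in> Prin \<longleftrightarrow> (\<exists>a b. a \<in> C \<and> a \<noteq> 0 \<and> b \<in> C \<and> b \<noteq> 0 \<and> D = Div a - Div b)"
  unfolding principal_divisors_def R_simps by auto

lemma PrinI: "a \<in> C \<Longrightarrow> a \<noteq> 0 \<Longrightarrow> b \<in> C \<Longrightarrow> b \<noteq> 0 \<Longrightarrow> D = Div a - Div b \<Longrightarrow> D \<in> Prin"
  unfolding Prin_iff by (intro exI conjI)

lemma PrinE:
  assumes "D \<in> Prin"
  obtains a b where "a \<in> C" "a \<noteq> 0" "b \<in> C" "b \<noteq> 0" "D = Div a - Div b"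
  using assms unfolding Prin_iff by (elim exE conjE)

lemma Prin_zero: "0 \<in> Prin"
  by (rule PrinI[of 1 1]) (simp_all add: one_closed)

lemma Prin_diff:
  assumes "D \<in> Prin" "D' \<in> Prin"
  shows "D - D' \<in> Prin"
proof -
  obtain a b where ab: "a \<in> C" "a \<noteq> 0" "b \<in> C" "b \<noteq> 0" "D = Div a - Div b" using assms(1) by (rule PrinE)
  obtain c d where cd: "c \<in> C" "c \<noteq> 0" "d \<in> C" "d \<noteq> 0" "D' = Div c - Div d" using assms(2) by (rule PrinE)
  have "D - D' = Div (a * d) - Div (b * c)"
    using ab cd by (simp add: Div_mult)
  then show ?thesis
    by (rule PrinI[rotated 4]) (simp_all add: mult_closed laurent_mult_nonzero ab(1-4) cd(1-4))
qed

lemma Prin_add: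
  assumes "D \<in> Prin" "D' \<in> Prin"
  shows "D + D' \<in> Prin"
  using Prin_diff[OF assms(1) Prin_diff[OF Prin_zero assms(2)]] by simp

lemma Prin_Div: "a \<in> C \<Longrightarrow> a \<noteq> 0 \<Longrightarrow> Div a \<in> Prin"
proof (rule PrinI[of a 1])
  have "Div (1 * 1) = Div 1 + Div 1" by (rule Div_mult) (simp_all add: one_closed)
  then show "Div a = Div a - Div 1" by simp
qed (simp_all add: one_closed)

text \<open>
  The boundary divisor with multiplicities \<open>n\<close>.
\<close>

definition E :: "int ^ 3 \<Rightarrow> (int ^ 3 \<Rightarrow>\<^sub>0 'k) set \<Rightarrow>\<^sub>0 int" where
  "E n = (\<Sum>i\<in>UNIV. frag_cmul (n $ i) (frag_of (P i)))"

lemma lookup_E_P: "lookup (E n) (P i) = n $ i"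
proof -
  have "lookup (E n) (P i) = (\<Sum>j\<in>UNIV. if j = i then n $ i else 0)"
    unfolding E_def lookup_sum by (rule sum.cong) (auto dest: P_inj)
  then show ?thesis by simp
qed

lemma lookup_E_other: "p \<notin> range P \<Longrightarrow> lookup (E n) p = 0"
  unfolding E_def lookup_sum by (rule sum.neutral) auto

lemma keys_E: "keys (E n) \<subseteq> codim1"
proof
  fix p assume "p \<in> keys (E n)"
  then have "lookup (E n) p \<noteq> 0" by (simp add: in_keys_iff)
  then have "p \<in> range P" using lookup_E_other by metis
  then show "p \<in> codim1" unfolding codim1_def by blast
qed

lemma E_diff: "E (m - n) = E m - E n"
  unfolding E_def sum_subtractf[symmetric] by (rule sum.cong) (simp_all add: frag_cmul_diff_distrib)

lemma monomial_notin_Q: "prime_elem f \<Longrightarrow> monomial w \<notin> Q f"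
  by (rule unit_notin_Q[OF _ monomial_dvd_1])

lemma single_nonzero: "c \<noteq> 0 \<Longrightarrow> Poly_Mapping.single m c \<noteq> 0"
  using keys_single[of m c] keys_zero by (metis insert_not_empty)

lemma Div_single:
  assumes m: "m \<in> S" and c: "c \<noteq> 0"
  shows "Div (Poly_Mapping.single m c) = E (m v* M)"
proof (rule poly_mapping_eqI)
  fix p
  let ?a = "Poly_Mapping.single m c :: int ^ 3 \<Rightarrow>\<^sub>0 'k"
  have a: "?a \<in> C" "?a \<noteq> 0" using m c by (simp_all add: C_iff single_nonzero)
  show "lookup (Div ?a) p = lookup (E (m v* M)) p"
  proof (cases "p \<in> range P")
    case True
    then obtain i where p: "p = P i" by blast
    have "P i \<in> codim1" unfolding codim1_def by blast
    then show ?thesis unfolding p lookup_E_P lookup_Div[OF a] using ord_P[OF a] val_single[OF c] by simp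
  next
    case False
    have "lookup (Div ?a) p = 0"
    proof (cases "p \<in> codim1")
      case True
      then obtain f where f: "prime_elem f" "p = Q f" using False by (elim codim1_cases) auto
      have "?a \<notin> p" unfolding f(2) using c by (intro unit_notin_Q[OF f(1)] monomial_unit)
      then show ?thesis unfolding lookup_Div[OF a] using ord_eq_0[OF True a(1)] by simp
    qed (simp add: lookup_Div[OF a])
    then show ?thesis using lookup_E_other[OF False] by simp
  qed
qed

lemma S_difference:
  obtains m1 m2 where "m1 \<in> S" "m2 \<in> S" "m = m1 - m2"
proof -
  obtain w where w: "w \<in> S" "(monomial m :: int ^ 3 \<Rightarrow>\<^sub>0 'k) * monomial w \<in> C" using clear_denominators .
  then have "m + w \<in> S" by (simp add: mult_single C_iff)
  then show ?thesis using w(1) by (rule that) simp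
qed

lemma E_lattice_Prin: "E (m v* M) \<in> Prin"
proof -
  obtain m1 m2 where m: "m1 \<in> S" "m2 \<in> S" "m = m1 - m2" using S_difference .
  have "E (m v* M) = Div (monomial m1) - Div (monomial m2)"
    using m by (simp add: Div_single ell_diff E_diff)
  then show ?thesis using m(1,2) by (intro PrinI) (simp_all add: monomial_in_C)
qed

lemma Q_neq_P:
  assumes "prime_elem f"
  shows "Q f \<noteq> P i"
proof
  assume eq: "Q f = P i"
  obtain m where m: "m \<in> S" "(m v* M) $ i = 1" using ell_one .
  then have "monomial m \<in> P i" by (simp add: P_iff_keys monomial_in_C)
  then show False using monomial_notin_Q[OF assms] eq by blast
qed

lemma Div_prime:
  assumes f: "prime_elem f" "f \<in> C"
  shows "Div f = frag_of (Q f) + E (\<chi> i. val i f)"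
proof (rule poly_mapping_eqI)
  fix p
  have f0: "f \<noteq> 0" by (rule prime_elem_nonzero[OF f(1)])
  show "lookup (Div f) p = lookup (frag_of (Q f) + E (\<chi> i. val i f)) p"
  proof (cases "p \<in> range P")
    case True
    then obtain i where p: "p = P i" by blast
    have "P i \<in> codim1" unfolding codim1_def by blast
    then show ?thesis
      unfolding p lookup_add lookup_E_P lookup_Div[OF f(2) f0]
      using ord_P[OF f(2) f0] Q_neq_P[OF f(1), of i] by simp
  next
    case False
    have "lookup (Div f) p = lookup (frag_of (Q f)) p"
    proof (cases "p = Q f")
      case True
      have Qc: "Q f \<in> codim1" unfolding codim1_def using f(1) by simp
      have un: "uniformizer (Q f) f"
        using Q_uniformizer[OF f(1) S_zero] f(2) by simp
      have "1 \<in> C - Q f" using unit_notin_Q[OF f(1), of 1] by (simp add: one_closed)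
      then have "ord (Q f) f = 1"
        using ord_at_eq[OF Q_prime[OF f(1)] un f(2), of 1 1 1] by simp
      then show ?thesis unfolding True lookup_Div[OF f(2) f0] using Qc by simp
    next
      case ne: False
      have "p \<in> codim1 \<Longrightarrow> ord p f = 0"
      proof -
        assume pc: "p \<in> codim1"
        then obtain g where g: "prime_elem g" "p = Q g" using False by (elim codim1_cases) auto
        have "f \<notin> p"
        proof
          assume "f \<in> p"
          then have "g dvd f" unfolding g(2) Q_def by simp
          then have "Q g = Q f" by (rule Q_dvd_eq[OF g(1) f(1)])
          then show False using ne g(2) by simp
        qed
        then show "ord p f = 0" by (rule ord_eq_0[OF pc f(2)])
      qed
      then show ?thesis unfolding lookup_Div[OF f(2) f0] using ne by simp
    qed
    then show ?thesis unfolding lookup_add using lookup_E_other[OF False] by simp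
  qed
qed

lemma mult_monomial_dvd_iff: "f * monomial w dvd b \<longleftrightarrow> f dvd (b :: int ^ 3 \<Rightarrow>\<^sub>0 'k)"
proof
  assume "f * monomial w dvd b"
  then show "f dvd b" by (rule dvd_mult_left)
next
  assume "f dvd b"
  then have "f * monomial w dvd b * monomial w" by (rule mult_dvd_mono[OF _ dvd_refl])
  then show "f * monomial w dvd b" unfolding dvd_mult_monomial_iff .
qed

lemma prime_elem_times_monomial:
  fixes f :: "int ^ 3 \<Rightarrow>\<^sub>0 'k"
  assumes "prime_elem f"
  shows "prime_elem (f * monomial w)"
  unfolding prime_elem_def mult_monomial_dvd_iff
proof (intro conjI)
  show "f * monomial w \<noteq> 0" by (intro laurent_mult_nonzero monomial_nonzero prime_elem_nonzero[OF assms])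
  show "\<not> f dvd 1" by (rule prime_elem_nonunit[OF assms])
  show "\<forall>a b. f dvd a * b \<longrightarrow> f dvd a \<or> f dvd b" using prime_elem_dvd_multE[OF assms] by simp
qed

lemma Q_generator_in_C:
  assumes "prime_elem f"
  shows "\<exists>g. prime_elem g \<and> g \<in> C \<and> Q g = Q f"
proof -
  obtain w where w: "w \<in> S" "f * monomial w \<in> C" using clear_denominators .
  have "Q (f * monomial w) = Q f" by (simp add: Q_def mult_monomial_dvd_iff)
  then show ?thesis using w(2) prime_elem_times_monomial[OF assms]
    by (intro exI[of _ "f * monomial w"]) simp
qed

definition gen :: "(int ^ 3 \<Rightarrow>\<^sub>0 'k) set \<Rightarrow> int ^ 3 \<Rightarrow>\<^sub>0 'k" where
  "gen p = (SOME g. prime_elem g \<and> g \<in> C \<and> Q g = p)"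

lemma gen:
  assumes "prime_elem f"
  shows "prime_elem (gen (Q f))" "gen (Q f) \<in> C" "Q (gen (Q f)) = Q f"
  using someI_ex[OF Q_generator_in_C[OF assms]] unfolding gen_def by simp_all

text \<open>
  The value at a prime that meets the torus is chosen such that the divisor of its generator, which is
  the prime plus the orders of the generator along the rays, gets weight \<open>0\<close>.
\<close>

definition wt :: "(int ^ 3 \<Rightarrow>\<^sub>0 'k) set \<Rightarrow> int ^ 3" where
  "wt p = (if p \<in> range P then axis (THE i. p = P i) 1 else - (\<chi> i. val i (gen p)))"

lemma wt_P: "wt (P i) = axis i 1"
proof -
  have "(THE j. P i = P j) = i" by (rule the_equality) (auto dest: P_inj)
  then show ?thesis by (simp add: wt_def)
qed

lemma wt_Q: "prime_elem f \<Longrightarrow> wt (Q f) = - (\<chi> i. val i (gen (Q f)))"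
  using Q_neq_P by (auto simp: wt_def)

lemma weigh_E: "weigh wt (E n) = n"
proof -
  have "weigh wt (\<Sum>i\<in>I. frag_cmul (n $ i) (frag_of (P i))) = (\<Sum>i\<in>I. n $ i *s axis i 1)"
    if "finite I" for I
    using that
    by (induction I rule: finite_induct)
      (simp_all add: weigh_zero weigh_add weigh_cmul weigh_frag_of wt_P)
  then have "weigh wt (E n) = (\<Sum>i\<in>UNIV. n $ i *s axis i 1)" unfolding E_def by simp
  also have "\<dots> = n" by (simp add: vec_eq_iff axis_def sum_3 forall_3)
  finally show ?thesis .
qed

lemma weigh_Div_gen:
  assumes "prime_elem f"
  shows "weigh wt (Div (gen (Q f))) = 0"
  unfolding Div_prime[OF gen(1,2)[OF assms]] weigh_add weigh_frag_of weigh_E gen(3)[OF assms] wt_Q[OF assms]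
  by simp

abbreviation lattice where "lattice \<equiv> range (\<lambda>m. m v* M)"

lemma lattice_add: "x \<in> lattice \<Longrightarrow> y \<in> lattice \<Longrightarrow> x + y \<in> lattice"
  and lattice_diff: "x \<in> lattice \<Longrightarrow> y \<in> lattice \<Longrightarrow> x - y \<in> lattice"
  by (auto simp flip: ell_add ell_diff)

lemma weigh_Div_single:
  assumes "m \<in> S" "c \<noteq> 0"
  shows "weigh wt (Div (Poly_Mapping.single m c)) \<in> lattice"
  unfolding Div_single[OF assms] weigh_E by simp

text \<open>
  Up to a unit of the Laurent polynomial ring, which is a term, \<open>f\<close> is the chosen generator of \<open>Q f\<close>,
  whose divisor has weight \<open>0\<close>.
\<close>

lemma weigh_Div_prime:
  assumes f: "prime_elem f" "f \<in> C"
  shows "weigh wt (Div f) \<in> lattice"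
proof -
  let ?g = "gen (Q f)"
  note g = gen[OF f(1)]
  have f0: "f \<noteq> 0" and g0: "?g \<noteq> 0" using f(1) g(1) by (simp_all add: prime_elem_nonzero)
  have "f \<in> Q ?g" unfolding g(3) using f(2) by (simp add: Q_def)
  then have "?g dvd f" by (simp add: Q_def)
  then obtain c where c: "c dvd 1" "f = ?g * c" using laurent_prime_dvd_prime[OF g(1) f(1)] by metis
  obtain m k where k: "k \<noteq> 0" "c = Poly_Mapping.single m k" using laurent_unit_is_term[OF c(1)] .
  obtain m1 m2 where m: "m1 \<in> S" "m2 \<in> S" "m = m1 - m2" using S_difference .
  have m2: "(monomial m2 :: int ^ 3 \<Rightarrow>\<^sub>0 'k) \<in> C" "(monomial m2 :: int ^ 3 \<Rightarrow>\<^sub>0 'k) \<noteq> 0"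
    using m(2) by (simp_all add: monomial_in_C)
  have m1: "(Poly_Mapping.single m1 k :: int ^ 3 \<Rightarrow>\<^sub>0 'k) \<in> C" "(Poly_Mapping.single m1 k :: int ^ 3 \<Rightarrow>\<^sub>0 'k) \<noteq> 0"
    using m(1) k(1) by (simp_all add: C_iff single_nonzero)
  have "c * monomial m2 = Poly_Mapping.single m1 k" by (simp add: k(2) m(3) mult_single)
  then have "f * monomial m2 = ?g * Poly_Mapping.single m1 k"
    by (subst c(2)) (simp only: mult.assoc)
  then have "Div f + Div (monomial m2) = Div ?g + Div (Poly_Mapping.single m1 k)"
    by (simp only: Div_mult[OF f(2) f0 m2, symmetric] Div_mult[OF g(2) g0 m1, symmetric])
  then have "Div f = Div ?g + Div (Poly_Mapping.single m1 k) - Div (monomial m2)"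
    by (simp add: eq_diff_eq)
  then have "weigh wt (Div f) = weigh wt (Div (Poly_Mapping.single m1 k)) - weigh wt (Div (monomial m2))"
    by (simp add: weigh_add weigh_diff weigh_Div_gen[OF f(1)])
  also have "\<dots> \<in> lattice"
    using m(1,2) k(1) by (intro lattice_diff weigh_Div_single) simp_all
  finally show ?thesis .
qed

text \<open>
  Both the divisor and its weight are additive under products, and multiplication by a monomial
  changes the weight by an element of the lattice. So the claim passes from the prime factors of \<open>a\<close>,
  each moved into the ring by a monomial, to \<open>a\<close>.
\<close>

lemma weigh_Div:
  assumes a: "a \<in> C" "a \<noteq> 0"
  shows "weigh wt (Div a) \<in> lattice"
proof -
  have *: "weigh wt (Div (u * prod_mset F)) \<in> lattice"
    if "\<forall>f\<in>#F. prime_elem f" "u dvd 1" "u * prod_mset F \<in> C" for u F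
    using that
  proof (induction F arbitrary: u)
    case empty
    obtain m k where k: "k \<noteq> 0" "u = Poly_Mapping.single m k" using laurent_unit_is_term[OF empty.prems(2)] .
    have "m \<in> S" using empty.prems(3) k by (simp add: C_iff)
    from weigh_Div_single[OF this k(1)] show ?case by (simp add: k(2))
  next
    case (add f F)
    have f: "prime_elem f" and F: "\<forall>f\<in>#F. prime_elem f" using add.prems(1) by simp_all
    obtain w where w: "w \<in> S" "f * monomial w \<in> C" using clear_denominators .
    obtain w' where w': "w' \<in> S" "(u * prod_mset F) * monomial w' \<in> C" using clear_denominators .
    have u0: "u \<noteq> 0" using add.prems(2) by auto
    have F0: "prod_mset F \<noteq> 0"
      using F by (induction F) (simp_all add: laurent_mult_nonzero prime_elem_nonzero)
    let ?a = "u * prod_mset (add_mset f F)" and ?f = "f * monomial w"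
      and ?b = "(u * monomial w') * prod_mset F"
    let ?m = "monomial (w + w') :: int ^ 3 \<Rightarrow>\<^sub>0 'k"
    have b_eq: "?b = (u * prod_mset F) * monomial w'" by (simp only: ac_simps)
    have aC: "?a \<in> C" by (rule add.prems(3))
    have f0: "f \<noteq> 0" by (rule prime_elem_nonzero[OF f])
    have a0: "?a \<noteq> 0" unfolding prod_mset.add_mset by (intro laurent_mult_nonzero u0 F0 f0)
    have bC: "?b \<in> C" unfolding b_eq by (rule w'(2))
    have b0: "?b \<noteq> 0" by (intro laurent_mult_nonzero u0 F0 monomial_nonzero)
    have ff0: "?f \<noteq> 0" by (intro laurent_mult_nonzero f0 monomial_nonzero)
    have ww: "w + w' \<in> S" by (rule S_add[OF w(1) w'(1)])
    have "?m = monomial w * monomial w'" by (simp add: mult_single)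
    then have "?a * ?m = ?f * ?b" by (simp only: prod_mset.add_mset ac_simps)
    then have "Div ?a + Div ?m = Div ?f + Div ?b"
      by (simp only: Div_mult[OF aC a0 monomial_in_C[OF ww] monomial_nonzero, symmetric] Div_mult[OF w(2) ff0 bC b0, symmetric])
    then have "Div ?a = Div ?f + Div ?b - Div ?m" by (simp add: eq_diff_eq)
    then have "weigh wt (Div ?a) = weigh wt (Div ?f) + weigh wt (Div ?b) - weigh wt (Div ?m)"
      by (simp only: weigh_add weigh_diff)
    also have "\<dots> \<in> lattice"
    proof (intro lattice_diff lattice_add)
      have "prime_elem ?f"
        by (rule prime_elem_times_monomial[OF f])
      then show "weigh wt (Div ?f) \<in> lattice" using w(2) by (rule weigh_Div_prime)
      show "weigh wt (Div ?b) \<in> lattice"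
        by (rule add.IH[OF F unit_mult[OF add.prems(2) monomial_dvd_1] bC])
      show "weigh wt (Div ?m) \<in> lattice" by (rule weigh_Div_single[OF ww]) simp
    qed
    finally show ?case .
  qed
  obtain u F where uF: "u dvd 1" "\<forall>f\<in>#F. prime_elem f" "a = u * prod_mset F"
    using laurent_prime_factorization[OF a(2)] by (elim exE conjE)
  show ?thesis using *[OF uF(2,1)] a(1) unfolding uF(3) .
qed

text \<open>
  Subtracting the divisor of its generator replaces a prime that meets the torus by a boundary
  divisor of the same weight.
\<close>

lemma divisor_class_toric:
  assumes "keys D \<subseteq> codim1"
  shows "D - E (weigh wt D) \<in> Prin"
proof (rule free_Abelian_group_induct[where P = "\<lambda>D. D - E (weigh wt D) \<in> Prin", OF assms])
  have "E 0 = 0" using E_diff[of 0 0] by simp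
  then show "0 - E (weigh wt 0) \<in> Prin" by (simp add: weigh_zero Prin_zero)
next
  fix x y assume xy: "x - E (weigh wt x) \<in> Prin" "y - E (weigh wt y) \<in> Prin"
  have eq: "x - y - E (weigh wt (x - y)) = (x - E (weigh wt x)) - (y - E (weigh wt y))"
    by (simp add: weigh_diff E_diff)
  show "x - y - E (weigh wt (x - y)) \<in> Prin" unfolding eq by (rule Prin_diff[OF xy])
next
  fix p assume "p \<in> codim1"
  then show "frag_of p - E (weigh wt (frag_of p)) \<in> Prin"
  proof (cases rule: codim1_cases)
    case (1 i)
    have "frag_of (P i) = E (axis i 1)"
    proof (rule poly_mapping_eqI)
      fix q
      show "lookup (frag_of (P i)) q = lookup (E (axis i 1)) q"
      proof (cases "q \<in> range P")
        case True
        then obtain j where j: "q = P j" by blast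
        show ?thesis unfolding j lookup_E_P using P_inj[of i j] by (auto simp: axis_def)
      next
        case False
        then show ?thesis using lookup_E_other[OF False] by auto
      qed
    qed
    then show ?thesis by (simp add: 1 weigh_E Prin_zero)
  next
    case (2 f)
    note g = gen[OF 2(1)]
    have "E (- (\<chi> i. val i (gen (Q f)))) = - E (\<chi> i. val i (gen (Q f)))"
      using E_diff[of 0] E_diff[of 0 0] by simp
    then have "frag_of p - E (weigh wt (frag_of p)) = Div (gen (Q f))"
      unfolding 2(2) weigh_frag_of wt_Q[OF 2(1)] Div_prime[OF g(1,2)] g(3) by simp
    then show ?thesis using Prin_Div[OF g(2) prime_elem_nonzero[OF g(1)]] by simp
  qed
qed

text \<open>
  A divisor is principal if and only if its weight lies in the lattice. So the boundary divisors whose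
  multiplicities represent the lattice cosets represent the divisor classes.
\<close>

theorem chow_group1_order:
  "finite (carrier (chow_group1 R)) \<and> int (order (chow_group1 R)) = \<bar>det M\<bar>"
proof -
  obtain T where T: "finite T" "int (card T) = \<bar>det M\<bar>" "\<forall>z. \<exists>!r. r \<in> T \<and> z - r \<in> lattice"
    using lattice_index[OF det_nonzero] by (elim exE conjE)
  have "bij_betw (\<lambda>r. Prin #>\<^bsub>free_Abelian_group codim1\<^esub> E r) T (carrier (free_Abelian_group codim1 Mod Prin))"
  proof (rule transversal_bij_cosets[OF Prin_zero Prin_diff keys_E])
    fix D :: "(int ^ 3 \<Rightarrow>\<^sub>0 'k) set \<Rightarrow>\<^sub>0 int" assume D: "keys D \<subseteq> codim1"
    have "\<exists>r. r \<in> T \<and> weigh wt D - r \<in> lattice" by (rule ex1_implies_ex[OF T(3)[rule_format]])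
    then obtain r where r: "r \<in> T" "weigh wt D - r \<in> lattice" by (elim exE conjE)
    from r(2) obtain m where m: "weigh wt D - r = m v* M" by (rule rangeE)
    have "E (weigh wt D - r) \<in> Prin" unfolding m by (rule E_lattice_Prin)
    then have "(D - E (weigh wt D)) + E (weigh wt D - r) \<in> Prin"
      by (rule Prin_add[OF divisor_class_toric[OF D]])
    then have "D - E r \<in> Prin" by (simp add: E_diff)
    then show "\<exists>r\<in>T. D - E r \<in> Prin" using r(1) by (rule bexI)
  next
    fix r r' assume r: "r \<in> T" "r' \<in> T" "E r - E r' \<in> Prin"
    obtain a b where ab: "a \<in> C" "a \<noteq> 0" "b \<in> C" "b \<noteq> 0" "E r - E r' = Div a - Div b"
      using r(3) by (rule PrinE)
    have "r - r' = weigh wt (E r - E r')" by (simp add: weigh_diff weigh_E)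
    also have "\<dots> \<in> lattice"
      unfolding ab(5) weigh_diff by (intro lattice_diff weigh_Div ab)
    finally have r': "r - r' \<in> lattice" .
    have "0 v* M - 0 v* M \<in> lattice" by (rule lattice_diff) (rule rangeI)+
    then have r0: "r - r \<in> lattice" by (simp only: diff_self)
    obtain s where s: "\<forall>t. t \<in> T \<and> r - t \<in> lattice \<longrightarrow> t = s"
      using T(3)[rule_format, of r] by (rule ex1E) (rule that)
    have "r = s" using s r(1) r0 by simp
    moreover have "r' = s" using s r(2) r' by simp
    ultimately show "r = r'" by simp
  qed
  then have bij: "bij_betw (\<lambda>r. Prin #>\<^bsub>free_Abelian_group codim1\<^esub> E r) T (carrier (chow_group1 R))"
    unfolding chow_group1_def codim1_points_R .
  have "finite (carrier (chow_group1 R))" using bij_betw_finite[OF bij] T(1) by simp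
  moreover have "card (carrier (chow_group1 R)) = card T" using bij_betw_same_card[OF bij] by simp
  ultimately show ?thesis using T(2) by (simp add: order_def)
qed

end

theorem theorem4p4:
  fixes \<sigma> :: "(real ^ 3) set" and M :: "int ^ 3 ^ 3"
  assumes "simplicial_cone \<sigma>" and "dim \<sigma> = 3"
    and "columns M = minimal_generators \<sigma>"
  shows "finite (carrier (chow_group1 (toric_ring \<sigma> :: (int ^ 3 \<Rightarrow>\<^sub>0 'k::field) ring))) \<and>
    int (order (chow_group1 (toric_ring \<sigma> :: (int ^ 3 \<Rightarrow>\<^sub>0 'k::field) ring))) = \<bar>det M\<bar>"
proof -
  have dim: "dim \<sigma> = CARD(3)" using assms(2) by simp
  note \<sigma> = full_cone_generator_matrix[OF assms(1) dim assms(3)]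
  define C :: "(int ^ 3 \<Rightarrow>\<^sub>0 'k) set" where "C = {f. keys f \<subseteq> {m. \<forall>i. 0 \<le> (m v* M) $ i}}"
  interpret simplicial_toric M C
    by unfold_locales (use \<sigma>(1,2) in \<open>simp_all add: C_def\<close>)
  have "(toric_ring \<sigma> :: (int ^ 3 \<Rightarrow>\<^sub>0 'k) ring) = R"
    unfolding R_def unfolding toric_ring_def semigroup_algebra_def C_def \<sigma>(3) ..
  then show ?thesis using chow_group1_order by simp
qed

end
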